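(* Let $n\ge4$ and $c\ge2$ be integers, $N=\frac{n(n-1)}{2}$, and set $\mathcal{T}_n(c)=\{t\in\mathcal{T}_n:\gcd(t,c)=1\}$. For $t\in\mathbb{Z}$ let $F_{t,c}(X)=X^n+c^{n-1}tX+c^nt\in\mathbb{Z}[X]$, let $\theta_{t,c}$ be any root of $F_{t,c}$, and $K_{t,c}=\mathbb{Q}(\theta_{t,c})$. Then $\mathcal{T}_n(c)$ has positive natural density in $\mathbb{Z}$, and for every $t\in\mathcal{T}_n(c)$ the field $K_{t,c}$ is ABS-unobstructed while $$[\mathcal{O}_{K_{t,c}}:\mathbb{Z}[\theta_{t,c}]]=c^N>1.$$ In particular, the one-parameter family $\{K_{t,c}\}_{t\in\mathbb{Z}}$ contains a positive-density set of parameters $t$ for which (i) the ABS fixed-sign local condition holds and (ii) $\mathbb{Z}[\theta_{t,c}]$ is a proper suborder of $\mathcal{O}_{K_{t,c}}$ of fixed index $c^N$.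
   Context: Let $C_{0,n}=(-1)^{n(n-1)/2}n^n$, $C_{1,n}=(-1)^{(n-1)(n-2)/2}(n-1)^{n-1}$, and $L_n(t)=C_{0,n}+C_{1,n}t$. Define $$\mathcal{T}_n=\{t\in\mathbb{Z}:|t|>1,\ \gcd(t,n(n-1))=1,\ t\,L_n(t)\text{ is squarefree}\}.$$ Natural density of $A\subseteq\mathbb{Z}$ is $\lim_{X\to\infty}\#\{t\in A:|t|\le X\}/(2X)$. For a number field $K$ of degree $n$ with ring of integers $\mathcal{O}_K$, an orientation is a generator $\omega$ of $\bigwedge^n_{\mathbb{Z}}\mathcal{O}_K\cong\mathbb{Z}$, and the index form $f_{K,\omega}:\mathcal{O}_K\to\mathbb{Z}$ is defined by $1\wedge\beta\wedge\cdots\wedge\beta^{n-1}=f_{K,\omega}(\beta)\,\omega$; it extends by the same formula to $\mathcal{O}_K\otimes_{\mathbb{Z}}\mathbb{Z}_\ell\to\mathbb{Z}_\ell$. $K$ is ABS-unobstructed (satisfies the ABS fixed-sign local condition) if there exist an orientation $\omega$ and $\varepsilon\in\{\pm1\}$ such that for every rational prime $\ell$ the equation $f_{K,\omega}(x)=\varepsilon$ has a solution in $\mathcal{O}_K\otimes_{\mathbb{Z}}\mathbb{Z}_\ell$. *)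

theory Defs
  imports
    Complex_Main
    "HOL-Computational_Algebra.Polynomial"
    "HOL-Computational_Algebra.Squarefree"
    "HOL-Library.Poly_Mapping"
    "HOL-Algebra.IntRing"
    "HOL-Algebra.QuotRing"
    "HOL-Algebra.Module"
    "HOL-Algebra.Embedded_Algebras"
    "HOL-Algebra.Generated_Fields"
begin

hide_const (open) Polynomial.smult

section \<open>Parameters and density\<close>

definition C0 :: "nat \<Rightarrow> int" where
  "C0 n = (- 1) ^ (n * (n - 1) div 2) * int n ^ n"

definition C1 :: "nat \<Rightarrow> int" where
  "C1 n = (- 1) ^ ((n - 1) * (n - 2) div 2) * int (n - 1) ^ (n - 1)"

definition L_form :: "nat \<Rightarrow> int \<Rightarrow> int" where
  "L_form n t = C0 n + C1 n * t"

definition T_set :: "nat \<Rightarrow> int set" where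
  "T_set n = {t. \<bar>t\<bar> > 1 \<and> gcd t (int (n * (n - 1))) = 1 \<and> squarefree (t * L_form n t)}"

definition T_set_coprime :: "nat \<Rightarrow> int \<Rightarrow> int set" where
  "T_set_coprime n c = {t \<in> T_set n. gcd t c = 1}"

definition has_natural_density :: "int set \<Rightarrow> real \<Rightarrow> bool" where
  "has_natural_density A d \<longleftrightarrow>
     ((\<lambda>X::real. real (card {t \<in> A. real_of_int \<bar>t\<bar> \<le> X}) / (2 * X)) \<longlongrightarrow> d) at_top"

definition has_positive_density :: "int set \<Rightarrow> bool" where
  "has_positive_density A \<longleftrightarrow> (\<exists>d>0. has_natural_density A d)"


section \<open>Number fields\<close>

text \<open>Number fields are realised as subfields of the complex numbers.\<close>

definition complex_ring :: "complex ring" where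
  "complex_ring = \<lparr>carrier = UNIV, mult = (*), one = 1, zero = 0, add = (+)\<rparr>"

definition number_field :: "complex set \<Rightarrow> bool" where
  "number_field K \<longleftrightarrow>
     subfield K complex_ring \<and> (\<exists>n. ring.dimension complex_ring n \<rat> K)"

definition field_degree :: "complex set \<Rightarrow> nat" where
  "field_degree K = (THE n. ring.dimension complex_ring n \<rat> K)"

text \<open>The ring of integers, together with its structure of an algebra over the integers.\<close>

definition ring_of_integers :: "complex set \<Rightarrow> (int, complex) module" where
  "ring_of_integers K =
     \<lparr>carrier = {x \<in> K. algebraic_int x}, mult = (*), one = 1, zero = 0, add = (+),
      smult = (\<lambda>k x. of_int k * x)\<rparr>"

text \<open>An order of \<open>K\<close>: a subring that is finitely generated as an additive group and whose
  rational multiples exhaust \<open>K\<close>.\<close>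

definition is_order :: "complex set \<Rightarrow> complex set \<Rightarrow> bool" where
  "is_order S K \<longleftrightarrow>
     subring S complex_ring \<and> S \<subseteq> K \<and>
     (\<exists>B. finite B \<and> S = {\<Sum>b\<in>B. of_int (k b) * b |k :: complex \<Rightarrow> int. True}) \<and>
     (\<forall>x\<in>K. \<exists>m::int. m \<noteq> 0 \<and> of_int m * x \<in> S)"

definition additive_index :: "('a, 'b) ring_scheme \<Rightarrow> 'a set \<Rightarrow> nat" where
  "additive_index R S = card (a_rcosets\<^bsub>R\<^esub> S)"


section \<open>Exterior powers\<close>

text \<open>The free module over \<open>R\<close> with basis \<open>S\<close>, as finitely supported functions. The fields
  \<open>mult\<close> and \<open>one\<close> of the record are irrelevant for modules.\<close>

definition free_module ::
    "('r, 'x) ring_scheme \<Rightarrow> 'a set \<Rightarrow> ('r, 'a \<Rightarrow> 'r) module" where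
  "free_module R S =
     \<lparr>carrier = {f. range f \<subseteq> carrier R \<and> finite {x. f x \<noteq> \<zero>\<^bsub>R\<^esub>} \<and> {x. f x \<noteq> \<zero>\<^bsub>R\<^esub>} \<subseteq> S},
      mult = undefined, one = undefined,
      zero = (\<lambda>x. \<zero>\<^bsub>R\<^esub>), add = (\<lambda>f g x. f x \<oplus>\<^bsub>R\<^esub> g x),
      smult = (\<lambda>r f x. r \<otimes>\<^bsub>R\<^esub> f x)\<rparr>"

definition basis_vec :: "('r, 'x) ring_scheme \<Rightarrow> 'a \<Rightarrow> 'a \<Rightarrow> 'r" where
  "basis_vec R a = (\<lambda>x. if x = a then \<one>\<^bsub>R\<^esub> else \<zero>\<^bsub>R\<^esub>)"

definition generated_submodule ::
    "('r, 'x) ring_scheme \<Rightarrow> ('r, 'm, 'y) module_scheme \<Rightarrow> 'm set \<Rightarrow> 'm set" where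
  "generated_submodule R M G = \<Inter>{N. submodule N R M \<and> G \<subseteq> N}"

definition quotient_module ::
    "('r, 'm, 'y) module_scheme \<Rightarrow> 'm set \<Rightarrow> ('r, 'm set) module" where
  "quotient_module M N =
     \<lparr>carrier = a_rcosets\<^bsub>M\<^esub> N, mult = undefined, one = undefined,
      zero = N, add = set_add M,
      smult = (\<lambda>r X. \<Union>x\<in>X. N +>\<^bsub>M\<^esub> (r \<odot>\<^bsub>M\<^esub> x))\<rparr>"

definition tuples :: "nat \<Rightarrow> ('m, 'y) ring_scheme \<Rightarrow> 'm list set" where
  "tuples n M = {xs. length xs = n \<and> set xs \<subseteq> carrier M}"

text \<open>Multilinearity in each slot, and vanishing on tuples with a repeated entry.\<close>

definition wedge_relations ::
    "('r, 'x) ring_scheme \<Rightarrow> nat \<Rightarrow> ('r, 'm, 'y) module_scheme \<Rightarrow> ('m list \<Rightarrow> 'r) set" where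
  "wedge_relations R n M =
     (let F = free_module R (tuples n M); e = basis_vec R in
      {e (xs[i := u \<oplus>\<^bsub>M\<^esub> v]) \<ominus>\<^bsub>F\<^esub> (e (xs[i := u]) \<oplus>\<^bsub>F\<^esub> e (xs[i := v])) |xs i u v.
         xs \<in> tuples n M \<and> i < n \<and> u \<in> carrier M \<and> v \<in> carrier M} \<union>
      {e (xs[i := r \<odot>\<^bsub>M\<^esub> u]) \<ominus>\<^bsub>F\<^esub> (r \<odot>\<^bsub>F\<^esub> e (xs[i := u])) |xs i r u.
         xs \<in> tuples n M \<and> i < n \<and> r \<in> carrier R \<and> u \<in> carrier M} \<union>
      {e xs |xs. xs \<in> tuples n M \<and> (\<exists>i j. i < j \<and> j < n \<and> xs ! i = xs ! j)})"

definition wedge_kernel ::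
    "('r, 'x) ring_scheme \<Rightarrow> nat \<Rightarrow> ('r, 'm, 'y) module_scheme \<Rightarrow> ('m list \<Rightarrow> 'r) set" where
  "wedge_kernel R n M =
     generated_submodule R (free_module R (tuples n M)) (wedge_relations R n M)"

definition exterior_power ::
    "('r, 'x) ring_scheme \<Rightarrow> nat \<Rightarrow> ('r, 'm, 'y) module_scheme
       \<Rightarrow> ('r, ('m list \<Rightarrow> 'r) set) module" where
  "exterior_power R n M = quotient_module (free_module R (tuples n M)) (wedge_kernel R n M)"

text \<open>The pure wedge \<open>x\<^sub>1 \<and> \<dots> \<and> x\<^sub>n\<close> of the entries of a list of length \<open>n\<close>.\<close>

definition wedge ::
    "('r, 'x) ring_scheme \<Rightarrow> ('r, 'm, 'y) module_scheme \<Rightarrow> 'm list \<Rightarrow> ('m list \<Rightarrow> 'r) set" where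
  "wedge R M xs =
     wedge_kernel R (length xs) M +>\<^bsub>free_module R (tuples (length xs) M)\<^esub> basis_vec R xs"

text \<open>The map of exterior powers induced by a ring homomorphism \<open>h\<close> from \<open>R\<close> to \<open>R'\<close> and an
  \<open>h\<close>-semilinear map \<open>g\<close> from \<open>M\<close> to \<open>M'\<close>. It sends the class of the formal sum of the
  \<open>r\<^sub>i xs\<^sub>i\<close> to the sum of the \<open>h r\<^sub>i\<close> times the wedge of \<open>map g xs\<^sub>i\<close>; the image set is a
  singleton because this does not depend on the representative.\<close>

definition exterior_map ::
    "('r, 'x) ring_scheme \<Rightarrow> ('s, 'z) ring_scheme \<Rightarrow> nat \<Rightarrow> ('s, 'k, 'w) module_scheme
       \<Rightarrow> ('r \<Rightarrow> 's) \<Rightarrow> ('m \<Rightarrow> 'k) \<Rightarrow> ('m list \<Rightarrow> 'r) set \<Rightarrow> ('k list \<Rightarrow> 's) set" where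
  "exterior_map R R' n M' h g \<omega> =
     the_elem
       ((\<lambda>f. \<Oplus>\<^bsub>exterior_power R' n M'\<^esub> xs \<in> {xs. f xs \<noteq> \<zero>\<^bsub>R\<^esub>}.
                h (f xs) \<odot>\<^bsub>exterior_power R' n M'\<^esub> wedge R' M' (map g xs)) ` \<omega>)"

text \<open>The coefficient \<open>r\<close> in \<open>1 \<and> x \<and> \<dots> \<and> x\<^sup>n\<^sup>-\<^sup>1 = r \<omega>\<close>, for an element \<open>x\<close> of
  an algebra \<open>A\<close> over \<open>R\<close>.\<close>

definition index_coeff ::
    "('r, 'x) ring_scheme \<Rightarrow> nat \<Rightarrow> ('r, 'm, 'y) module_scheme
       \<Rightarrow> ('m list \<Rightarrow> 'r) set \<Rightarrow> 'm \<Rightarrow> 'r" where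
  "index_coeff R n A \<omega> x =
     (THE r. r \<in> carrier R \<and>
        wedge R A (map (\<lambda>i. x [^]\<^bsub>A\<^esub> i) [0..<n]) = r \<odot>\<^bsub>exterior_power R n A\<^esub> \<omega>)"


section \<open>Base change to the p-adic integers\<close>

text \<open>The \<open>l\<close>-adic integers as the inverse limit of the integers modulo \<open>l ^ k\<close>, an element
  being the compatible sequence of its least nonnegative residues.\<close>

definition padic_int_ring :: "nat \<Rightarrow> (nat \<Rightarrow> int) ring" where
  "padic_int_ring l =
     \<lparr>carrier = {x. \<forall>k. 0 \<le> x k \<and> x k < int l ^ k \<and> x (Suc k) mod int l ^ k = x k},
      mult = (\<lambda>x y k. (x k * y k) mod int l ^ k),
      one = (\<lambda>k. 1 mod int l ^ k),
      zero = (\<lambda>k. 0),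
      add = (\<lambda>x y k. (x k + y k) mod int l ^ k)\<rparr>"

definition padic_of_int :: "nat \<Rightarrow> int \<Rightarrow> nat \<Rightarrow> int" where
  "padic_of_int l a = (\<lambda>k. a mod int l ^ k)"

text \<open>The tensor product of two commutative rings over the integers: the monoid ring of the
  product of their multiplicative monoids (the free abelian group on pairs), modulo
  biadditivity. The additive subgroup spanned by the biadditivity relations is already an ideal,
  so the underlying group is the usual tensor product of abelian groups.\<close>

definition pair_monoid_ring ::
    "('a, 'x) ring_scheme \<Rightarrow> ('b, 'y) ring_scheme \<Rightarrow> ('a \<times> 'b \<Rightarrow>\<^sub>0 int) ring" where
  "pair_monoid_ring A B =
     \<lparr>carrier = {f. Poly_Mapping.keys f \<subseteq> carrier A \<times> carrier B},
      mult = (\<lambda>f g. frag_extend (\<lambda>(a, b). frag_extend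
                (\<lambda>(a', b'). frag_of (a \<otimes>\<^bsub>A\<^esub> a', b \<otimes>\<^bsub>B\<^esub> b')) g) f),
      one = frag_of (\<one>\<^bsub>A\<^esub>, \<one>\<^bsub>B\<^esub>), zero = 0, add = (+)\<rparr>"

definition tensor_relations ::
    "('a, 'x) ring_scheme \<Rightarrow> ('b, 'y) ring_scheme \<Rightarrow> ('a \<times> 'b \<Rightarrow>\<^sub>0 int) set" where
  "tensor_relations A B =
     {frag_of (a \<oplus>\<^bsub>A\<^esub> a', b) - frag_of (a, b) - frag_of (a', b) |a a' b.
        a \<in> carrier A \<and> a' \<in> carrier A \<and> b \<in> carrier B} \<union>
     {frag_of (a, b \<oplus>\<^bsub>B\<^esub> b') - frag_of (a, b) - frag_of (a, b') |a b b'.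
        a \<in> carrier A \<and> b \<in> carrier B \<and> b' \<in> carrier B}"

definition tensor_ideal ::
    "('a, 'x) ring_scheme \<Rightarrow> ('b, 'y) ring_scheme \<Rightarrow> ('a \<times> 'b \<Rightarrow>\<^sub>0 int) set" where
  "tensor_ideal A B = Idl\<^bsub>pair_monoid_ring A B\<^esub> (tensor_relations A B)"

definition pure_tensor ::
    "('a, 'x) ring_scheme \<Rightarrow> ('b, 'y) ring_scheme \<Rightarrow> 'a \<Rightarrow> 'b \<Rightarrow> ('a \<times> 'b \<Rightarrow>\<^sub>0 int) set" where
  "pure_tensor A B a b = tensor_ideal A B +>\<^bsub>pair_monoid_ring A B\<^esub> frag_of (a, b)"

text \<open>The tensor product of \<open>A\<close> and \<open>B\<close> as an algebra over \<open>B\<close>.\<close>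

definition base_change ::
    "('a, 'x) ring_scheme \<Rightarrow> ('b, 'y) ring_scheme \<Rightarrow> ('b, ('a \<times> 'b \<Rightarrow>\<^sub>0 int) set) module" where
  "base_change A B =
     (let Q = pair_monoid_ring A B Quot tensor_ideal A B in
      \<lparr>carrier = carrier Q, mult = mult Q, one = one Q, zero = zero Q, add = add Q,
       smult = (\<lambda>b x. pure_tensor A B \<one>\<^bsub>A\<^esub> b \<otimes>\<^bsub>Q\<^esub> x)\<rparr>)"


section \<open>Index forms and the local condition\<close>

definition orientation :: "complex set \<Rightarrow> (complex list \<Rightarrow> int) set \<Rightarrow> bool" where
  "orientation K \<omega> \<longleftrightarrow>
     (let W = exterior_power \<Z> (field_degree K) (ring_of_integers K) in
      \<omega> \<in> carrier W \<and> carrier W = {k \<odot>\<^bsub>W\<^esub> \<omega> |k. k \<in> carrier \<Z>})"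

definition index_form :: "complex set \<Rightarrow> (complex list \<Rightarrow> int) set \<Rightarrow> complex \<Rightarrow> int" where
  "index_form K \<omega> = index_coeff \<Z> (field_degree K) (ring_of_integers K) \<omega>"

definition local_integers ::
    "complex set \<Rightarrow> nat \<Rightarrow> (nat \<Rightarrow> int, (complex \<times> (nat \<Rightarrow> int) \<Rightarrow>\<^sub>0 int) set) module" where
  "local_integers K l = base_change (ring_of_integers K) (padic_int_ring l)"

text \<open>The orientation over the \<open>l\<close>-adic integers is the image of \<open>\<omega>\<close>.\<close>

definition local_index_form ::
    "complex set \<Rightarrow> (complex list \<Rightarrow> int) set \<Rightarrow> nat
       \<Rightarrow> (complex \<times> (nat \<Rightarrow> int) \<Rightarrow>\<^sub>0 int) set \<Rightarrow> (nat \<Rightarrow> int)" where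
  "local_index_form K \<omega> l =
     index_coeff (padic_int_ring l) (field_degree K) (local_integers K l)
       (exterior_map \<Z> (padic_int_ring l) (field_degree K) (local_integers K l)
          (padic_of_int l)
          (\<lambda>a. pure_tensor (ring_of_integers K) (padic_int_ring l) a \<one>\<^bsub>padic_int_ring l\<^esub>)
          \<omega>)"

definition ABS_unobstructed :: "complex set \<Rightarrow> bool" where
  "ABS_unobstructed K \<longleftrightarrow>
     number_field K \<and>
     (\<exists>\<omega>. orientation K \<omega> \<and>
       (\<exists>\<epsilon>\<in>{1, - 1}. \<forall>l. prime l \<longrightarrow>
          (\<exists>x\<in>carrier (local_integers K l). local_index_form K \<omega> l x = padic_of_int l \<epsilon>)))"


section \<open>The family\<close>

definition F_poly :: "nat \<Rightarrow> int \<Rightarrow> int \<Rightarrow> int poly" where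
  "F_poly n c t = [:0, 1:] ^ n + [:c ^ n * t, c ^ (n - 1) * t:]"

definition is_root_F :: "nat \<Rightarrow> int \<Rightarrow> int \<Rightarrow> complex \<Rightarrow> bool" where
  "is_root_F n c t \<theta> \<longleftrightarrow> poly (map_poly of_int (F_poly n c t)) \<theta> = 0"

definition rationals_adjoin :: "complex \<Rightarrow> complex set" where
  "rationals_adjoin \<theta> = generate_field complex_ring {\<theta>}"

definition integers_adjoin :: "complex \<Rightarrow> complex set" where
  "integers_adjoin \<theta> = generate_ring complex_ring {\<theta>}"

end

theory Submission
  imports Defs "Jordan_Normal_Form.Char_Poly" "HOL-Number_Theory.Cong"
begin

text \<open>
  Write \<open>\<theta> = c \<alpha>\<close>. Since \<open>X\<^sup>n + c\<^bsup>n-1\<^esup> t X + c\<^sup>n t = c\<^sup>n f(X / c)\<close> for \<open>f = X\<^sup>n + t X + t\<close>, the number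
  \<open>\<alpha>\<close> is a root of \<open>f\<close>, and the field \<open>K = \<rat>(\<theta>) = \<rat>(\<alpha>)\<close> does not see \<open>c\<close>. Everything rests on the
  equality of \<open>\<int>[\<alpha>]\<close> with the ring of integers of \<open>K\<close>. Given this, \<open>\<int>[\<theta>]\<close> has the basis
  \<open>c\<^sup>i \<alpha>\<^sup>i\<close>, \<open>i < n\<close>, and its index is \<open>c\<close> to the power \<open>0 + 1 + \<dots> + (n - 1)\<close>. Moreover the
  wedge of the powers of \<open>\<alpha>\<close> is an orientation for which the index form takes the value 1 at
  \<open>\<alpha>\<close>; the image of \<open>\<alpha>\<close> therefore solves the equation with \<open>\<epsilon> = 1\<close> at every prime.

  Maximality of \<open>\<int>[\<alpha>]\<close> is proved one prime \<open>p\<close> at a time (\<open>in_adj_if_multiple\<close>). If \<open>p\<close> divides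
  \<open>t\<close>, then \<open>f\<close> is an Eisenstein polynomial at \<open>p\<close>; as \<open>1 + \<alpha>\<close> is a unit and
  \<open>\<alpha>\<^sup>n = - t (1 + \<alpha>)\<close>, a power of the critical element is a rational number times a unit, which
  replaces a computation of norms (\<open>eisenstein\<close>). If \<open>p\<close> does not divide \<open>t\<close>, Euler's formula
  \<open>\<gamma> f'(\<alpha>) \<in> \<int>[\<alpha>]\<close> for integral \<open>\<gamma>\<close> (\<open>euler\<close>), obtained from Lagrange interpolation over the
  conjugates, gives \<open>y \<gamma> \<in> \<int>[\<alpha>]\<close> up to denominators prime to \<open>p\<close>, where \<open>y = (n - 1) \<alpha> + n\<close>: indeed
  \<open>\<alpha> f'(\<alpha>) = - t y\<close>. Since \<open>y\<close> divides \<open>L\<^sub>n(t)\<close>, this settles all \<open>p\<close> that do not divide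
  \<open>L\<^sub>n(t)\<close>. If \<open>p\<close> divides \<open>L\<^sub>n(t)\<close>, it does so exactly once; then \<open>y\<close> is a local generator of
  the only prime ideal of \<open>\<int>[\<alpha>]\<close> that contains \<open>p\<close> and \<open>y\<close>, so the local ring there is a discrete
  valuation ring, hence integrally closed.

  The value of the index form is defined as the unique coefficient with respect to the orientation.
  The top exterior power is generated by the wedge of a generating sequence
  (\<open>exterior_power_top_cyclic\<close>). That the coefficient is unique over the \<open>l\<close>-adic integers follows
  from the determinant of coordinates, an alternating form with the value 1 on the powers of
  \<open>\<alpha> \<otimes> 1\<close>; it is computed modulo each \<open>l\<^sup>k\<close> from integer representatives of the coordinates
  (\<open>multilinear_alternating_local_det\<close>, \<open>wedge_multiple_unique\<close>).

  The parameters form a set of positive density by a sieve: the conditions at primes up to \<open>z\<close> are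
  periodic, and the larger primes remove a set of upper density \<open>O(1/z)\<close>, since \<open>t\<close> and \<open>L\<^sub>n(t)\<close> are
  linear in \<open>t\<close> (\<open>linear_form_square_divisor_count\<close>).
\<close>

hide_const (open) up_ring.coeff up_ring.monom Polynomial.smult

section \<open>Densities of integer sets\<close>

definition count_upto :: "int set \<Rightarrow> real \<Rightarrow> nat" where
  "count_upto A X = card {t \<in> A. real_of_int \<bar>t\<bar> \<le> X}"

lemma finite_upto: "finite {t::int. P t \<and> \<bar>real_of_int t\<bar> \<le> X}"
proof (rule finite_subset)
  show "{t. P t \<and> \<bar>real_of_int t\<bar> \<le> X} \<subseteq> {- \<lfloor>X\<rfloor>..\<lfloor>X\<rfloor>}"
  proof
    fix t assume "t \<in> {t. P t \<and> \<bar>real_of_int t\<bar> \<le> X}"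
    hence "t \<le> \<lfloor>X\<rfloor>" "- t \<le> \<lfloor>X\<rfloor>" by (auto simp: le_floor_iff abs_le_iff)
    thus "t \<in> {- \<lfloor>X\<rfloor>..\<lfloor>X\<rfloor>}" by auto
  qed
qed simp

text \<open>The counting quotients of \<open>A\<close> stay, up to any prescribed error, close to those of a set with a
  density; hence they satisfy a Cauchy criterion.\<close>

lemma natural_densityI_approx:
  assumes "\<And>e. e > 0 \<Longrightarrow> \<exists>B d. has_natural_density B d \<and>
     (\<forall>\<^sub>F X in at_top. \<bar>real (count_upto A X) - real (count_upto B X)\<bar> \<le> e * (2 * X))"
  shows "\<exists>d. has_natural_density A d"
proof -
  define g where "g A X = real (count_upto A X) / (2 * X)" for A X
  have dens: "has_natural_density B d \<longleftrightarrow> (g B \<longlongrightarrow> d) at_top" for B d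
    unfolding has_natural_density_def g_def count_upto_def ..
  have appr: "\<exists>d. \<forall>\<^sub>F X in at_top. \<bar>g A X - d\<bar> \<le> 2 * e" if "e > 0" for e
  proof -
    obtain B d where B: "(g B \<longlongrightarrow> d) at_top"
       "\<forall>\<^sub>F X in at_top. \<bar>real (count_upto A X) - real (count_upto B X)\<bar> \<le> e * (2 * X)"
      using assms \<open>e > 0\<close> unfolding dens by metis
    have "\<forall>\<^sub>F X in at_top. \<bar>g B X - d\<bar> < e"
      using tendstoD[OF B(1) that] by (simp add: dist_real_def)
    with B(2) eventually_gt_at_top[of 0]
    have "\<forall>\<^sub>F X in at_top. \<bar>g A X - d\<bar> \<le> 2 * e"
    proof eventually_elim
      case (elim X)
      have "\<bar>g A X - g B X\<bar> = \<bar>real (count_upto A X) - real (count_upto B X)\<bar> / (2 * X)"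
        using elim(2) by (simp add: g_def flip: diff_divide_distrib)
      also have "\<dots> \<le> e" using elim(1,2) by (simp add: field_simps)
      finally show ?case using elim(3) by linarith
    qed
    thus ?thesis by blast
  qed
  \<comment> \<open>The approximating densities form a Cauchy sequence, because any two of them are close to the
     same quotient at one large \<open>X\<close>.\<close>
  define e where "e k = 1 / real (Suc k)" for k
  have epos: "e k > 0" for k by (simp add: e_def)
  obtain d where d: "\<And>k. \<forall>\<^sub>F X in at_top. \<bar>g A X - d k\<bar> \<le> 2 * e k"
    using appr[OF epos] by metis
  have dd: "\<bar>d j - d k\<bar> \<le> 2 * e j + 2 * e k" for j k
  proof -
    have "\<forall>\<^sub>F X in at_top. \<bar>g A X - d j\<bar> \<le> 2 * e j \<and> \<bar>g A X - d k\<bar> \<le> 2 * e k"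
      using d by (simp add: eventually_conj)
    then obtain X where "\<bar>g A X - d j\<bar> \<le> 2 * e j" "\<bar>g A X - d k\<bar> \<le> 2 * e k"
      using eventually_happens by fastforce
    thus ?thesis by linarith
  qed
  have e_small: "\<exists>K. \<forall>k\<ge>K. e k < r" if "r > 0" for r
  proof -
    obtain K where "inverse (real (Suc K)) < r" using reals_Archimedean \<open>r > 0\<close> by blast
    hence "e k < r" if "k \<ge> K" for k
      using that frac_le[of 1 1 "real (Suc K)" "real (Suc k)"] by (simp add: e_def inverse_eq_divide)
    thus ?thesis by blast
  qed
  have "Cauchy d"
  proof (rule metric_CauchyI)
    fix r :: real assume "r > 0"
    then obtain K where K: "\<forall>k\<ge>K. e k < r / 4" using e_small[of "r/4"] by auto
    have "dist (d j) (d k) < r" if "j \<ge> K" "k \<ge> K" for j k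
    proof -
      have "e j < r / 4" "e k < r / 4" using K that by auto
      thus ?thesis using dd[of j k] by (simp add: dist_real_def)
    qed
    thus "\<exists>M. \<forall>m\<ge>M. \<forall>n\<ge>M. dist (d m) (d n) < r" by blast
  qed
  then obtain l where l: "d \<longlonglongrightarrow> l" by (auto simp: Cauchy_convergent_iff convergent_def)
  have "(g A \<longlongrightarrow> l) at_top"
  proof (rule tendstoI)
    fix r :: real assume r: "r > 0"
    obtain K where K: "\<forall>k\<ge>K. e k < r / 4" using e_small[of "r/4"] r by auto
    have "\<forall>\<^sub>F k in sequentially. dist (d k) l < r / 2" using tendstoD[OF l, of "r / 2"] r by simp
    hence "\<forall>\<^sub>F k in sequentially. dist (d k) l < r / 2 \<and> e k < r / 4"
      using K by (auto simp: eventually_conj_iff eventually_at_top_linorder)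
    then obtain k where k: "dist (d k) l < r / 2" "e k < r / 4"
      using eventually_happens by fastforce
    show "\<forall>\<^sub>F X in at_top. dist (g A X) l < r"
      using d[of k]
    proof eventually_elim
      case (elim X)
      thus ?case using k unfolding dist_real_def by linarith
    qed
  qed
  thus ?thesis using dens by blast
qed

lemma count_residue_class:
  fixes r m :: int and X :: real
  assumes "m > 0" "X \<ge> 0"
  shows "\<bar>real (count_upto {t. [t = r] (mod m)} X) - 2 * X / m\<bar> \<le> 1"
proof -
  define a where "a = \<lceil>(- X - r) / m\<rceil>"
  define b where "b = \<lfloor>(X - r) / m\<rfloor>"
  have bounds: "\<bar>real_of_int (r + m * k)\<bar> \<le> X \<longleftrightarrow> k \<in> {a..b}" for k
  proof -
    have "k \<in> {a..b} \<longleftrightarrow> - X - r \<le> k * real_of_int m \<and> k * real_of_int m \<le> X - r"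
      using assms(1) by (simp add: a_def b_def ceiling_le_iff le_floor_iff pos_divide_le_eq pos_le_divide_eq)
    also have "\<dots> \<longleftrightarrow> \<bar>real_of_int (r + m * k)\<bar> \<le> X"
      by (auto simp: abs_le_iff mult.commute)
    finally show ?thesis by blast
  qed
  have "{t \<in> {t. [t = r] (mod m)}. real_of_int \<bar>t\<bar> \<le> X} = (\<lambda>k. r + m * k) ` {a..b}"
  proof (intro equalityI subsetI)
    fix t assume t: "t \<in> {t \<in> {t. [t = r] (mod m)}. real_of_int \<bar>t\<bar> \<le> X}"
    then obtain k where k: "t = r + m * k"
      by (metis (no_types, lifting) cong_iff_lin cong_sym mem_Collect_eq)
    have "k \<in> {a..b}"
      using t bounds[of k] by (simp add: k)
    thus "t \<in> (\<lambda>k. r + m * k) ` {a..b}" using k by blast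
  next
    fix t assume "t \<in> (\<lambda>k. r + m * k) ` {a..b}"
    then obtain k where k: "t = r + m * k" "k \<in> {a..b}" by blast
    show "t \<in> {t \<in> {t. [t = r] (mod m)}. real_of_int \<bar>t\<bar> \<le> X}"
      using k bounds[of k] by (simp add: cong_def)
  qed
  moreover have "inj_on (\<lambda>k. r + m * k) {a..b}" using assms by (auto simp: inj_on_def)
  ultimately have "count_upto {t. [t = r] (mod m)} X = nat (b - a + 1)"
    by (simp add: count_upto_def card_image)
  moreover have "real_of_int (b - a + 1) > 2 * X / m - 1" "real_of_int (b - a + 1) \<le> 2 * X / m + 1"
  proof -
    have "real_of_int b > (X - r) / m - 1" "real_of_int b \<le> (X - r) / m"
      "real_of_int a < (- X - r) / m + 1" "real_of_int a \<ge> (- X - r) / m"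
      unfolding a_def b_def by linarith+
    moreover have "(X - r) / m - (- X - r) / m = 2 * X / m" by (simp flip: diff_divide_distrib)
    ultimately show "real_of_int (b - a + 1) > 2 * X / m - 1" "real_of_int (b - a + 1) \<le> 2 * X / m + 1"
      by simp_all
  qed
  moreover have "2 * X / m \<ge> 0" using assms by simp
  moreover have "b - a + 1 \<ge> 0"
  proof -
    have "real_of_int (b - a + 1) > -1" using calculation by linarith
    thus ?thesis by linarith
  qed
  hence "real (nat (b - a + 1)) = real_of_int (b - a + 1)" by simp
  ultimately show ?thesis by linarith
qed

text \<open>In the sieve a congruence condition on the values of a linear form is only known to confine \<open>t\<close> to
  some residue class; this version avoids solving for the class.\<close>

lemma card_le_if_pairwise_cong:
  fixes S :: "int set" and m :: int
  assumes "m > 0" "X \<ge> 0" "S \<subseteq> {t. real_of_int \<bar>t\<bar> \<le> X}"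
    and "\<And>s t. s \<in> S \<Longrightarrow> t \<in> S \<Longrightarrow> [s = t] (mod m)"
  shows "real (card S) \<le> 2 * X / m + 1"
proof (cases "S = {}")
  case True
  thus ?thesis using assms by simp
next
  case False
  then obtain s where s: "s \<in> S" by blast
  have "card S \<le> count_upto {t. [t = s] (mod m)} X"
    unfolding count_upto_def by (intro card_mono) (use assms s in \<open>auto intro: finite_upto\<close>)
  thus ?thesis using count_residue_class[OF assms(1,2), of s] by linarith
qed

lemma periodic_has_natural_density:
  fixes B :: "int set" and m :: int
  assumes "m > 0" "\<And>s t. [s = t] (mod m) \<Longrightarrow> s \<in> B \<longleftrightarrow> t \<in> B"
  shows "\<exists>d. has_natural_density B d"
proof -
  define R where "R = B \<inter> {0..<m}"
  have fin: "finite R" by (simp add: R_def)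
  have cnt: "\<bar>real (count_upto B X) - card R * (2 * X / m)\<bar> \<le> card R" if "X \<ge> 0" for X
  proof -
    have "{t \<in> B. real_of_int \<bar>t\<bar> \<le> X} = (\<Union>r\<in>R. {t \<in> {t. [t = r] (mod m)}. real_of_int \<bar>t\<bar> \<le> X})"
    proof (intro equalityI subsetI)
      fix t assume t: "t \<in> {t \<in> B. real_of_int \<bar>t\<bar> \<le> X}"
      have "[t = t mod m] (mod m)" by (simp add: cong_def)
      moreover have "t mod m \<in> R"
        using assms(2)[OF calculation] t assms(1) by (simp add: R_def)
      ultimately show "t \<in> (\<Union>r\<in>R. {t \<in> {t. [t = r] (mod m)}. real_of_int \<bar>t\<bar> \<le> X})"
        using t by blast
    next
      fix t assume "t \<in> (\<Union>r\<in>R. {t \<in> {t. [t = r] (mod m)}. real_of_int \<bar>t\<bar> \<le> X})"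
      then obtain r where r: "r \<in> R" "[t = r] (mod m)" "real_of_int \<bar>t\<bar> \<le> X" by blast
      thus "t \<in> {t \<in> B. real_of_int \<bar>t\<bar> \<le> X}"
        using assms(2)[OF r(2)] by (simp add: R_def)
    qed
    moreover have "card (\<Union>r\<in>R. {t \<in> {t. [t = r] (mod m)}. real_of_int \<bar>t\<bar> \<le> X}) =
        (\<Sum>r\<in>R. count_upto {t. [t = r] (mod m)} X)"
      unfolding count_upto_def
      by (rule card_UN_disjoint) (auto simp: fin R_def cong_def intro: finite_upto)
    ultimately have "real (count_upto B X) - card R * (2 * X / m) =
        (\<Sum>r\<in>R. real (count_upto {t. [t = r] (mod m)} X) - 2 * X / m)"
      by (simp add: count_upto_def sum_subtractf)
    also have "\<bar>\<dots>\<bar> \<le> (\<Sum>r\<in>R. 1)"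
      by (rule order.trans[OF sum_abs]) (intro sum_mono count_residue_class that assms)
    finally show ?thesis by simp
  qed
  have "((\<lambda>X. real (count_upto B X) / (2 * X)) \<longlongrightarrow> card R / m) at_top"
  proof (rule Lim_transform2)
    show "((\<lambda>X. real (card R) / m) \<longlongrightarrow> card R / m) at_top" by simp
    have "((\<lambda>X. real (card R) / 2 * inverse X) \<longlongrightarrow> real (card R) / 2 * 0) at_top"
      by (intro tendsto_intros tendsto_inverse_0_at_top filterlim_ident)
    hence lim: "((\<lambda>X. real (card R) / (2 * X)) \<longlongrightarrow> 0) at_top" by (simp add: field_simps)
    show "((\<lambda>X. real (card R) / m - real (count_upto B X) / (2 * X)) \<longlongrightarrow> 0) at_top"
    proof (rule tendsto_0_le[OF lim, where K = 1])
      show "\<forall>\<^sub>F X in at_top. norm (real (card R) / m - real (count_upto B X) / (2 * X)) \<le> norm (real (card R) / (2 * X)) * 1"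
        using eventually_gt_at_top[of 0]
      proof eventually_elim
        case (elim X)
        have "real (card R) / m - real (count_upto B X) / (2 * X) =
          - (real (count_upto B X) - card R * (2 * X / m)) / (2 * X)"
          using elim by (simp add: diff_divide_distrib)
        also have "norm \<dots> = \<bar>real (count_upto B X) - card R * (2 * X / m)\<bar> / (2 * X)"
          using elim by (simp add: abs_minus_commute)
        also have "\<dots> \<le> card R / (2 * X)"
          using cnt[of X] elim by (intro divide_right_mono) auto
        also have "\<dots> = norm (real (card R) / (2 * X)) * 1" using elim by simp
        finally show ?case .
      qed
    qed
  qed
  thus ?thesis unfolding has_natural_density_def count_upto_def by blast
qed

text \<open>Telescoping: \<open>1 / (w + 1)\<^sup>2 \<le> 1 / w - 1 / (w + 1)\<close>.\<close>

lemma sum_inverse_squares_tail: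
  fixes z w :: nat
  assumes "z > 0"
  shows "(\<Sum>k\<in>{z<..w}. 1 / (real k)\<^sup>2) \<le> 1 / z"
proof (cases "z \<le> w")
  case True
  have "(\<Sum>k\<in>{z<..w}. 1 / (real k)\<^sup>2) \<le> 1 / z - 1 / w"
    using True
  proof (induction w rule: dec_induct)
    case (step w)
    have w: "w > 0" using step assms by simp
    have "{z<..Suc w} = insert (Suc w) {z<..w}" using step by auto
    hence "(\<Sum>k\<in>{z<..Suc w}. 1 / (real k)\<^sup>2) \<le> 1 / (real (Suc w))\<^sup>2 + (1 / z - 1 / w)"
      using step by simp
    also have "1 / (real (Suc w))\<^sup>2 \<le> 1 / w - 1 / Suc w"
    proof -
      have "1 / (real (Suc w))\<^sup>2 \<le> 1 / (real w * real (Suc w))"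
        using w by (intro divide_left_mono) (simp_all add: power2_eq_square)
      also have "\<dots> = 1 / w - 1 / Suc w"
        using w by (simp add: field_simps)
      finally show ?thesis .
    qed
    finally show ?case by simp
  qed auto
  moreover have "1 / real w \<ge> 0" by simp
  ultimately show ?thesis by linarith
qed (use assms in auto)

text \<open>For a prime \<open>p\<close> that divides neither the modulus nor the leading coefficient, the condition
  \<open>p\<^sup>2 dvd a + b t\<close> defines a single class modulo \<open>p\<^sup>2 M\<close>. Such a class contributes at most
  \<open>2 X / (p\<^sup>2 M) + 1\<close> elements; the first terms add up to the tail of a convergent series, and the
  number of relevant primes is of the order of \<open>\<surd>X\<close>.\<close>

lemma linear_form_square_divisor_count:
  fixes a b t0 M :: int and z :: nat and X :: real
  assumes "z > 0" "M > 0" "X \<ge> 1"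
  defines "S \<equiv> {t. [t = t0] (mod M) \<and> a + b * t \<noteq> 0 \<and>
     (\<exists>p::nat. prime p \<and> p > z \<and> \<not> int p dvd M \<and> \<not> int p dvd b \<and> (int p)\<^sup>2 dvd a + b * t)}"
  shows "real (count_upto S X) \<le> 2 * X / (M * z) + sqrt ((\<bar>a\<bar> + \<bar>b\<bar>) * X)"
proof -
  \<comment> \<open>A square \<open>p\<^sup>2\<close> dividing the nonzero value of the form cannot exceed that value, so only
     primes up to \<open>w\<close> occur.\<close>
  define w where "w = nat \<lfloor>sqrt ((\<bar>a\<bar> + \<bar>b\<bar>) * X)\<rfloor>"
  define P where "P = {p. prime p \<and> p \<in> {z<..w} \<and> \<not> int p dvd M \<and> \<not> int p dvd b}"
  define T where "T p = {t. [t = t0] (mod M) \<and> (int p)\<^sup>2 dvd a + b * t \<and> \<bar>real_of_int t\<bar> \<le> X}" for p :: nat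
  have finP: "finite P" by (rule finite_subset[of _ "{z<..w}"]) (auto simp: P_def)
  have sq0: "sqrt ((\<bar>a\<bar> + \<bar>b\<bar>) * X) \<ge> 0" using assms by simp
  have "{t \<in> S. real_of_int \<bar>t\<bar> \<le> X} \<subseteq> (\<Union>p\<in>P. T p)"
  proof
    fix t assume t: "t \<in> {t \<in> S. real_of_int \<bar>t\<bar> \<le> X}"
    then obtain p :: nat where p: "prime p" "p > z" "\<not> int p dvd M" "\<not> int p dvd b" "(int p)\<^sup>2 dvd a + b * t"
      by (auto simp: S_def)
    have "a + b * t \<noteq> 0" using t by (simp add: S_def)
    hence "(int p)\<^sup>2 \<le> \<bar>a + b * t\<bar>" using p(5) by (meson dvd_abs_iff zdvd_imp_le zero_less_abs_iff)
    moreover have "\<bar>a + b * t\<bar> \<le> \<bar>a\<bar> + \<bar>b\<bar> * \<bar>t\<bar>" using abs_triangle_ineq[of a "b * t"] by (simp add: abs_mult)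
    ultimately have "(int p)\<^sup>2 \<le> \<bar>a\<bar> + \<bar>b\<bar> * \<bar>t\<bar>" by linarith
    hence "real_of_int ((int p)\<^sup>2) \<le> real_of_int (\<bar>a\<bar> + \<bar>b\<bar> * \<bar>t\<bar>)" by (simp only: of_int_le_iff)
    hence "(real p)\<^sup>2 \<le> real_of_int \<bar>a\<bar> + real_of_int \<bar>b\<bar> * real_of_int \<bar>t\<bar>" by simp
    also have "\<dots> \<le> real_of_int \<bar>a\<bar> * X + real_of_int \<bar>b\<bar> * X"
      using t assms(3) by (intro add_mono mult_left_mono) (auto simp: mult_le_cancel_left1)
    finally have "(real p)\<^sup>2 \<le> (\<bar>a\<bar> + \<bar>b\<bar>) * X" by (simp add: algebra_simps)
    hence "real p \<le> sqrt ((\<bar>a\<bar> + \<bar>b\<bar>) * X)" by (simp add: real_le_rsqrt)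
    hence "p \<le> w" by (simp add: w_def le_nat_floor)
    hence "p \<in> P" using p by (simp add: P_def)
    thus "t \<in> (\<Union>p\<in>P. T p)" using t p by (auto simp: S_def T_def)
  qed
  moreover have finT: "finite (T p)" for p
    using finite_upto[of "\<lambda>t. [t = t0] (mod M) \<and> (int p)\<^sup>2 dvd a + b * t" X] by (simp add: T_def conj_assoc)
  ultimately have "count_upto S X \<le> card (\<Union>p\<in>P. T p)"
    unfolding count_upto_def using finP by (intro card_mono) auto
  also have "\<dots> \<le> (\<Sum>p\<in>P. card (T p))" by (rule card_UN_le[OF finP])
  finally have "real (count_upto S X) \<le> real (\<Sum>p\<in>P. card (T p))" by (simp only: of_nat_le_iff)
  also have "\<dots> = (\<Sum>p\<in>P. real (card (T p)))" by simp
  also have "\<dots> \<le> (\<Sum>p\<in>P. 2 * X / M * (1 / (real p)\<^sup>2) + 1)"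
  proof (rule sum_mono)
    fix p assume p: "p \<in> P"
    have cop: "Rings.coprime ((int p)\<^sup>2) M" "Rings.coprime ((int p)\<^sup>2) b"
      using p prime_imp_coprime[of "int p" M] prime_imp_coprime[of "int p" b] by (auto simp: P_def)
    have "real (card (T p)) \<le> 2 * X / real_of_int ((int p)\<^sup>2 * M) + 1"
    proof (rule card_le_if_pairwise_cong)
      show "(int p)\<^sup>2 * M > 0" using p assms(1,2) by (auto simp: P_def)
      show "X \<ge> 0" using assms by simp
      show "T p \<subseteq> {t. real_of_int \<bar>t\<bar> \<le> X}" by (auto simp: T_def)
      fix s t assume st: "s \<in> T p" "t \<in> T p"
      have "(int p)\<^sup>2 dvd (a + b * s) - (a + b * t)" using st by (intro dvd_diff) (auto simp: T_def)
      hence "(int p)\<^sup>2 dvd b * (s - t)" by (simp add: algebra_simps)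
      hence "(int p)\<^sup>2 dvd s - t" using cop(2) coprime_dvd_mult_right_iff by blast
      moreover have "[s = t] (mod M)" using st by (auto simp: T_def intro: cong_trans cong_sym)
      hence "M dvd s - t" by (simp add: cong_iff_dvd_diff)
      ultimately have "(int p)\<^sup>2 * M dvd s - t" using cop(1) divides_mult by blast
      thus "[s = t] (mod (int p)\<^sup>2 * M)" by (simp add: cong_iff_dvd_diff)
    qed
    thus "real (card (T p)) \<le> 2 * X / M * (1 / (real p)\<^sup>2) + 1" by (simp add: mult.commute)
  qed
  also have "\<dots> = 2 * X / M * (\<Sum>p\<in>P. 1 / (real p)\<^sup>2) + card P"
    by (simp add: sum.distrib sum_distrib_left)
  also have "\<dots> \<le> 2 * X / M * (1 / z) + w"
  proof (intro add_mono mult_left_mono)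
    have "(\<Sum>p\<in>P. 1 / (real p)\<^sup>2) \<le> (\<Sum>p\<in>{z<..w}. 1 / (real p)\<^sup>2)"
      by (intro sum_mono2) (auto simp: P_def)
    also have "\<dots> \<le> 1 / z" by (rule sum_inverse_squares_tail[OF assms(1)])
    finally show "(\<Sum>p\<in>P. 1 / (real p)\<^sup>2) \<le> 1 / z" .
    have "card P \<le> card {z<..w}" by (intro card_mono) (auto simp: P_def)
    thus "real (card P) \<le> real w" by simp
  qed (use assms in auto)
  also have "real w \<le> sqrt ((\<bar>a\<bar> + \<bar>b\<bar>) * X)"
    using sq0 unfolding w_def by simp
  finally show ?thesis by simp
qed

lemma prime_dvd_C0_imp: "prime p \<Longrightarrow> int p dvd C0 n \<Longrightarrow> p dvd n"
  by (auto simp: C0_def minus_one_power_iff split: if_splits dest!: prime_dvd_power[rotated])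

lemma prime_dvd_C1_imp: "prime p \<Longrightarrow> int p dvd C1 n \<Longrightarrow> p dvd n - 1"
  by (auto simp: C1_def minus_one_power_iff split: if_splits dest!: prime_dvd_power[rotated])

text \<open>The source of all coprimality statements between the two coefficients of the form \<open>L\<^sub>n\<close>.\<close>

lemma not_dvd_consecutive:
  fixes p n :: nat
  assumes "prime p" "n \<ge> 1" "p dvd n" "p dvd n - 1"
  shows False
proof -
  have "p dvd n - (n - 1)" using dvd_diff_nat[OF assms(3,4)] .
  moreover have "n - (n - 1) = 1" using assms(2) by simp
  ultimately have "p dvd 1" by simp
  thus False using prime_ge_2_nat[OF assms(1)] by simp
qed

lemma dvd_C0: "p dvd n \<Longrightarrow> n > 0 \<Longrightarrow> int p dvd C0 n"
  unfolding C0_def by (intro dvd_mult) (metis dvd_power dvd_trans of_nat_dvd_iff)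

lemma dvd_C1: "p dvd n - 1 \<Longrightarrow> n > 1 \<Longrightarrow> int p dvd C1 n"
  unfolding C1_def by (intro dvd_mult) (metis dvd_power dvd_trans of_nat_dvd_iff zero_less_diff)

lemma L_form_nonzero:
  assumes "n \<ge> 4"
  shows "L_form n t \<noteq> 0"
proof
  assume *: "L_form n t = 0"
  have "n - 1 \<noteq> 1" using assms by simp
  then obtain p where p: "prime p" "p dvd n - 1" using prime_factor_nat by blast
  have "int p dvd C1 n" using p assms by (intro dvd_C1) auto
  moreover have "C0 n = - (C1 n * t)" using * by (simp add: L_form_def)
  ultimately have "p dvd n" using prime_dvd_C0_imp[OF p(1)] by simp
  thus False using not_dvd_consecutive[OF p(1), of n] p assms by simp
qed

section \<open>A sieve for the set of parameters\<close>

text \<open>Squarefreeness of the product splits into conditions on the two factors because a common prime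
  divisor of \<open>t\<close> and \<open>L\<^sub>n(t)\<close> would divide \<open>n\<close>, to which \<open>t\<close> is prime. The primes that divide
  \<open>n (n - 1)\<close> need no further condition: by coprimality they never divide \<open>t L\<^sub>n(t)\<close>.\<close>

lemma T_set_coprime_altdef:
  fixes n :: nat and c :: int
  assumes "n \<ge> 4"
  defines "q \<equiv> int (n * (n - 1))"
  shows "t \<in> T_set_coprime n c \<longleftrightarrow> \<bar>t\<bar> > 1 \<and> Rings.coprime t (q * c) \<and>
     (\<forall>p::nat. prime p \<longrightarrow> \<not> int p dvd q \<longrightarrow> \<not> (int p)\<^sup>2 dvd t \<and> \<not> (int p)\<^sup>2 dvd L_form n t)"
    (is "_ \<longleftrightarrow> ?R")
proof
  assume t: "t \<in> T_set_coprime n c"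
  hence sq: "squarefree (t * L_form n t)" by (simp add: T_set_coprime_def T_set_def)
  have "Rings.coprime t (q * c)"
    using t unfolding T_set_coprime_def T_set_def q_def coprime_iff_gcd_eq_1[symmetric] by simp
  moreover have "\<not> (int p)\<^sup>2 dvd t \<and> \<not> (int p)\<^sup>2 dvd L_form n t" if p: "prime p" for p :: nat
  proof -
    have "\<not> (int p)\<^sup>2 dvd t * L_form n t" using sq p by (auto simp: squarefree_def)
    thus ?thesis by auto
  qed
  ultimately show ?R using t by (simp add: T_set_coprime_def T_set_def)
next
  assume R: ?R
  have cop: "Rings.coprime t q" "Rings.coprime t c" using R by auto
  have nz: "t * L_form n t \<noteq> 0" using R L_form_nonzero[OF assms(1)] by auto
  have "squarefree (t * L_form n t)"
    unfolding squarefree_factorial_semiring[OF nz]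
  proof (intro allI impI)
    fix p' :: int assume p': "prime p'"
    then obtain p where p: "p' = int p" "prime p" by (metis prime_int_nat_transfer prime_ge_0_int nat_0_le prime_nat_iff_prime)
    have pt: "\<not> (int p dvd t \<and> int p dvd q)"
      using cop(1) p by (meson not_prime_unit coprime_common_divisor prime_int_nat_transfer prime_nat_int_transfer)
    have tL: "\<not> (int p dvd t \<and> int p dvd L_form n t)"
    proof
      assume *: "int p dvd t \<and> int p dvd L_form n t"
      have "int p dvd L_form n t - C1 n * t" using * by (intro dvd_diff) auto
      hence "p dvd n" using prime_dvd_C0_imp[OF p(2)] by (simp add: L_form_def)
      hence "int p dvd q" by (simp add: q_def)
      thus False using pt * by blast
    qed
    have qL: "\<not> (int p dvd q \<and> int p dvd L_form n t)"
    proof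
      assume *: "int p dvd q \<and> int p dvd L_form n t"
      hence "p dvd n \<or> p dvd n - 1" using p prime_dvd_mult_iff by (auto simp: q_def simp flip: of_nat_mult)
      thus False
      proof
        assume pn: "p dvd n"
        hence "int p dvd C0 n" using assms(1) by (intro dvd_C0) auto
        hence "int p dvd L_form n t - C0 n" using * by (intro dvd_diff) auto
        hence "int p dvd C1 n * t" by (simp add: L_form_def)
        hence "int p dvd C1 n" using pt * p prime_dvd_mult_iff[of "int p"] by auto
        thus False using prime_dvd_C1_imp[OF p(2), of n] not_dvd_consecutive[OF p(2), of n] pn assms(1) by auto
      next
        assume pn: "p dvd n - 1"
        hence "int p dvd C1 n" using assms(1) by (intro dvd_C1) auto
        hence "int p dvd L_form n t - C1 n * t" using * by (intro dvd_diff) auto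
        hence "int p dvd C0 n" by (simp add: L_form_def)
        thus False using prime_dvd_C0_imp[OF p(2), of n] not_dvd_consecutive[OF p(2), of n] pn assms(1) by auto
      qed
    qed
    show "\<not> p'\<^sup>2 dvd t * L_form n t"
    proof
      assume d: "p'\<^sup>2 dvd t * L_form n t"
      have dd: "int p dvd t * L_form n t" using d unfolding p(1) by (metis dvd_trans dvd_triv_left power2_eq_square)
      hence "int p dvd t \<or> int p dvd L_form n t" using p prime_dvd_mult_iff[of "int p"] by auto
      hence nq: "\<not> int p dvd q" using pt qL by blast
      show False
      proof (cases "int p dvd t")
        case True
        hence "Rings.coprime (int p) (L_form n t)" using tL p prime_imp_coprime[of "int p"] by auto
        hence "(int p)\<^sup>2 dvd t" using d unfolding p(1) using coprime_dvd_mult_left_iff coprime_power_left_iff by blast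
        thus False using R p nq by blast
      next
        case False
        hence "Rings.coprime (int p) t" using p prime_imp_coprime[of "int p"] by auto
        hence "(int p)\<^sup>2 dvd L_form n t" using d unfolding p(1) using coprime_dvd_mult_right_iff coprime_power_left_iff by blast
        thus False using R p nq by blast
      qed
    qed
  qed
  thus "t \<in> T_set_coprime n c"
    using R cop by (simp add: T_set_coprime_def T_set_def q_def coprime_iff_gcd_eq_1)
qed

text \<open>Primes are added one at a time. Moving \<open>t\<close> by multiples of the modulus built from the earlier primes
  preserves what has been achieved, and three consecutive multiples suffice at the new prime, which
  is odd because \<open>n (n - 1)\<close> is even.\<close>

lemma ex_simultaneously_nonvanishing:
  fixes n :: nat and P :: "nat set"
  assumes "n \<ge> 4" "finite P" "\<And>p. p \<in> P \<Longrightarrow> prime p \<and> \<not> int p dvd int (n * (n - 1))"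
  shows "\<exists>t. Rings.coprime t (int (n * (n - 1))) \<and> (\<forall>p\<in>P. \<not> int p dvd t \<and> \<not> int p dvd L_form n t)"
  using assms(2,3)
proof (induction P)
  case empty
  show ?case by (intro exI[of _ 1]) auto
next
  case (insert p P)
  define q where "q = int (n * (n - 1))"
  obtain t where t: "Rings.coprime t q" "\<forall>p\<in>P. \<not> int p dvd t \<and> \<not> int p dvd L_form n t"
    using insert unfolding q_def by auto
  define m where "m = q * (\<Prod>r\<in>P. int r)"
  have p: "prime p" "\<not> int p dvd q" using insert.prems[of p] by (auto simp: q_def)
  have pm: "\<not> int p dvd m"
  proof
    assume "int p dvd m"
    hence "int p dvd (\<Prod>r\<in>P. int r)" using p prime_dvd_mult_iff[of "int p"] by (auto simp: m_def)
    then obtain r where "r \<in> P" "int p dvd int r"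
      using prime_dvd_prod_iff[OF insert.hyps(1), of "int p"] p by auto
    thus False using insert p primes_dvd_imp_eq[of p r] by auto
  qed
  have "even q" by (cases n) (simp_all add: q_def)
  hence p3: "p \<ge> 3" using p prime_ge_2_nat[of p] by (cases "p = 2") auto
  have pC: "\<not> int p dvd C1 n"
    using prime_dvd_C1_imp[of p n] p by (auto simp: q_def)
  have uniq: False if "\<not> int p dvd v" "int p dvd u + v * i" "int p dvd u + v * j" "i \<in> {0,1,2}" "j \<in> {0,1,2}" "i \<noteq> j"
    for u v i j :: int
  proof -
    have "int p dvd (u + v * i) - (u + v * j)" using that by (intro dvd_diff)
    hence "int p dvd v * (i - j)" by (simp add: algebra_simps)
    hence "int p dvd i - j" using that(1) p prime_dvd_mult_iff[of "int p"] by auto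
    hence "int p \<le> \<bar>i - j\<bar>" using that(6) by (meson dvd_abs_iff zdvd_imp_le zero_less_abs_iff eq_iff_diff_eq_0)
    thus False using that p3 by auto
  qed
  have L: "L_form n (t + m * k) = L_form n t + (C1 n * m) * k" for k by (simp add: L_form_def algebra_simps)
  have pCm: "\<not> int p dvd C1 n * m" using pC pm p prime_dvd_mult_iff[of "int p"] by auto
  \<comment> \<open>Each of the two conditions excludes at most one residue class of \<open>k\<close> modulo \<open>p \<ge> 3\<close>.\<close>
  have "\<exists>k\<in>{0,1,2}. \<not> int p dvd t + m * k \<and> \<not> int p dvd L_form n (t + m * k)"
  proof (rule ccontr)
    assume "\<not> ?thesis"
    hence *: "int p dvd t + m * k \<or> int p dvd L_form n t + (C1 n * m) * k" if "k \<in> {0,1,2}" for k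
      using that L by auto
    note u1 = uniq[OF pm, of t] and u2 = uniq[OF pCm, of "L_form n t"]
    show False
      using *[of 0] *[of 1] *[of 2] u1[of 0 1] u1[of 0 2] u1[of 1 2] u2[of 0 1] u2[of 0 2] u2[of 1 2] by auto
  qed
  then obtain k where k: "\<not> int p dvd t + m * k" "\<not> int p dvd L_form n (t + m * k)" by blast
  have "Rings.coprime (t + m * k) q"
    using t(1) cong_imp_coprime[of t "t + m * k" q] by (simp add: m_def cong_def mult.assoc)
  moreover have "\<not> int r dvd t + m * k \<and> \<not> int r dvd L_form n (t + m * k)" if "r \<in> P" for r
  proof -
    have rm: "int r dvd m" unfolding m_def using that insert.hyps by (intro dvd_mult dvd_prodI)
    have "int r dvd t + m * k \<longleftrightarrow> int r dvd t" "int r dvd L_form n (t + m * k) \<longleftrightarrow> int r dvd L_form n t"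
      using rm by (simp_all add: L dvd_add_left_iff)
    thus ?thesis using t(2) that by simp
  qed
  ultimately show ?case using k unfolding q_def by blast
qed

lemma count_upto_mono: "(\<And>t. t \<in> A \<Longrightarrow> t \<in> B) \<Longrightarrow> count_upto A X \<le> count_upto B X"
  unfolding count_upto_def by (rule card_mono) (auto intro: finite_upto)

lemma count_upto_Un: "count_upto (A \<union> B) X \<le> count_upto A X + count_upto B X"
proof -
  have "{t \<in> A \<union> B. real_of_int \<bar>t\<bar> \<le> X} = {t \<in> A. real_of_int \<bar>t\<bar> \<le> X} \<union> {t \<in> B. real_of_int \<bar>t\<bar> \<le> X}"
    by auto
  thus ?thesis unfolding count_upto_def by (simp add: card_Un_le)
qed

lemma count_upto_le_card: "finite A \<Longrightarrow> count_upto A X \<le> card A"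
  unfolding count_upto_def by (rule card_mono) auto

lemma eventually_sqrt_le_linear:
  fixes a e :: real
  assumes "e > 0" "a \<ge> 0"
  shows "\<forall>\<^sub>F X in at_top. a + a * sqrt X \<le> e * X"
proof -
  have "\<forall>\<^sub>F X in at_top. X \<ge> max 1 ((2 * a / e)\<^sup>2)" by (rule eventually_ge_at_top)
  thus ?thesis
  proof eventually_elim
    case (elim X)
    have s1: "sqrt X \<ge> 1" using elim by simp
    have "2 * a / e \<le> sqrt X" using elim by (intro real_le_rsqrt) auto
    hence "2 * a \<le> e * sqrt X" using assms by (simp add: field_simps)
    hence "2 * a * sqrt X \<le> e * sqrt X * sqrt X" using s1 by (intro mult_right_mono) auto
    also have "\<dots> = e * X" using elim by (simp add: mult.assoc)
    finally have "2 * a * sqrt X \<le> e * X" .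
    moreover have "a \<le> a * sqrt X" using s1 assms by (simp add: mult_le_cancel_left1)
    ultimately show ?case by linarith
  qed
qed

text \<open>Truncating the conditions at \<open>z\<close> gives periodic sets that approximate the set of parameters with
  error \<open>O(1/z)\<close>, so the density exists. It is positive because one residue class that satisfies all
  conditions at the small primes loses less than half of its elements to the large ones.\<close>

theorem T_set_coprime_has_positive_density:
  fixes n :: nat and c :: int
  assumes n: "n \<ge> 4" and c: "c \<ge> 2"
  shows "has_positive_density (T_set_coprime n c)"
proof -
  define q where "q = int (n * (n - 1))"
  define T where "T = T_set_coprime n c"
  have qpos: "q > 0" using n by (simp add: q_def)
  note mem_T = T_set_coprime_altdef[OF n, of _ c, folded q_def T_def]
  have pC: "\<not> int p dvd C1 n" if "prime p" "\<not> int p dvd q" for p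
    using prime_dvd_C1_imp[of p n] that by (auto simp: q_def)
  define bad where "bad M t0 z a b = {t. [t = t0] (mod M) \<and> a + b * t \<noteq> 0 \<and>
     (\<exists>p::nat. prime p \<and> p > z \<and> \<not> int p dvd M \<and> \<not> int p dvd b \<and> (int p)\<^sup>2 dvd a + b * t)}"
    for M t0 :: int and z :: nat and a b :: int
  define Bad where "Bad M t0 z = bad M t0 z 0 1 \<union> bad M t0 z (C0 n) (C1 n) \<union> {-1,0,1}" for M t0 z
  define C where "C = 3 + sqrt (\<bar>C0 n\<bar> + \<bar>C1 n\<bar>)"
  have C: "C \<ge> 0" by (simp add: C_def)
  have Bad_count: "real (count_upto (Bad M t0 z) X) \<le> 4 * X / (M * z) + (C + C * sqrt X)"
    if "z > 0" "M > 0" "X \<ge> 1" for M t0 z X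
  proof -
    have "real (count_upto (Bad M t0 z) X) \<le>
        real (count_upto (bad M t0 z 0 1) X) + real (count_upto (bad M t0 z (C0 n) (C1 n)) X) + 3"
      using count_upto_Un[of "bad M t0 z 0 1 \<union> bad M t0 z (C0 n) (C1 n)" "{-1,0,1}" X]
        count_upto_Un[of "bad M t0 z 0 1" "bad M t0 z (C0 n) (C1 n)" X]
        count_upto_le_card[of "{-1,0,1::int}" X]
      unfolding Bad_def by simp
    also have "real (count_upto (bad M t0 z 0 1) X) \<le> 2 * X / (M * z) + sqrt X"
      using linear_form_square_divisor_count[OF that, of t0 0 1] by (simp add: bad_def)
    also have "real (count_upto (bad M t0 z (C0 n) (C1 n)) X) \<le>
        2 * X / (M * z) + sqrt (\<bar>C0 n\<bar> + \<bar>C1 n\<bar>) * sqrt X"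
      using linear_form_square_divisor_count[OF that, of t0 "C0 n" "C1 n"]
      by (simp add: bad_def real_sqrt_mult)
    also have "2 * X / (M * z) + sqrt X + (2 * X / (M * z) + sqrt (\<bar>C0 n\<bar> + \<bar>C1 n\<bar>) * sqrt X) + 3
      \<le> 4 * X / (M * z) + (C + C * sqrt X)"
    proof -
      have "3 \<le> C" by (simp add: C_def)
      moreover have "C * sqrt X \<ge> sqrt X + sqrt (\<bar>C0 n\<bar> + \<bar>C1 n\<bar>) * sqrt X"
        using that by (simp add: C_def algebra_simps)
      ultimately show ?thesis by (simp add: add_divide_distrib)
    qed
    finally show ?thesis by simp
  qed
  have "\<exists>d. has_natural_density T d"
  proof (rule natural_densityI_approx)
    fix e :: real assume e: "e > 0"
    obtain z :: nat where z: "4 / e < z" using reals_Archimedean2 by blast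
    have z0: "z > 0" using e z by (cases "z = 0") (auto simp: field_simps)
    have ze: "4 / z \<le> e" using z z0 e by (simp add: field_simps)
    define B where "B = {t. Rings.coprime t (q * c) \<and> (\<forall>p::nat. prime p \<longrightarrow> p \<le> z \<longrightarrow> \<not> int p dvd q \<longrightarrow>
        \<not> (int p)\<^sup>2 dvd t \<and> \<not> (int p)\<^sup>2 dvd L_form n t)}"
    define m where "m = q * c * (fact z)\<^sup>2"
    have "\<exists>d. has_natural_density B d"
    proof (rule periodic_has_natural_density)
      show "m > 0" using qpos c by (simp add: m_def)
      fix s t assume st: "[s = t] (mod m)"
      have "[s = t] (mod q * c)" using st by (rule cong_dvd_modulus) (simp add: m_def)
      hence 1: "Rings.coprime s (q * c) \<longleftrightarrow> Rings.coprime t (q * c)"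
        using cong_imp_coprime cong_sym by blast
      have 2: "(int p)\<^sup>2 dvd s \<longleftrightarrow> (int p)\<^sup>2 dvd t" "(int p)\<^sup>2 dvd L_form n s \<longleftrightarrow> (int p)\<^sup>2 dvd L_form n t"
        if "prime p" "p \<le> z" for p :: nat
      proof -
        have "p dvd fact z" using that by (intro dvd_fact prime_ge_1_nat)
        hence "int p dvd fact z" by (metis of_nat_dvd_iff of_nat_fact)
        hence "(int p)\<^sup>2 dvd m" by (simp add: m_def dvd_power_same)
        hence *: "[s = t] (mod (int p)\<^sup>2)" using st cong_dvd_modulus by blast
        thus "(int p)\<^sup>2 dvd s \<longleftrightarrow> (int p)\<^sup>2 dvd t" by (rule cong_dvd_iff)
        have "[L_form n s = L_form n t] (mod (int p)\<^sup>2)"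
          unfolding L_form_def by (intro cong_add cong_mult cong_refl *)
        thus "(int p)\<^sup>2 dvd L_form n s \<longleftrightarrow> (int p)\<^sup>2 dvd L_form n t" by (rule cong_dvd_iff)
      qed
      show "s \<in> B \<longleftrightarrow> t \<in> B" unfolding B_def using 1 2 by auto
    qed
    then obtain d where d: "has_natural_density B d" by blast
    have TB: "T \<subseteq> B" using mem_T by (auto simp: B_def)
    have BT: "B \<subseteq> T \<union> Bad 1 0 z"
    proof
      fix t assume t: "t \<in> B"
      show "t \<in> T \<union> Bad 1 0 z"
      proof (rule ccontr)
        assume nt: "t \<notin> T \<union> Bad 1 0 z"
        hence t1: "\<bar>t\<bar> > 1" by (auto simp: Bad_def)
        then obtain p :: nat where p: "prime p" "\<not> int p dvd q" "(int p)\<^sup>2 dvd t \<or> (int p)\<^sup>2 dvd L_form n t"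
          using nt t mem_T[of t] by (auto simp: B_def)
        have "p > z"
        proof (rule ccontr)
          assume "\<not> p > z"
          thus False using p t unfolding B_def mem_Collect_eq by (meson not_le)
        qed
        hence "t \<in> bad 1 0 z 0 1 \<union> bad 1 0 z (C0 n) (C1 n)"
          using p pC[of p] t1 L_form_nonzero[OF n, of t] by (auto simp: bad_def L_form_def)
        thus False using nt by (simp add: Bad_def)
      qed
    qed
    have "\<forall>\<^sub>F X in at_top. \<bar>real (count_upto T X) - real (count_upto B X)\<bar> \<le> e * (2 * X)"
      using eventually_sqrt_le_linear[OF e C] eventually_ge_at_top[of 1]
    proof eventually_elim
      case (elim X)
      have 1: "count_upto T X \<le> count_upto B X" using TB by (intro count_upto_mono) auto
      have "count_upto B X \<le> count_upto (T \<union> Bad 1 0 z) X" using BT by (intro count_upto_mono) auto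
      also have "\<dots> \<le> count_upto T X + count_upto (Bad 1 0 z) X" by (rule count_upto_Un)
      finally have 2: "real (count_upto B X) \<le> real (count_upto T X) + real (count_upto (Bad 1 0 z) X)" by linarith
      have 3: "real (count_upto (Bad 1 0 z) X) \<le> 4 * X / z + (C + C * sqrt X)"
        using Bad_count[OF z0, of 1 X 0] elim by simp
      have "4 / z * X \<le> e * X" using ze elim by (intro mult_right_mono) auto
      thus ?case using 1 2 3 elim by simp
    qed
    thus "\<exists>B d. has_natural_density B d \<and>
       (\<forall>\<^sub>F X in at_top. \<bar>real (count_upto T X) - real (count_upto B X)\<bar> \<le> e * (2 * X))"
      using d by blast
  qed
  then obtain d where d: "has_natural_density T d" by blast
  \<comment> \<open>All primes up to 8 divide \<open>N\<close>, so the sieve starts beyond \<open>z = 8\<close>; there the two forms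
     together remove at most the fraction \<open>2 / 8\<close> of the class of \<open>t0\<close>.\<close>
  define N where "N = c * fact 8"
  define P where "P = {p::nat. prime p \<and> int p dvd N \<and> \<not> int p dvd q}"
  have N: "N > 0" using c by (simp add: N_def)
  have finP: "finite P"
  proof (rule finite_subset)
    show "P \<subseteq> {p. p dvd nat N}" using N by (auto simp: P_def nat_dvd_iff int_dvd_int_iff[symmetric])
  qed (use N in auto)
  have "prime p \<and> \<not> int p dvd int (n * (n - 1))" if "p \<in> P" for p
    using that unfolding P_def q_def by blast
  from ex_simultaneously_nonvanishing[OF n finP this] obtain t0
    where t0: "Rings.coprime t0 q" "\<forall>p\<in>P. \<not> int p dvd t0 \<and> \<not> int p dvd L_form n t0"
    unfolding q_def by blast
  define M where "M = N * q"
  have M: "M > 0" using N qpos by (simp add: M_def)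
  have sub: "{t. [t = t0] (mod M)} \<subseteq> T \<union> Bad M t0 8"
  proof
    fix t assume "t \<in> {t. [t = t0] (mod M)}"
    hence t: "[t = t0] (mod M)" by simp
    have tp: "(int p dvd t \<longleftrightarrow> int p dvd t0) \<and> (int p dvd L_form n t \<longleftrightarrow> int p dvd L_form n t0)"
      if "int p dvd M" for p
    proof -
      have *: "[t = t0] (mod int p)" using t that by (rule cong_dvd_modulus)
      have "[L_form n t = L_form n t0] (mod int p)" unfolding L_form_def by (intro cong_add cong_mult cong_refl *)
      thus ?thesis using * cong_dvd_iff by blast
    qed
    have good: "\<not> int p dvd t \<and> (\<not> int p dvd q \<longrightarrow> \<not> int p dvd L_form n t)" if "int p dvd M" "prime p" for p
    proof (cases "int p dvd q")
      case True
      hence "\<not> int p dvd t0" using t0(1) that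
        by (meson not_prime_unit coprime_common_divisor prime_int_nat_transfer prime_nat_int_transfer)
      thus ?thesis using tp[OF that(1)] True by simp
    next
      case False
      hence "int p dvd N" using that prime_dvd_mult_iff[of "int p"] by (auto simp: M_def)
      hence "p \<in> P" using that False by (simp add: P_def)
      thus ?thesis using tp[OF that(1)] t0(2) by simp
    qed
    have "Rings.coprime t (q * c)"
    proof (rule ccontr)
      assume "\<not> Rings.coprime t (q * c)"
      then obtain u where u: "u dvd t" "u dvd q * c" "\<not> is_unit u" by (rule not_coprimeE)
      have "u \<noteq> 0" using u(2) qpos c by auto
      then obtain p' where p': "prime p'" "p' dvd t" "p' dvd q * c"
        using prime_divisorE[OF _ u(3)] u(1,2) dvd_trans by metis
      then obtain p where p: "p' = int p" "prime p" by (metis prime_int_nat_transfer prime_ge_0_int nat_0_le prime_nat_iff_prime)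
      have "q * c dvd M" by (simp add: M_def N_def mult.commute)
      hence "int p dvd M" using p' p dvd_trans by blast
      thus False using good p p' by blast
    qed
    show "t \<in> T \<union> Bad M t0 8"
    proof (rule ccontr)
      assume nt: "t \<notin> T \<union> Bad M t0 8"
      hence t1: "\<bar>t\<bar> > 1" by (auto simp: Bad_def)
      then obtain p :: nat where p: "prime p" "\<not> int p dvd q" "(int p)\<^sup>2 dvd t \<or> (int p)\<^sup>2 dvd L_form n t"
        using nt \<open>Rings.coprime t (q * c)\<close> mem_T[of t] by auto
      have "int p dvd t \<or> int p dvd L_form n t" using p(3) by (metis dvd_trans dvd_triv_left power2_eq_square)
      hence pM: "\<not> int p dvd M" using good[of p] p by blast
      have "p > 8"
      proof (rule ccontr)
        assume "\<not> p > 8"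
        hence "p dvd fact 8" using p(1) by (intro dvd_fact prime_ge_1_nat) auto
        hence "int p dvd int (fact 8)" using of_nat_dvd_iff by blast
        hence "int p dvd fact 8" by (simp only: of_nat_fact)
        thus False using pM by (simp add: M_def N_def del: fact_numeral)
      qed
      hence "t \<in> bad M t0 8 0 1 \<union> bad M t0 8 (C0 n) (C1 n)"
        using p pC[of p] pM t t1 L_form_nonzero[OF n, of t] by (auto simp: bad_def L_form_def)
      thus False using nt by (simp add: Bad_def)
    qed
  qed
  have "d \<ge> 1 / (2 * real_of_int M)"
  proof (rule tendsto_lowerbound)
    show "((\<lambda>X. real (count_upto T X) / (2 * X)) \<longlongrightarrow> d) at_top"
      using d by (simp add: has_natural_density_def count_upto_def)
    have C1: "C + 1 \<ge> 0" and M': "0 < 1 / real_of_int (2 * M)" using C M by simp_all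
    show "\<forall>\<^sub>F X in at_top. 1 / (2 * real_of_int M) \<le> real (count_upto T X) / (2 * X)"
      using eventually_sqrt_le_linear[OF M' C1] eventually_ge_at_top[of 1]
    proof eventually_elim
      case (elim X)
      have "count_upto {t. [t = t0] (mod M)} X \<le> count_upto (T \<union> Bad M t0 8) X"
        using sub by (intro count_upto_mono) auto
      also have "\<dots> \<le> count_upto T X + count_upto (Bad M t0 8) X" by (rule count_upto_Un)
      finally have 1: "real (count_upto {t. [t = t0] (mod M)} X) \<le> real (count_upto T X) + real (count_upto (Bad M t0 8) X)"
        by linarith
      have 2: "real (count_upto (Bad M t0 8) X) \<le> X / (2 * M) + (C + C * sqrt X)"
        using Bad_count[of 8 M X t0] elim M by simp
      have 3: "real (count_upto {t. [t = t0] (mod M)} X) \<ge> 2 * X / M - 1"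
        using count_residue_class[OF M, of X t0] elim by linarith
      have "0 \<le> sqrt X" using elim by simp
      moreover have "C + 1 + (C + 1) * sqrt X \<le> X / (2 * M)" using elim by simp
      ultimately have 4: "C + C * sqrt X + 1 \<le> X / (2 * M)" unfolding distrib_right by linarith
      have "X / M \<le> real (count_upto T X)" using 1 2 3 4 by (simp add: field_simps)
      thus ?case using elim M by (simp add: field_simps)
    qed
  qed auto
  moreover have "1 / (2 * real_of_int M) > 0" using M by simp
  ultimately have "d > 0" by linarith
  thus ?thesis unfolding has_positive_density_def using d T_def by blast
qed

section \<open>The ring of algebraic integers\<close>

text \<open>The additive group of the complex numbers, as a module over the integers.\<close>

interpretation int_span: Modules.module "\<lambda>(k::int) (x::complex). of_int k * x"
  by unfold_locales (auto simp: algebra_simps)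

text \<open>The number is an eigenvalue of the integer matrix that describes multiplication by it on the
  generators, hence a root of a monic integer polynomial, the characteristic one.\<close>

lemma algebraic_int_if_preserves_span:
  fixes z :: complex
  assumes fin: "finite G" and nz: "g0 \<in> G" "g0 \<noteq> 0"
    and closed: "\<And>g. g \<in> G \<Longrightarrow> z * g \<in> int_span.span G"
  shows "algebraic_int z"
proof -
  define k where "k = card G"
  obtain v where v: "bij_betw v {0..<k} G"
    using ex_bij_betw_nat_finite[OF fin] unfolding k_def by blast
  have "\<exists>u. z * g = (\<Sum>h\<in>G. of_int (u h) * h)" if "g \<in> G" for g
    using closed[OF that] unfolding int_span.span_finite[OF fin] by auto
  then obtain u where u: "\<And>g. g \<in> G \<Longrightarrow> z * g = (\<Sum>h\<in>G. of_int (u g h) * h)"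
    by metis
  define A where "A = mat k k (\<lambda>(i,j). u (v i) (v j))"
  have A: "A \<in> carrier_mat k k" by (simp add: A_def)
  let ?C = "map_mat of_int A :: complex mat"
  have C: "?C \<in> carrier_mat k k" using A by simp
  let ?v = "vec k v"
  have vG: "v i \<in> G" if "i < k" for i
    using v that by (auto simp: bij_betw_def)
  have "?C *\<^sub>v ?v = z \<cdot>\<^sub>v ?v"
  proof (rule eq_vecI)
    fix i assume "i < dim_vec (z \<cdot>\<^sub>v ?v)"
    hence i: "i < k" by simp
    have "(?C *\<^sub>v ?v) $ i = (\<Sum>j=0..<k. of_int (u (v i) (v j)) * v j)"
      using i A by (simp add: scalar_prod_def A_def)
    also have "\<dots> = (\<Sum>h\<in>G. of_int (u (v i) h) * h)"
      by (rule sum.reindex_bij_betw[OF v])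
    also have "\<dots> = z * v i" using u[OF vG[OF i]] by simp
    finally show "(?C *\<^sub>v ?v) $ i = (z \<cdot>\<^sub>v ?v) $ i" using i by simp
  qed (use A in auto)
  moreover have "?v \<noteq> 0\<^sub>v k"
  proof
    assume eq: "?v = 0\<^sub>v k"
    obtain i where "i < k" "v i = g0" using v nz(1) by (auto simp: bij_betw_def)
    thus False using nz(2) arg_cong[OF eq, of "\<lambda>w. w $ i"] by simp
  qed
  ultimately have "eigenvector ?C ?v z" unfolding eigenvector_def using A by auto
  hence "poly (char_poly ?C) z = 0"
    using eigenvalue_root_char_poly[OF C] by (auto simp: eigenvalue_def)
  hence "poly (map_poly of_int (char_poly A)) z = 0"
    by (simp add: of_int_hom.char_poly_hom[OF A])
  moreover have "lead_coeff (char_poly A) = 1"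
    using degree_monic_char_poly[OF A] by simp
  ultimately show ?thesis unfolding algebraic_int_altdef_ipoly by blast
qed

lemma algebraic_int_power_reduction:
  fixes x :: complex
  assumes "algebraic_int x"
  obtains m a where "m > 0" "x ^ m = (\<Sum>i<m. of_int (a i) * x ^ i)"
proof -
  obtain p where p: "poly (map_poly of_int p) x = 0" "lead_coeff p = 1"
    using assms unfolding algebraic_int_altdef_ipoly by blast
  let ?m = "degree p"
  have "(\<Sum>i\<le>?m. of_int (coeff p i) * x ^ i) = 0"
    using p(1) by (simp add: poly_altdef)
  hence eq: "x ^ ?m + (\<Sum>i<?m. of_int (coeff p i) * x ^ i) = 0"
    using p(2) by (simp add: lessThan_Suc_atMost[symmetric] add.commute)
  have "?m > 0"
    using eq by (intro Nat.gr0I) auto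
  moreover have "x ^ ?m = (\<Sum>i<?m. of_int (- coeff p i) * x ^ i)"
    using eq by (simp add: sum_negf eq_neg_iff_add_eq_0)
  ultimately show ?thesis by (rule that)
qed

text \<open>The products \<open>x\<^sup>i y\<^sup>j\<close> with exponents below the degrees of two monic equations span a group that
  multiplication by \<open>x\<close> and by \<open>y\<close> preserves.\<close>

lemma algebraic_int_add_mult:
  fixes x y :: complex
  assumes "algebraic_int x" "algebraic_int y"
  shows "algebraic_int (x + y) \<and> algebraic_int (x * y)"
proof -
  obtain m a where m: "m > 0" "x ^ m = (\<Sum>i<m. of_int (a i) * x ^ i)"
    using algebraic_int_power_reduction[OF assms(1)] by metis
  obtain k b where k: "k > 0" "y ^ k = (\<Sum>i<k. of_int (b i) * y ^ i)"
    using algebraic_int_power_reduction[OF assms(2)] by metis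
  define G where "G = (\<lambda>(i,j). x ^ i * y ^ j) ` ({..<m} \<times> {..<k})"
  let ?S = "int_span.span G"
  have fin: "finite G" by (simp add: G_def)
  have one: "1 \<in> G" using m(1) k(1) by (auto simp: G_def intro!: image_eqI[of _ _ "(0,0)"])
  have base: "x ^ i * y ^ j \<in> ?S" if "i < m" "j < k" for i j
    by (rule int_span.span_base) (use that in \<open>auto simp: G_def\<close>)
  have xG: "x * g \<in> ?S" if "g \<in> G" for g
  proof -
    obtain i j where ij: "i < m" "j < k" "g = x ^ i * y ^ j" using \<open>g \<in> G\<close> by (auto simp: G_def)
    show ?thesis
    proof (cases "Suc i < m")
      case True
      thus ?thesis using base[of "Suc i" j] ij by (simp add: mult_ac)
    next
      case False
      hence "x * g = x ^ m * y ^ j" using ij by (metis Suc_lessI mult.assoc power_Suc)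
      also have "\<dots> = (\<Sum>i<m. of_int (a i) * (x ^ i * y ^ j))"
        by (simp add: m(2) sum_distrib_right mult.assoc)
      also have "\<dots> \<in> ?S"
        by (intro int_span.span_sum int_span.span_scale base) (use ij in auto)
      finally show ?thesis .
    qed
  qed
  have yG: "y * g \<in> ?S" if "g \<in> G" for g
  proof -
    obtain i j where ij: "i < m" "j < k" "g = x ^ i * y ^ j" using \<open>g \<in> G\<close> by (auto simp: G_def)
    show ?thesis
    proof (cases "Suc j < k")
      case True
      thus ?thesis using base[of i "Suc j"] ij by (simp add: mult_ac)
    next
      case False
      hence "Suc j = k" using ij by simp
      hence "y * g = y ^ k * x ^ i" using ij by (auto simp: mult_ac)
      also have "\<dots> = (\<Sum>j<k. of_int (b j) * (x ^ i * y ^ j))"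
        by (simp only: k(2) sum_distrib_right) (simp add: mult_ac)
      also have "\<dots> \<in> ?S"
        by (intro int_span.span_sum int_span.span_scale base) (use ij in auto)
      finally show ?thesis .
    qed
  qed
  have xS: "x * s \<in> ?S" if "s \<in> ?S" for s
    using that
  proof (induction rule: int_span.span_induct_alt)
    case (step c g s)
    have "of_int c * (x * g) + x * s \<in> ?S"
      by (intro int_span.span_add int_span.span_scale xG step)
    thus ?case by (simp add: algebra_simps)
  qed (simp add: int_span.span_zero)
  have "algebraic_int (x + y)"
    by (rule algebraic_int_if_preserves_span[OF fin one])
       (auto simp: ring_distribs intro!: int_span.span_add xG yG)
  moreover have "algebraic_int (x * y)"
    by (rule algebraic_int_if_preserves_span[OF fin one])
       (auto simp: mult.assoc intro!: xS yG)
  ultimately show ?thesis ..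
qed

lemmas algebraic_int_plus = algebraic_int_add_mult[THEN conjunct1]
lemmas algebraic_int_times = algebraic_int_add_mult[THEN conjunct2]

lemma algebraic_int_power_complex:
  "algebraic_int (x :: complex) \<Longrightarrow> algebraic_int (x ^ k)"
  by (induction k) (simp_all add: algebraic_int_times)

lemma algebraic_int_sum:
  "(\<And>i. i \<in> A \<Longrightarrow> algebraic_int (f i :: complex)) \<Longrightarrow> algebraic_int (sum f A)"
  by (induction A rule: infinite_finite_induct) (simp_all add: algebraic_int_plus)

lemma algebraic_int_coeff_times:
  fixes p q :: "complex poly"
  assumes "\<And>i. algebraic_int (coeff p i)" "\<And>i. algebraic_int (coeff q i)"
  shows "algebraic_int (coeff (p * q) k)"
  unfolding coeff_mult by (intro algebraic_int_sum algebraic_int_times assms)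

section \<open>Values of integer polynomials\<close>

text \<open>Integer polynomials are evaluated in arbitrary commutative rings: at complex numbers, and at integers
  when residues modulo a prime are considered.\<close>

definition ev :: "int poly \<Rightarrow> 'a::comm_ring_1 \<Rightarrow> 'a" where
  "ev p x = poly (map_poly of_int p) x"

lemma ev_simps [simp]:
  "ev (p + q) x = ev p x + ev q x"
  "ev (p - q) x = ev p x - ev q x"
  "ev (- p) x = - ev p x"
  "ev (p * q) x = ev p x * ev q x"
  "ev (p ^ k) x = ev p x ^ k"
  "ev 0 x = 0" "ev 1 x = 1"
  "ev (pCons a p) x = of_int a + x * ev p x"
  "ev (Polynomial.monom a k) x = of_int a * x ^ k"
  "ev (Polynomial.smult a p) x = of_int a * ev p x"
  "ev (\<Sum>i\<in>A. P i) x = (\<Sum>i\<in>A. ev (P i) x)"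
  by (simp_all add: ev_def of_int_poly_hom.hom_add of_int_poly_hom.hom_minus of_int_poly_hom.hom_uminus
      of_int_poly_hom.hom_mult of_int_poly_hom.hom_power map_poly_monom poly_monom poly_sum
      of_int_poly_hom.hom_sum of_int_hom.map_poly_hom_smult of_int_hom.map_poly_pCons_hom)

lemma ev_int [simp]: "ev p (a::int) = poly p a"
  by (simp add: ev_def)

lemma ev_altdef: "ev p x = (\<Sum>i\<le>degree p. of_int (coeff p i) * x ^ i)"
proof -
  have "p = (\<Sum>i\<le>degree p. Polynomial.monom (coeff p i) i)" by (rule poly_as_sum_of_monoms[symmetric])
  hence "ev p x = ev (\<Sum>i\<le>degree p. Polynomial.monom (coeff p i) i) x" by simp
  thus ?thesis by (simp del: poly_as_sum_of_monoms)
qed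

lemma ev_altdef_less:
  assumes "degree p < n"
  shows "ev p x = (\<Sum>i<n. of_int (coeff p i) * x ^ i)"
proof -
  have "(\<Sum>i<n. of_int (coeff p i) * x ^ i) = (\<Sum>i\<le>degree p. of_int (coeff p i) * x ^ i)"
    using assms by (intro sum.mono_neutral_right) (auto simp: not_le coeff_eq_0)
  thus ?thesis by (simp add: ev_altdef)
qed

lemma algebraic_int_ev: "algebraic_int (x :: complex) \<Longrightarrow> algebraic_int (ev p x)"
  unfolding ev_altdef by (intro algebraic_int_sum algebraic_int_times algebraic_int_power_complex) auto

lemma algebraic_int_ev_def: "algebraic_int (x::complex) \<longleftrightarrow> (\<exists>p. ev p x = 0 \<and> lead_coeff p = 1)"
  unfolding algebraic_int_altdef_ipoly ev_def ..

lemma algebraic_int_rational_imp: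
  assumes "algebraic_int (of_int a / of_int b :: complex)" "b \<noteq> 0"
  shows "b dvd a"
proof -
  have "(of_int a / of_int b :: complex) \<in> \<int>"
    by (rule rational_algebraic_int_is_int[OF assms(1)]) auto
  then obtain k where "(of_int a / of_int b :: complex) = of_int k" by (auto elim: Ints_cases)
  hence "(of_int a :: complex) = of_int (k * b)" using assms(2) by (simp add: field_simps)
  hence "a = k * b" by (simp only: of_int_eq_iff)
  thus ?thesis by simp
qed

text \<open>The ring \<open>\<int>[x]\<close>, in a form that exhibits its elements as values of polynomials.\<close>

definition adj :: "complex \<Rightarrow> complex set" where
  "adj x = range (\<lambda>p. ev p x)"

lemma adjI [intro]: "ev p x \<in> adj x" by (simp add: adj_def)
lemma adj_add [intro]: "a \<in> adj x \<Longrightarrow> b \<in> adj x \<Longrightarrow> a + b \<in> adj x"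
  unfolding adj_def by clarify (metis ev_simps(1) rangeI)
lemma adj_diff [intro]: "a \<in> adj x \<Longrightarrow> b \<in> adj x \<Longrightarrow> a - b \<in> adj x"
  unfolding adj_def by clarify (metis ev_simps(2) rangeI)
lemma adj_minus [intro]: "a \<in> adj x \<Longrightarrow> - a \<in> adj x"
  unfolding adj_def by clarify (metis ev_simps(3) rangeI)
lemma adj_mult [intro]: "a \<in> adj x \<Longrightarrow> b \<in> adj x \<Longrightarrow> a * b \<in> adj x"
  unfolding adj_def by clarify (metis ev_simps(4) rangeI)
lemma adj_of_int [intro]: "of_int a \<in> adj x"
  using adjI[of "[:a:]" x] by simp
lemma adj_self [intro]: "x \<in> adj x"
  using adjI[of "[:0,1:]" x] by simp
lemma adj_0 [intro]: "0 \<in> adj x" and adj_1 [intro]: "1 \<in> adj x"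
  using adj_of_int[of 0 x] adj_of_int[of 1 x] by simp_all
lemma adj_power [intro]: "a \<in> adj x \<Longrightarrow> a ^ k \<in> adj x"
  by (induction k) (simp_all add: adj_1 adj_mult)
lemma adj_sum: "(\<And>i. i \<in> A \<Longrightarrow> f i \<in> adj x) \<Longrightarrow> sum f A \<in> adj x"
  by (induction A rule: infinite_finite_induct) (simp_all add: adj_0 adj_add)

text \<open>Bezout's identity removes coprime denominators.\<close>

lemma adj_coprime_multiples:
  assumes "Rings.coprime a b" "of_int a * z \<in> adj x" "of_int b * z \<in> adj x"
  shows "z \<in> adj x"
proof -
  obtain u v where uv: "u * a + v * b = 1"
    using assms(1) bezout_int[of a b] by (metis coprime_imp_gcd_eq_1)
  have "z = of_int (u * a + v * b) * z" using uv by simp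
  also have "\<dots> = of_int u * (of_int a * z) + of_int v * (of_int b * z)" by (simp add: algebra_simps)
  finally have "z = of_int u * (of_int a * z) + of_int v * (of_int b * z)" .
  moreover have "of_int u * (of_int a * z) + of_int v * (of_int b * z) \<in> adj x"
    by (rule adj_add; rule adj_mult[OF adj_of_int]; fact)
  ultimately show ?thesis by simp
qed

section \<open>The trinomial and its arithmetic\<close>

text \<open>Up to the last summand, the linear factor \<open>m x + (m + 1)\<close> divides the trinomial; the remainder is
  \<open>m\<^sup>n\<close> times the value at \<open>x = - (m + 1) / m\<close>. With \<open>m = n - 1\<close> that point is the only
  candidate for a multiple root of \<open>X\<^sup>n + t X + t\<close> outside zero, and the remainder is, up to sign,
  the linear form \<open>L\<^sub>n(t)\<close>.\<close>

lemma trinomial_identity: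
  fixes x t m :: "'a::comm_ring_1"
  assumes "n > 0"
  shows "m ^ n * (x ^ n + t * x + t) =
    (m * x + (m + 1)) * ((\<Sum>k<n. (- (m + 1)) ^ (n - Suc k) * (m * x) ^ k) + t * m ^ (n - 1))
     + ((- (m + 1)) ^ n - t * m ^ (n - 1))"
proof -
  have 1: "(m * x) ^ n - (- (m + 1)) ^ n = (m * x + (m + 1)) * (\<Sum>k<n. (- (m + 1)) ^ (n - Suc k) * (m * x) ^ k)"
    using power_diff_sumr2[of "m * x" n "- (m + 1)"] by (simp only: diff_minus_eq_add)
  have mn: "m ^ n = m * m ^ (n - 1)" using assms by (cases n) auto
  have "m ^ n * (x ^ n + t * x + t) = ((m * x) ^ n - (- (m + 1)) ^ n) + (- (m + 1)) ^ n + t * (m ^ n * x) + t * m ^ n"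
    by (simp add: algebra_simps power_mult_distrib)
  also have "\<dots> = (m * x + (m + 1)) * ((\<Sum>k<n. (- (m + 1)) ^ (n - Suc k) * (m * x) ^ k) + t * m ^ (n - 1))
     + ((- (m + 1)) ^ n - t * m ^ (n - 1))"
    unfolding 1 mn by (simp add: algebra_simps)
  finally show ?thesis .
qed

text \<open>The form \<open>L\<^sub>n(t)\<close> up to sign, as it arises from evaluating the trinomial at \<open>- n / (n - 1)\<close>.\<close>

definition L' :: "nat \<Rightarrow> int \<Rightarrow> int" where
  "L' n t = (- int n) ^ n - t * (int n - 1) ^ (n - 1)"

lemma L_form_eq_L':
  assumes "n \<ge> 2"
  shows "L_form n t = - ((- 1) ^ ((n - 1) * (n - 2) div 2)) * L' n t"
proof -
  obtain k where k: "n = k + 2" using assms le_Suc_ex by (metis add.commute)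
  define e where "e = (k + 1) * k div 2"
  have "(k + 2) * (k + 1) = (k + 1) * k + 2 * (k + 1)" by (simp add: algebra_simps)
  hence "(k + 2) * (k + 1) div 2 = e + (k + 1)" unfolding e_def by simp
  hence C0: "C0 n = (- 1) ^ e * ((- 1) ^ (k + 1) * int n ^ n)"
    by (simp add: C0_def k power_add)
  have C1: "C1 n = (- 1) ^ e * (int n - 1) ^ (n - 1)"
    by (simp add: C1_def k e_def)
  have "(- int n) ^ n = (- 1) ^ (k + 2) * int n ^ n"
    unfolding k by (rule power_minus)
  hence "L' n t = - ((- 1) ^ (k + 1) * int n ^ n) - t * (int n - 1) ^ (n - 1)"
    by (simp add: L'_def)
  moreover have "(n - 1) * (n - 2) div 2 = e" by (simp add: k e_def)
  ultimately show ?thesis unfolding L_form_def C0 C1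
    by (simp add: right_diff_distrib distrib_left mult_ac)
qed

text \<open>The situation after division of the given root by \<open>c\<close>.\<close>

locale trinomial_root =
  fixes n :: nat and t :: int and \<alpha> :: complex
  assumes n: "n \<ge> 4" and t1: "\<bar>t\<bar> > 1" and cop: "Rings.coprime t (int (n * (n - 1)))"
    and sqf: "squarefree (t * L_form n t)"
    and root: "\<alpha> ^ n + of_int t * \<alpha> + of_int t = 0"
begin

definition f :: "int poly" where "f = Polynomial.monom 1 n + [:t, t:]"

lemma ev_f: "ev f x = x ^ n + of_int t * x + of_int t"
  by (simp add: f_def algebra_simps)

lemma ev_f_alpha [simp]: "ev f \<alpha> = 0" using root by (simp add: ev_f)

lemma degree_lin: "degree [:t, t:] < n" using n by (simp add: le_less_trans[OF degree_pCons_le])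

lemma degree_f: "degree f = n"
  unfolding f_def using degree_lin by (subst degree_add_eq_left) (simp_all add: degree_monom_eq)

lemma monic_f: "lead_coeff f = 1"
proof -
  have "coeff [:t, t:] n = 0" using degree_lin by (rule coeff_eq_0)
  thus ?thesis unfolding degree_f by (simp add: f_def)
qed

lemma f_nz: "f \<noteq> 0" using monic_f by auto

lemma divide_by_f:
  obtains q r where "g = f * q + r" "degree r < n"
proof -
  obtain q r where qr: "pseudo_divmod g f = (q, r)" by force
  have "g = f * q + r" "r = 0 \<or> degree r < degree f"
    using pseudo_divmod[OF f_nz qr] monic_f by simp_all
  moreover from this(2) have "degree r < n" using n degree_f by auto
  ultimately show ?thesis by (intro that)
qed

lemma alg_alpha: "algebraic_int \<alpha>"
  unfolding algebraic_int_ev_def using monic_f ev_f_alpha by blast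

lemma alpha_pow_n: "\<alpha> ^ n = - of_int t * (1 + \<alpha>)"
proof -
  have "\<alpha> ^ n = ev f \<alpha> - of_int t * \<alpha> - of_int t" unfolding ev_f by simp
  also have "\<dots> = - of_int t * (1 + \<alpha>)" unfolding ev_f_alpha by (simp add: algebra_simps)
  finally show ?thesis .
qed

lemma adj_alg: "z \<in> adj \<alpha> \<Longrightarrow> algebraic_int z"
  by (auto simp: adj_def intro: algebraic_int_ev alg_alpha)

text \<open>The value of the trinomial at \<open>- 1\<close> is \<open>(- 1)\<^sup>n\<close>.\<close>

lemma one_plus_alpha_unit: "\<exists>u. algebraic_int u \<and> (1 + \<alpha>) * u = 1"
proof -
  define S where "S = (\<Sum>i<n. (- 1) ^ (n - Suc i) * \<alpha> ^ i)"
  have fac: "\<alpha> ^ n - (- 1) ^ n = (\<alpha> + 1) * S"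
    using power_diff_sumr2[of \<alpha> n "-1"] by (simp add: S_def)
  have eq: "(1 + \<alpha>) * (S + of_int t) = - ((- 1) ^ n)"
  proof -
    from fac have "- ((- 1) ^ n) = (\<alpha> + 1) * S - \<alpha> ^ n" by (simp add: algebra_simps)
    thus ?thesis unfolding alpha_pow_n by (simp add: algebra_simps)
  qed
  have "(1 + \<alpha>) * (- ((- 1) ^ n) * (S + of_int t)) = 1"
    using arg_cong[OF eq, of "\<lambda>z. - ((- 1) ^ n) * z"] by (simp add: mult_ac flip: power_mult_distrib)
  moreover have "- ((- 1) ^ n) * (S + of_int t) \<in> adj \<alpha>"
  proof -
    have "(- 1) \<in> adj \<alpha>" using adj_minus[OF adj_1] .
    thus ?thesis unfolding S_def by (intro adj_mult adj_minus adj_power adj_add adj_sum adj_of_int adj_self) auto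
  qed
  ultimately show ?thesis using adj_alg by blast
qed

lemma t_nz: "t \<noteq> 0" using t1 by auto

lemma prime_sq_not_dvd: "prime p \<Longrightarrow> \<not> p\<^sup>2 dvd t * L_form n t" for p :: int
  using squarefreeD[OF sqf, of p] prime_ge_2_int[of p] by (auto simp: zdvd1_eq)

text \<open>This is the Eisenstein argument on an arbitrary integral combination of the powers of \<open>\<alpha>\<close>. Let
  \<open>b\<close> be the first coefficient that \<open>p\<close> does not divide. Multiplication by a power of \<open>\<alpha>\<close> shows that
  \<open>b \<alpha>\<^bsup>n-1\<^esup> / p\<close> is integral. Its \<open>n\<close>-th power is, up to the unit \<open>(1 + \<alpha>)\<^bsup>n-1\<^esup>\<close>, the rational
  number \<open>b\<^sup>n (- t)\<^bsup>n-1\<^esup> / p\<^sup>n\<close>, which is not an integer because \<open>p\<close> divides \<open>t\<close> only once.\<close>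

lemma eisenstein:
  fixes p :: int
  assumes p: "prime p" "p dvd t" and deg: "degree g < n" and alg: "algebraic_int (ev g \<alpha> / of_int p)"
  shows "p dvd coeff g i"
proof (induction i rule: less_induct)
  case (less i)
  show ?case
  proof (cases "i < n")
    case False
    thus ?thesis using deg by (simp add: coeff_eq_0)
  next
    case i: True
    have p0: "p \<noteq> 0" using p by auto
    \<comment> \<open>Multiplying by \<open>\<alpha>\<^bsup>n-1-i\<^esup>\<close> moves the term of index \<open>i\<close> to \<open>\<alpha>\<^bsup>n-1\<^esup>\<close> and all later ones
       beyond \<open>\<alpha>\<^bsup>n\<^esup>\<close>, where they acquire the factor \<open>t\<close>.\<close>
    let ?s = "\<lambda>k. of_int (coeff g k) / of_int p * \<alpha> ^ (k + (n - 1 - i))"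
    have "ev g \<alpha> / of_int p * \<alpha> ^ (n - 1 - i) = (\<Sum>k<n. ?s k)"
      by (simp add: ev_altdef_less[OF deg] sum_divide_distrib sum_distrib_right power_add mult.assoc)
    also have "\<dots> = ?s i + (\<Sum>k\<in>{..<n}-{i}. ?s k)"
      using i by (simp add: sum.remove)
    also have "?s i = of_int (coeff g i) / of_int p * \<alpha> ^ (n - 1)" using i by simp
    finally have eq: "of_int (coeff g i) / of_int p * \<alpha> ^ (n - 1) =
       ev g \<alpha> / of_int p * \<alpha> ^ (n - 1 - i) - (\<Sum>k\<in>{..<n}-{i}. ?s k)" by simp
    have "algebraic_int (?s k)" if k: "k \<in> {..<n}-{i}" for k
    proof (cases "k < i")
      case True
      then obtain b where "coeff g k = p * b" using less.IH[of k] by auto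
      hence "?s k = of_int b * \<alpha> ^ (k + (n - 1 - i))" using p0 by simp
      thus ?thesis using alg_alpha by (auto intro: algebraic_int_times algebraic_int_power_complex)
    next
      case False
      then obtain j where j: "k + (n - 1 - i) = n + j" using k i by (intro that[of "k - i - 1"]) auto
      obtain b where b: "t = p * b" using p(2) by auto
      have "?s k = of_int (coeff g k) / of_int p * (- of_int t * (1 + \<alpha>) * \<alpha> ^ j)"
        unfolding j power_add alpha_pow_n ..
      also have "\<dots> = of_int (- coeff g k * b) * ((1 + \<alpha>) * \<alpha> ^ j)" using p0 by (simp add: b)
      also have "\<dots> \<in> adj \<alpha>" by (intro adj_mult adj_add adj_of_int adj_1 adj_self adj_power)
      finally show ?thesis by (rule adj_alg)
    qed
    hence "algebraic_int (\<Sum>k\<in>{..<n}-{i}. ?s k)" by (rule algebraic_int_sum)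
    moreover have "algebraic_int (ev g \<alpha> / of_int p * \<alpha> ^ (n - 1 - i))"
      using alg alg_alpha by (intro algebraic_int_times algebraic_int_power_complex)
    ultimately have "algebraic_int (ev g \<alpha> / of_int p * \<alpha> ^ (n - 1 - i) + - (\<Sum>k\<in>{..<n}-{i}. ?s k))"
      by (intro algebraic_int_plus algebraic_int_minus)
    hence gam: "algebraic_int (of_int (coeff g i) / of_int p * \<alpha> ^ (n - 1))" unfolding eq by simp
    \<comment> \<open>The \<open>n\<close>-th power of \<open>b \<alpha>\<^bsup>n-1\<^esup> / p\<close>, freed from its unit factor, is rational.\<close>
    obtain u where u: "algebraic_int u" "(1 + \<alpha>) * u = 1" using one_plus_alpha_unit by blast
    have "(of_int (coeff g i) / of_int p * \<alpha> ^ (n - 1)) ^ n * u ^ (n - 1)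
       = of_int (coeff g i) ^ n / of_int p ^ n * ((\<alpha> ^ n) ^ (n - 1) * u ^ (n - 1))"
      by (simp add: power_mult_distrib power_divide mult.commute flip: power_mult)
    also have "(\<alpha> ^ n) ^ (n - 1) * u ^ (n - 1) = (- of_int t * ((1 + \<alpha>) * u)) ^ (n - 1)"
      unfolding alpha_pow_n by (simp only: power_mult_distrib mult.assoc)
    also have "of_int (coeff g i) ^ n / of_int p ^ n * (- of_int t * ((1 + \<alpha>) * u)) ^ (n - 1)
       = of_int (coeff g i ^ n * (- t) ^ (n - 1)) / of_int (p ^ n)"
      using u(2) by simp
    finally have "algebraic_int (of_int (coeff g i ^ n * (- t) ^ (n - 1)) / of_int (p ^ n) :: complex)"
      using gam u(1) by (metis algebraic_int_times algebraic_int_power_complex)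
    hence dv: "p ^ n dvd coeff g i ^ n * (- t) ^ (n - 1)"
      using p0 by (intro algebraic_int_rational_imp) auto
    show ?thesis
    proof (rule ccontr)
      assume "\<not> p dvd coeff g i"
      hence "Rings.coprime (p ^ n) (coeff g i ^ n)" using p prime_imp_coprime by auto
      hence "p ^ n dvd (- t) ^ (n - 1)" using dv coprime_dvd_mult_right_iff by blast
      moreover obtain s where s: "t = p * s" using p(2) by auto
      have "(- t) ^ (n - 1) = p ^ (n - 1) * (- s) ^ (n - 1)" unfolding s by (simp flip: power_mult_distrib)
      moreover have "p ^ n = p ^ (n - 1) * p" using n by (cases n) auto
      ultimately have "p dvd (- s) ^ (n - 1)" using p0 by simp
      hence "p dvd - s" by (rule prime_dvd_power[OF p(1)])
      hence "p dvd s" by simp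
      hence "p\<^sup>2 dvd t" unfolding s power2_eq_square by simp
      thus False using prime_sq_not_dvd[OF p(1)] by simp
    qed
  qed
qed

text \<open>Zero is an algebraic integer divisible by every power of a prime divisor of \<open>t\<close>, so the Eisenstein
  argument makes all coefficients of a relation infinitely divisible.\<close>

lemma linear_independence_int:
  assumes "degree g < n" "ev g \<alpha> = 0"
  shows "g = 0"
proof -
  obtain p where p: "prime p" "p dvd t"
    using prime_divisor_exists[of t] t1 t_nz by (metis less_irrefl zdvd1_eq)
  have p2: "p \<ge> 2" using p(1) prime_ge_2_int by blast
  have *: "p ^ k dvd coeff g i" if "degree g < n" "ev g \<alpha> = 0" for k g i
    using that
  proof (induction k arbitrary: g)
    case (Suc k)
    have "\<forall>i. p dvd coeff g i" using eisenstein[OF p Suc.prems(1)] Suc.prems(2) by simp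
    then obtain h where h: "g = [:p:] * h" by (metis const_poly_dvd_iff dvdE)
    have "degree h < n" using Suc.prems(1) p2 by (simp add: h)
    moreover have "ev h \<alpha> = 0" using Suc.prems(2) p2 by (simp add: h)
    ultimately have "p ^ k dvd coeff h i" by (rule Suc.IH)
    thus ?case by (simp add: h)
  qed simp
  show ?thesis
  proof (rule poly_eqI, rule ccontr)
    fix i assume nz: "coeff g i \<noteq> coeff 0 i"
    define k where "k = nat \<bar>coeff g i\<bar>"
    have "p ^ k \<le> \<bar>coeff g i\<bar>" using *[OF assms, of k i] nz p2 dvd_imp_le_int[of "coeff g i" "p ^ k"] by simp
    moreover have "int k < 2 ^ k" by (metis of_nat_less_two_power)
    moreover have "(2::int) ^ k \<le> p ^ k" using p2 by (intro power_mono) auto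
    ultimately show False by (simp add: k_def)
  qed
qed

text \<open>Consequently the trinomial is the minimal polynomial of \<open>\<alpha>\<close>.\<close>

lemma vanishing_imp_dvd:
  assumes "ev g \<alpha> = 0"
  shows "f dvd g"
proof -
  obtain q r where qr: "g = f * q + r" "degree r < n" by (rule divide_by_f)
  have "ev r \<alpha> = 0" using assms by (simp add: qr(1))
  hence "r = 0" using linear_independence_int qr(2) by blast
  thus ?thesis using qr by simp
qed

text \<open>A monic equation for \<open>g(\<alpha>) / m\<close> is a polynomial relation for \<open>\<alpha>\<close>, which every conjugate satisfies.\<close>

lemma conjugate_integral:
  fixes m :: int
  assumes "algebraic_int (ev g \<alpha> / of_int m)" "m \<noteq> 0" and root': "ev f x = 0"
  shows "algebraic_int (ev g x / of_int m :: complex)"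
proof -
  obtain q where q: "ev q (ev g \<alpha> / of_int m) = 0" "lead_coeff q = 1"
    using assms(1) unfolding algebraic_int_ev_def by blast
  \<comment> \<open>The polynomial \<open>m\<^bsup>deg q\<^esup> q(g / m)\<close> with denominators cleared.\<close>
  define H where "H = (\<Sum>i\<le>degree q. [:coeff q i * m ^ (degree q - i):] * g ^ i)"
  have H: "ev H y = of_int m ^ degree q * ev q (ev g y / of_int m)" for y :: complex
  proof -
    have "of_int m ^ degree q * (of_int (coeff q i) * (ev g y / of_int m) ^ i) =
       of_int (coeff q i * m ^ (degree q - i)) * ev g y ^ i" if "i \<le> degree q" for i
    proof -
      have "(of_int m :: complex) ^ degree q = of_int m ^ (degree q - i) * of_int m ^ i"
        using that by (simp flip: power_add)
      thus ?thesis using assms(2) by (simp add: power_divide)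
    qed
    hence "of_int m ^ degree q * ev q (ev g y / of_int m) =
      (\<Sum>i\<le>degree q. of_int (coeff q i * m ^ (degree q - i)) * ev g y ^ i)"
      unfolding ev_altdef[of q] sum_distrib_left by (intro sum.cong) auto
    thus ?thesis by (simp add: H_def)
  qed
  have "f dvd H" by (rule vanishing_imp_dvd) (simp add: H q)
  hence "ev H x = 0" using root' by (auto elim!: dvdE)
  hence "ev q (ev g x / of_int m) = 0" using H[of x] assms(2) by simp
  thus ?thesis unfolding algebraic_int_ev_def using q(2) by blast
qed

text \<open>The linear factor and its cofactor in the identity above, as polynomials.\<close>

definition Y :: "int poly" where "Y = [:int n, int n - 1:]"
definition Z :: "int poly" where
  "Z = (\<Sum>k<n. [:(- int n) ^ (n - Suc k):] * [:0, int n - 1:] ^ k) + [:t * (int n - 1) ^ (n - 1):]"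

lemma ev_Y: "ev Y x = of_int (int n - 1) * x + (of_int (int n - 1) + 1)"
  by (simp add: Y_def algebra_simps)

lemma ev_YZ: "of_int (int n - 1) ^ n * ev f x = ev Y x * ev Z x + of_int (L' n t)"
proof -
  have "n > 0" using n by simp
  note id = trinomial_identity[OF this, of "of_int (int n - 1)" x "of_int t"]
  have "of_int (int n - 1) + 1 = (of_nat n :: 'a)" by simp
  thus ?thesis using id
    by (simp add: ev_f ev_Y Z_def L'_def mult_ac)
qed

lemma L'_nz: "L' n t \<noteq> 0"
proof
  assume "L' n t = 0"
  hence "L_form n t = 0" using L_form_eq_L'[of n t] n by simp
  thus False using sqf by simp
qed

section \<open>The powers of the root form an integral basis\<close>

text \<open>These relations hold for every root of the trinomial; in particular no root is a multiple one.\<close>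

lemma root_facts:
  assumes "ev f x = (0::complex)"
  shows "x * ev (pderiv f) x = - of_int t * ev Y x" "ev Y x * ev Z x = - of_int (L' n t)"
    "x \<noteq> 0" "ev Y x \<noteq> 0" "ev (pderiv f) x \<noteq> 0"
proof -
  have "x ^ n = ev f x - of_int t * x - of_int t" by (simp add: ev_f)
  hence x: "x ^ n = - of_int t * x - of_int t" using assms by simp
  have "x * ev (pderiv f) x = of_nat n * x ^ n + of_int t * x"
  proof -
    have "x * x ^ (n - 1) = x ^ n" using n by (cases n) auto
    thus ?thesis by (simp add: f_def pderiv_add pderiv_monom pderiv_pCons algebra_simps)
  qed
  thus 1: "x * ev (pderiv f) x = - of_int t * ev Y x" unfolding x by (simp add: ev_Y algebra_simps)
  have "ev Y x * ev Z x = of_int (int n - 1) ^ n * ev f x - of_int (L' n t)" unfolding ev_YZ by simp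
  thus 2: "ev Y x * ev Z x = - of_int (L' n t)" using assms by simp
  show "x \<noteq> 0"
  proof
    assume "x = 0"
    hence "ev f x = of_int t" using n by (simp add: ev_f zero_power)
    thus False using assms t_nz by simp
  qed
  show 3: "ev Y x \<noteq> 0" using 2 L'_nz by auto
  show "ev (pderiv f) x \<noteq> 0" using 1 3 t_nz by auto
qed

text \<open>Interpolate the values \<open>g(x) f'(x) / m\<close> at the conjugates \<open>x\<close> of \<open>\<alpha>\<close>. By Lagrange's formula the
  coefficients of the interpolation polynomial are algebraic integers. The same polynomial arises
  from reducing \<open>g f'\<close> modulo \<open>f\<close> and dividing by \<open>m\<close>, so the coefficients are also rational,
  hence integers.\<close>

lemma euler:
  fixes m :: int
  assumes alg: "algebraic_int (ev g \<alpha> / of_int m)" and m: "m \<noteq> 0"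
  shows "\<exists>r. ev g \<alpha> * ev (pderiv f) \<alpha> = of_int m * ev r \<alpha>"
proof -
  define F :: "complex poly" where "F = map_poly of_int f"
  define R where "R = {x. poly F x = 0}"
  have F0: "F \<noteq> 0" using f_nz by (simp add: F_def)
  have finR: "finite R" unfolding R_def by (rule poly_roots_finite[OF F0])
  have R: "x \<in> R \<longleftrightarrow> ev f x = 0" for x by (simp add: R_def F_def ev_def)
  have dF: "pderiv F = map_poly of_int (pderiv f)" unfolding F_def by (simp add: of_int_hom.map_poly_pderiv)
  have "rsquarefree F" unfolding rsquarefree_roots dF
  proof (intro allI notI)
    fix a assume "poly F a = 0 \<and> poly (map_poly of_int (pderiv f)) a = 0"
    thus False using root_facts(5)[of a] unfolding F_def ev_def by blast
  qed
  moreover have "lead_coeff F = 1" using monic_f by (simp add: F_def)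
  ultimately have Fprod: "F = (\<Prod>z\<in>R. [:-z, 1:])"
    using complex_poly_decompose_rsquarefree[of F] by (simp add: R_def)
  have "degree F = card R" unfolding Fprod by (subst degree_prod_sum_eq) auto
  hence cardR: "card R = n" using degree_f by (simp add: F_def)
  define G where "G x = (\<Prod>z\<in>R-{x}. [:-z, 1:])" for x
  have FG: "F = [:-x, 1:] * G x" if "x \<in> R" for x
    unfolding Fprod G_def using that finR by (simp add: prod.remove)
  have Gx: "poly (G x) x = ev (pderiv f) x" if "x \<in> R" for x
  proof -
    have "ev (pderiv f) x = poly (pderiv F) x" by (simp add: dF ev_def)
    also have "pderiv F = [:-x, 1:] * pderiv (G x) + G x * pderiv [:-x, 1:]"
      by (subst FG[OF that]) (rule pderiv_mult)
    also have "poly \<dots> x = poly (G x) x" by (simp add: pderiv_pCons)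
    finally show ?thesis by simp
  qed
  have Gy: "poly (G x) y = 0" if "y \<in> R" "x \<noteq> y" for x y
    unfolding G_def poly_prod using that finR by (intro prod_zero) auto
  have algR: "algebraic_int x" if "x \<in> R" for x
    using that monic_f unfolding R algebraic_int_ev_def by blast
  have algG: "algebraic_int (coeff (G x) i)" for x i
  proof -
    have "algebraic_int (coeff (\<Prod>z\<in>S. [:-z, 1:]) i)" if "S \<subseteq> R" for S i
      using finite_subset[OF that finR] that
    proof (induction S arbitrary: i)
      case empty
      show ?case by (cases i) auto
    next
      case (insert z S)
      have "algebraic_int (coeff [:-z, 1:] i)" for i
        using algR[of z] insert.prems by (auto simp: coeff_pCons split: nat.splits)
      moreover have "algebraic_int (coeff (\<Prod>z\<in>S. [:- z, 1:]) i)" for i using insert by simp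
      ultimately show ?case unfolding prod.insert[OF insert.hyps(1,2)]
        by (rule algebraic_int_coeff_times)
    qed
    thus ?thesis unfolding G_def by blast
  qed
  have degG: "degree (G x) < n" if "x \<in> R" for x
  proof -
    have "degree (G x) = card (R - {x})" unfolding G_def by (subst degree_prod_sum_eq) auto
    also have "\<dots> < card R" using finR that by (rule card_Diff1_less)
    finally show ?thesis by (simp add: cardR)
  qed
  \<comment> \<open>The interpolation polynomial with the values \<open>g(x) f'(x) / m\<close> at the conjugates \<open>x\<close>.\<close>
  define h where "h = (\<Sum>x\<in>R. Polynomial.smult (ev g x / of_int m) (G x))"
  have algh: "algebraic_int (coeff h i)" for i
    unfolding h_def coeff_sum coeff_smult
    by (intro algebraic_int_sum algebraic_int_times algG conjugate_integral[OF alg m]) (simp add: R)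
  have degh: "degree h < n"
    unfolding h_def using n
    by (intro degree_sum_less) (auto intro: le_less_trans[OF degree_smult_le] simp: degG)
  have hy: "poly h y = ev g y / of_int m * ev (pderiv f) y" if "y \<in> R" for y
  proof -
    have "poly h y = (\<Sum>x\<in>R. ev g x / of_int m * poly (G x) y)" by (simp add: h_def poly_sum)
    also have "\<dots> = (\<Sum>x\<in>R. if x = y then ev g y / of_int m * poly (G y) y else 0)"
      by (intro sum.cong) (auto simp: Gy[OF that])
    also have "\<dots> = ev g y / of_int m * poly (G y) y" using that finR by simp
    finally show ?thesis by (simp add: Gx[OF that])
  qed
  obtain q r where qr: "g * pderiv f = f * q + r" "degree r < n" by (rule divide_by_f)
  define D where "D = Polynomial.smult (of_int m) h - map_poly of_int r"
  have "D = 0"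
  proof (rule ccontr)
    assume D: "D \<noteq> 0"
    have "poly D y = 0" if y: "y \<in> R" for y
    proof -
      have "ev g y * ev (pderiv f) y = ev r y"
        using arg_cong[OF qr(1), of "\<lambda>P. ev P y"] y by (simp add: R)
      thus ?thesis using m by (simp add: D_def hy[OF y] ev_def)
    qed
    hence "card R \<le> card {y. poly D y = 0}" using poly_roots_finite[OF D] by (intro card_mono) auto
    also have "\<dots> \<le> degree D" using D by (rule card_poly_roots_bound)
    also have "\<dots> < n" unfolding D_def
      using degh qr(2) by (intro degree_diff_less) (auto intro: le_less_trans[OF degree_smult_le])
    finally show False using cardR by simp
  qed
  hence coeffs: "of_int m * coeff h i = of_int (coeff r i)" for i
  proof -
    have "coeff D i = 0" using \<open>D = 0\<close> by simp
    thus ?thesis by (simp add: D_def)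
  qed
  have "m dvd coeff r i" for i
  proof (rule algebraic_int_rational_imp[OF _ m])
    have "coeff h i = of_int (coeff r i) / of_int m" using coeffs[of i] m by (simp add: field_simps)
    thus "algebraic_int (of_int (coeff r i) / of_int m :: complex)" using algh[of i] by simp
  qed
  then obtain r' where r': "r = [:m:] * r'" by (metis const_poly_dvd_iff dvdE)
  have "ev g \<alpha> * ev (pderiv f) \<alpha> = ev r \<alpha>"
    using arg_cong[OF qr(1), of "\<lambda>P. ev P \<alpha>"] by simp
  thus ?thesis by (auto simp: r')
qed

lemma in_adj_if_p_multiple_dvd_t:
  fixes p :: int
  assumes p: "prime p" "p dvd t" and alg: "algebraic_int \<gamma>" and mult: "of_int p * \<gamma> \<in> adj \<alpha>"
  shows "\<gamma> \<in> adj \<alpha>"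
proof -
  have p0: "p \<noteq> 0" using p(1) by auto
  obtain g where g: "of_int p * \<gamma> = ev g \<alpha>" using mult by (auto simp: adj_def)
  obtain q r where qr: "g = f * q + r" "degree r < n" by (rule divide_by_f)
  have r: "of_int p * \<gamma> = ev r \<alpha>" using g by (simp add: qr(1))
  hence "\<gamma> = ev r \<alpha> / of_int p" using p0 by (simp add: field_simps)
  hence "\<forall>i. p dvd coeff r i" using eisenstein[OF p qr(2)] alg by simp
  then obtain h where h: "r = [:p:] * h" by (metis const_poly_dvd_iff dvdE)
  have "\<gamma> = ev h \<alpha>" using r p0 by (simp add: h)
  thus ?thesis by blast
qed

lemma prime_not_dvd_facts:
  fixes p :: int
  assumes p: "prime p" "\<not> p dvd t" "p dvd L' n t"
  shows "\<not> p dvd int n - 1" "\<not> p\<^sup>2 dvd L' n t"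
proof -
  show "\<not> p\<^sup>2 dvd L' n t"
  proof
    assume "p\<^sup>2 dvd L' n t"
    hence "p\<^sup>2 dvd t * L_form n t" using L_form_eq_L'[of n t] n by simp
    thus False using prime_sq_not_dvd[OF p(1)] by blast
  qed
  show "\<not> p dvd int n - 1"
  proof
    assume d: "p dvd int n - 1"
    hence "p dvd t * (int n - 1) ^ (n - 1)" using n by (intro dvd_mult) (auto intro: dvd_trans[OF _ dvd_power])
    hence "p dvd (- int n) ^ n" using p(3) unfolding L'_def by (simp add: dvd_diff_left_iff)
    hence "p dvd - int n" by (rule prime_dvd_power[OF p(1)])
    hence "p dvd int n" by simp
    hence "p dvd int n - (int n - 1)" using d by (rule dvd_diff)
    thus False using prime_ge_2_int[OF p(1)] by (simp add: zdvd1_eq)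
  qed
qed

text \<open>Euler's formula yields \<open>y \<gamma> \<in> \<int>[\<alpha>]\<close> for \<open>y = (n - 1) \<alpha> + n\<close>, a divisor of \<open>L\<^sub>n(t)\<close>. If \<open>p\<close>
  divides \<open>L\<^sub>n(t)\<close>, exactly once, then the localisation of \<open>\<int>[\<alpha>]\<close> at the kernel of
  \<open>\<alpha> \<mapsto> a\<close> modulo \<open>p\<close> is a discrete valuation ring with uniformiser \<open>y\<close>. The proof below is the
  elementary form of the statement that such a ring is integrally closed.\<close>

lemma in_adj_if_p_multiple_not_dvd_t:
  fixes p :: int
  assumes p: "prime p" "\<not> p dvd t" and alg: "algebraic_int \<gamma>" and mult: "of_int p * \<gamma> \<in> adj \<alpha>"
  shows "\<gamma> \<in> adj \<alpha>"
proof -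
  have p0: "p \<noteq> 0" using p(1) by auto
  obtain g where g: "of_int p * \<gamma> = ev g \<alpha>" using mult by (auto simp: adj_def)
  have gam: "\<gamma> = ev g \<alpha> / of_int p" using p0 g by (simp add: field_simps)
  define y where "y = ev Y \<alpha>"
  define z where "z = ev Z \<alpha>"
  note rf = root_facts[OF ev_f_alpha, folded y_def z_def]
  have yA: "y \<in> adj \<alpha>" and zA: "z \<in> adj \<alpha>" by (auto simp: y_def z_def)
  have yg: "y * \<gamma> \<in> adj \<alpha>"
  proof (rule adj_coprime_multiples)
    obtain r where "ev g \<alpha> * ev (pderiv f) \<alpha> = of_int p * ev r \<alpha>"
      using euler[of g p] alg gam p0 by auto
    hence "\<gamma> * ev (pderiv f) \<alpha> = ev r \<alpha>" using p0 by (simp add: gam field_simps)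
    hence "\<gamma> * (\<alpha> * ev (pderiv f) \<alpha>) = \<alpha> * ev r \<alpha>" by simp
    hence "- (of_int t * (y * \<gamma>)) = \<alpha> * ev r \<alpha>" unfolding rf(1) by (simp add: mult_ac)
    hence "of_int t * (y * \<gamma>) = - (\<alpha> * ev r \<alpha>)" by (simp only: minus_equation_iff)
    also have "\<dots> = ev (- ([:0, 1:] * r)) \<alpha>" by simp
    finally show "of_int t * (y * \<gamma>) \<in> adj \<alpha>" by (simp only: adjI)
    have "of_int p * (y * \<gamma>) = ev (Y * g) \<alpha>" by (simp add: g[symmetric] y_def)
    thus "of_int p * (y * \<gamma>) \<in> adj \<alpha>" by (simp only: adjI)
    show "Rings.coprime t p" using p prime_imp_coprime[of p t] by (simp add: coprime_commute)
  qed
  show ?thesis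
  proof (cases "p dvd L' n t")
    case False
    show ?thesis
    proof (rule adj_coprime_multiples[OF _ _ mult])
      show "Rings.coprime (L' n t) p" using False p(1) prime_imp_coprime[of p "L' n t"] by (simp add: coprime_commute)
      have "of_int (L' n t) * \<gamma> = - (z * (y * \<gamma>))" using rf(2) by (simp add: algebra_simps)
      moreover have "- (z * (y * \<gamma>)) \<in> adj \<alpha>" by (intro adj_minus adj_mult zA yg)
      ultimately show "of_int (L' n t) * \<gamma> \<in> adj \<alpha>" by simp
    qed
  next
    case True
    note pn = prime_not_dvd_facts[OF p True]
    have "Rings.coprime (int n - 1) p"
      using pn(1) p(1) prime_imp_coprime[of p "int n - 1"] by (simp add: coprime_commute)
    then obtain e where "[(int n - 1) * e = 1] (mod p)" using cong_solve_coprime_int by blast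
    then obtain k where k: "(int n - 1) * e = 1 + p * k" 
      by (metis cong_iff_lin cong_sym)
    \<comment> \<open>Modulo \<open>p\<close>, \<open>a\<close> is the root of \<open>Y\<close>, and it is the double root of \<open>f\<close>.\<close>
    define a where "a = - int n * e"
    have Ya: "poly Y a = - (p * (int n * k))"
    proof -
      have "poly Y a = int n - int n * ((int n - 1) * e)" by (simp add: Y_def a_def algebra_simps)
      thus ?thesis unfolding k by (simp add: algebra_simps)
    qed
    have pY: "p dvd poly Y a" unfolding Ya by simp
    have Za: "p dvd poly Z a"
    proof -
      have c: "[(int n - 1) * a = - int n] (mod p)"
      proof -
        have "(int n - 1) * a - (- int n) = poly Y a" by (simp add: Y_def algebra_simps)
        thus ?thesis using pY by (simp add: cong_iff_dvd_diff)
      qed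
      have "poly Z a = (\<Sum>k<n. (- int n) ^ (n - Suc k) * ((int n - 1) * a) ^ k) + t * (int n - 1) ^ (n - 1)"
        by (simp add: Z_def poly_sum mult.commute)
      also have "[\<dots> = (\<Sum>k<n. (- int n) ^ (n - Suc k) * (- int n) ^ k) + t * (int n - 1) ^ (n - 1)] (mod p)"
        by (intro cong_add cong_sum cong_mult cong_pow cong_refl c)
      also have "(\<Sum>k<n. (- int n) ^ (n - Suc k) * (- int n) ^ k) = (\<Sum>k<n. (- int n) ^ (n - 1))"
        by (intro sum.cong) (auto simp flip: power_add)
      also have "\<dots> = - ((- int n) ^ n)"
      proof -
        have "(- int n) ^ n = - int n * (- int n) ^ (n - 1)" using n by (cases n) auto
        thus ?thesis by simp
      qed
      also have "- ((- int n) ^ n) + t * (int n - 1) ^ (n - 1) = - L' n t" by (simp add: L'_def)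
      finally have "[poly Z a = - L' n t] (mod p)" .
      thus ?thesis using True cong_dvd_iff by (metis dvd_minus_iff)
    qed
    have fa: "p dvd poly f a"
    proof -
      have "p dvd (int n - 1) ^ n * poly f a"
        using ev_YZ[of a] pY True by simp
      thus ?thesis using pn(1) p(1) prime_dvd_mult_iff prime_dvd_power by blast
    qed
    \<comment> \<open>The prime ideal \<open>{r(\<alpha>). p dvd r(a)}\<close> is generated by \<open>p\<close> and \<open>y\<close>.\<close>
    have split: "\<exists>u v. r = [:p:] * u + Y * v" if "p dvd poly r a" for r
    proof -
      have "poly (r - [:poly r a:]) a = 0" by simp
      then obtain s where s: "r - [:poly r a:] = [:-a, 1:] * s" by (metis dvdE poly_eq_0_iff_dvd)
      obtain b where b: "poly r a = p * b" using \<open>p dvd poly r a\<close> by (rule dvdE)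
      have lin: "[:-a, 1:] = [:e:] * Y - [:p:] * [:0, k:]"
        using k by (simp add: Y_def a_def algebra_simps)
      have "r = [:p * b:] + [:-a, 1:] * s" using s b by (metis add.commute diff_add_cancel)
      also have "[:p * b:] = [:p:] * [:b:]" by simp
      finally have "r = [:p:] * ([:b:] - [:0, k:] * s) + Y * ([:e:] * s)"
        unfolding lin by (simp only: left_diff_distrib right_diff_distrib mult_ac)
      thus ?thesis by blast
    qed
    obtain U V where UV: "Z = [:p:] * U + Y * V" using split[OF Za] by blast
    define u where "u = ev U \<alpha>"
    define v where "v = ev V \<alpha>"
    have uvA: "u \<in> adj \<alpha>" "v \<in> adj \<alpha>" by (auto simp: u_def v_def)
    have zuv: "z = of_int p * u + y * v" by (simp add: z_def UV u_def v_def y_def)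
    obtain l where l: "L' n t = p * l" using True by auto
    have pl: "\<not> p dvd l" using pn(2) l by (auto simp: power2_eq_square)
    \<comment> \<open>Locally at that prime, \<open>l + y u\<close> is a unit, so \<open>y\<close> alone generates the prime.\<close>
    have rel: "of_int p * (of_int l + y * u) = - (y * y * v)"
      using rf(2) unfolding zuv l by (simp add: algebra_simps eq_neg_iff_add_eq_0)
    \<comment> \<open>If \<open>D(a)\<close> were a unit modulo \<open>p\<close>, then \<open>\<gamma>\<close> would have a pole of order one at the prime, which
       an equation of integral dependence excludes.\<close>
    obtain D where D: "y * \<gamma> = ev D \<alpha>" using yg by (auto simp: adj_def)
    have "p dvd poly D a"
    proof -
      obtain m c where mc: "m > 0" "\<gamma> ^ m = (\<Sum>i<m. of_int (c i) * \<gamma> ^ i)"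
        using algebraic_int_power_reduction[OF alg] by metis
      define H where "H = D ^ m - (\<Sum>i<m. [:c i:] * D ^ i * Y ^ (m - i))"
      have "ev H \<alpha> = (y * \<gamma>) ^ m - (\<Sum>i<m. of_int (c i) * (y * \<gamma>) ^ i * y ^ (m - i))"
        unfolding D by (simp add: H_def y_def mult.assoc)
      also have "(\<Sum>i<m. of_int (c i) * (y * \<gamma>) ^ i * y ^ (m - i)) = (\<Sum>i<m. y ^ m * (of_int (c i) * \<gamma> ^ i))"
        by (intro sum.cong refl)
           (simp add: power_mult_distrib mult.assoc mult.left_commute flip: power_add)
      also have "\<dots> = y ^ m * \<gamma> ^ m" by (simp add: mc(2) sum_distrib_left)
      finally have "ev H \<alpha> = 0" by (simp add: power_mult_distrib)
      hence "f dvd H" by (rule vanishing_imp_dvd)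
      hence "poly f a dvd poly H a" by (metis dvd_def poly_mult)
      hence pH: "p dvd poly H a" using fa dvd_trans by blast
      have "p dvd (\<Sum>i<m. c i * poly D a ^ i * poly Y a ^ (m - i))"
        by (intro dvd_sum dvd_mult dvd_trans[OF pY] dvd_power) auto
      hence "p dvd poly D a ^ m" using pH by (simp add: H_def poly_sum mult.assoc dvd_diff_left_iff)
      thus ?thesis using p(1) prime_dvd_power by blast
    qed
    then obtain U1 V1 where UV1: "D = [:p:] * U1 + Y * V1" using split by blast
    define u1 where "u1 = ev U1 \<alpha>"
    define v1 where "v1 = ev V1 \<alpha>"
    have uvA1: "u1 \<in> adj \<alpha>" "v1 \<in> adj \<alpha>" by (auto simp: u1_def v1_def)
    \<comment> \<open>Subtracting \<open>v1\<close> from \<open>\<gamma>\<close> leaves an element that a number prime to \<open>p\<close> carries into \<open>\<int>[\<alpha>]\<close>.\<close>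
    define \<gamma>' where "\<gamma>' = \<gamma> - v1"
    have yg': "y * \<gamma>' = of_int p * u1"
      using D by (simp add: \<gamma>'_def UV1 u1_def v1_def y_def algebra_simps)
    have "y * ((of_int l + y * u) * \<gamma>') = (of_int l + y * u) * (y * \<gamma>')" by (simp add: algebra_simps)
    also have "\<dots> = of_int p * (of_int l + y * u) * u1" unfolding yg' by (simp add: algebra_simps)
    also have "\<dots> = y * (- (y * v * u1))" unfolding rel by (simp add: algebra_simps)
    finally have "y * ((of_int l + y * u) * \<gamma>') = y * (- (y * v * u1))" .
    hence w: "(of_int l + y * u) * \<gamma>' = - (y * v * u1)"
      using mult_left_cancel[OF rf(4)] by blast
    have "\<gamma>' \<in> adj \<alpha>"
    proof (rule adj_coprime_multiples)
      show "Rings.coprime p l" using pl p(1) prime_imp_coprime by blast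
      have "of_int p * \<gamma>' = of_int p * \<gamma> - of_int p * v1" by (simp add: \<gamma>'_def algebra_simps)
      moreover have "of_int p * \<gamma> - of_int p * v1 \<in> adj \<alpha>"
        by (intro adj_diff mult adj_mult adj_of_int uvA1)
      ultimately show "of_int p * \<gamma>' \<in> adj \<alpha>" by simp
      have "of_int l * \<gamma>' = - (y * v * u1) - u * (y * \<gamma>')" using w by (simp add: algebra_simps)
      moreover have "- (y * v * u1) - u * (y * \<gamma>') \<in> adj \<alpha>"
        unfolding yg' by (intro adj_diff adj_minus adj_mult yA uvA uvA1 adj_of_int)
      ultimately show "of_int l * \<gamma>' \<in> adj \<alpha>" by simp
    qed
    moreover have "\<gamma> = \<gamma>' + v1" by (simp add: \<gamma>'_def)
    ultimately show ?thesis using uvA1 by (simp add: adj_add)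
  qed
qed

text \<open>The prime factors of a common denominator are removed one by one.\<close>

theorem in_adj_if_multiple:
  fixes m :: int
  assumes "m \<noteq> 0" "algebraic_int \<gamma>" "of_int m * \<gamma> \<in> adj \<alpha>"
  shows "\<gamma> \<in> adj \<alpha>"
  using assms
proof (induction "nat \<bar>m\<bar>" arbitrary: m \<gamma> rule: less_induct)
  case less
  show ?case
  proof (cases "\<bar>m\<bar> = 1")
    case True
    hence "m = 1 \<or> m = -1" by auto
    thus ?thesis using less.prems(3) adj_minus by fastforce
  next
    case False
    then obtain p where p: "prime p" "p dvd m"
      using prime_divisor_exists[of m] less.prems(1) by (metis zdvd1_eq)
    obtain k where k: "m = p * k" using p(2) by auto
    have p2: "p \<ge> 2" using p(1) prime_ge_2_int by blast
    have "of_int k * \<gamma> \<in> adj \<alpha>"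
    proof -
      have "algebraic_int (of_int k * \<gamma>)" using less.prems(2) by (intro algebraic_int_times) auto
      moreover have "of_int p * (of_int k * \<gamma>) \<in> adj \<alpha>"
        using less.prems(3) unfolding k of_int_mult mult.assoc .
      ultimately show ?thesis
        using in_adj_if_p_multiple_dvd_t[OF p(1)] in_adj_if_p_multiple_not_dvd_t[OF p(1)] by blast
    qed
    moreover have "nat \<bar>k\<bar> < nat \<bar>m\<bar>" "k \<noteq> 0"
    proof -
      show "k \<noteq> 0" using less.prems(1) k by auto
      hence "1 * \<bar>k\<bar> < p * \<bar>k\<bar>" using p2 by (intro mult_strict_right_mono) auto
      thus "nat \<bar>k\<bar> < nat \<bar>m\<bar>" using p2 by (simp add: k abs_mult)
    qed
    ultimately show ?thesis using less.hyps less.prems(2) by blast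
  qed
qed

end

section \<open>The number field as a subfield of the complex numbers\<close>

lemma complex_ring_simps [simp]:
  "carrier complex_ring = UNIV" "mult complex_ring = (*)" "one complex_ring = 1"
  "zero complex_ring = 0" "add complex_ring = (+)"
  by (simp_all add: complex_ring_def)

lemma field_complex_ring: "field complex_ring"
proof -
  have "cring complex_ring"
  proof (rule cringI)
    show "abelian_group complex_ring"
      by (rule abelian_groupI) (auto simp: algebra_simps intro!: exI[of _ "- _"] intro: minus_add_cancel left_minus)
    show "comm_monoid complex_ring"
      by (rule comm_monoidI) (auto simp: algebra_simps)
  qed (auto simp: algebra_simps)
  thus ?thesis
  proof (rule cring.cring_fieldI2)
    fix a assume "a \<noteq> \<zero>\<^bsub>complex_ring\<^esub>"
    thus "\<exists>b\<in>carrier complex_ring. a \<otimes>\<^bsub>complex_ring\<^esub> b = \<one>\<^bsub>complex_ring\<^esub>"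
      by (intro bexI[of _ "inverse a"]) auto
  qed auto
qed

interpretation CR: domain complex_ring by (rule field.axioms(1)[OF field_complex_ring])

lemma complex_ring_uminus [simp]: "\<ominus>\<^bsub>complex_ring\<^esub> x = - x"
  by (rule CR.minus_equality) auto

lemma complex_ring_inv [simp]: "x \<noteq> 0 \<Longrightarrow> inv\<^bsub>complex_ring\<^esub> x = inverse x"
  by (rule CR.inv_unique'[symmetric]) auto

lemma subring_complexI:
  assumes "1 \<in> S" "\<And>x. x \<in> S \<Longrightarrow> - x \<in> S" "\<And>x y. x \<in> S \<Longrightarrow> y \<in> S \<Longrightarrow> x + y \<in> S"
    "\<And>x y. x \<in> S \<Longrightarrow> y \<in> S \<Longrightarrow> x * y \<in> S"
  shows "subring S complex_ring"
  by (rule CR.subringI) (use assms in auto)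

lemma of_int_mem_subring:
  assumes "subring E complex_ring"
  shows "of_int k \<in> E"
proof -
  note s = subringE[OF assms]
  have nat: "of_nat m \<in> E" for m
  proof (induction m)
    case 0
    show ?case using s(2) by simp
  next
    case (Suc m)
    show ?case using s(7)[OF s(3) Suc] by simp
  qed
  show ?thesis
  proof (cases "k \<ge> 0")
    case True
    thus ?thesis using nat[of "nat k"] by simp
  next
    case False
    thus ?thesis using s(5)[OF nat[of "nat (- k)"]] by simp
  qed
qed

lemma subfield_complexI:
  assumes "subring S complex_ring" "\<And>x. x \<in> S \<Longrightarrow> x \<noteq> 0 \<Longrightarrow> inverse x \<in> S"
  shows "subfield S complex_ring"
  by (rule field.subfieldI'[OF field_complex_ring assms(1)]) (use assms(2) in auto)

lemma subfield_Rats: "subfield \<rat> complex_ring"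
  by (intro subfield_complexI subring_complexI) auto

text \<open>For \<open>m = n\<close> this will be the field; the smaller values of \<open>m\<close> form the flag that computes its
  dimension.\<close>

definition rat_span :: "nat \<Rightarrow> complex \<Rightarrow> complex set" where
  "rat_span m x = {\<Sum>i<m. q i * x ^ i |q. \<forall>i. q i \<in> \<rat>}"

lemma adj_rat_multiple:
  "y \<in> rat_span m x \<Longrightarrow> \<exists>k::int. k \<noteq> 0 \<and> of_int k * y \<in> adj x"
proof -
  assume "y \<in> rat_span m x"
  then obtain q where q: "\<And>i. q i \<in> \<rat>" "y = (\<Sum>i<m. q i * x ^ i)" by (auto simp: rat_span_def)
  have "\<exists>k::int. k \<noteq> 0 \<and> of_int k * (\<Sum>i<m. q i * x ^ i) \<in> adj x" for m
  proof (induction m)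
    case 0
    show ?case by (intro exI[of _ 1]) auto
  next
    case (Suc m)
    then obtain k :: int where k: "k \<noteq> 0" "of_int k * (\<Sum>i<m. q i * x ^ i) \<in> adj x" by blast
    obtain a b :: int where ab: "b > 0" "q m = of_int a / of_int b" using q(1)[of m] by (auto elim: Rats_cases')
    have "of_int b * q m = of_int a" using ab by simp
    hence "of_int (k * b) * (q m * x ^ m) = of_int (k * a) * x ^ m"
      by (metis (no_types, opaque_lifting) mult.assoc of_int_mult)
    hence "of_int (k * b) * (\<Sum>i<Suc m. q i * x ^ i) =
        of_int b * (of_int k * (\<Sum>i<m. q i * x ^ i)) + of_int (k * a) * x ^ m"
      by (simp only: sum.lessThan_Suc distrib_left of_int_mult) (simp only: mult_ac)
    moreover have "of_int b * (of_int k * (\<Sum>i<m. q i * x ^ i)) + of_int (k * a) * x ^ m \<in> adj x"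
      by (intro adj_add adj_mult[OF adj_of_int] adj_power adj_self k)
    ultimately show ?case using k(1) ab(1) by (intro exI[of _ "k * b"]) auto
  qed
  thus ?thesis using q(2) by blast
qed

context trinomial_root
begin

lemma adj_basis: "z \<in> adj \<alpha> \<longleftrightarrow> (\<exists>b::nat \<Rightarrow> int. z = (\<Sum>i<n. of_int (b i) * \<alpha> ^ i))"
proof
  assume "z \<in> adj \<alpha>"
  then obtain g where g: "z = ev g \<alpha>" by (auto simp: adj_def)
  obtain q r where qr: "g = f * q + r" "degree r < n" by (rule divide_by_f)
  have "z = ev r \<alpha>" using g by (simp add: qr(1))
  thus "\<exists>b::nat \<Rightarrow> int. z = (\<Sum>i<n. of_int (b i) * \<alpha> ^ i)" using ev_altdef_less[OF qr(2)] by metis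
next
  assume "\<exists>b::nat \<Rightarrow> int. z = (\<Sum>i<n. of_int (b i) * \<alpha> ^ i)"
  thus "z \<in> adj \<alpha>" by (auto intro!: adj_sum adj_mult adj_of_int adj_power adj_self)
qed

lemma basis_unique:
  fixes b b' :: "nat \<Rightarrow> int"
  assumes "(\<Sum>i<n. of_int (b i) * \<alpha> ^ i) = (\<Sum>i<n. of_int (b' i) * \<alpha> ^ i)" "i < n"
  shows "b i = b' i"
proof -
  define g where "g = (\<Sum>i<n. Polynomial.monom (b i - b' i) i)"
  have c: "coeff g i = (if i < n then b i - b' i else 0)" for i
    by (simp add: g_def coeff_sum coeff_monom sum.delta)
  have "degree g \<le> n - 1" by (rule degree_le) (use c n in auto)
  hence "degree g < n" using n by simp
  moreover have "ev g \<alpha> = (\<Sum>i<n. of_int (b i) * \<alpha> ^ i) - (\<Sum>i<n. of_int (b' i) * \<alpha> ^ i)"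
    by (simp add: g_def sum_subtractf algebra_simps)
  ultimately have "g = 0" using assms(1) linear_independence_int by simp
  thus ?thesis using c[of i] assms(2) by simp
qed

definition K :: "complex set" where "K = rat_span n \<alpha>"

text \<open>Membership in the field through denominators is the form in which maximality of \<open>\<int>[\<alpha>]\<close> applies.\<close>

lemma K_iff: "z \<in> K \<longleftrightarrow> (\<exists>k::int. k \<noteq> 0 \<and> of_int k * z \<in> adj \<alpha>)"
proof
  assume "z \<in> K"
  thus "\<exists>k::int. k \<noteq> 0 \<and> of_int k * z \<in> adj \<alpha>" unfolding K_def by (rule adj_rat_multiple)
next
  assume "\<exists>k::int. k \<noteq> 0 \<and> of_int k * z \<in> adj \<alpha>"
  then obtain k :: int and b :: "nat \<Rightarrow> int" where k: "k \<noteq> 0" "of_int k * z = (\<Sum>i<n. of_int (b i) * \<alpha> ^ i)"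
    using adj_basis by blast
  have "z = of_int k * z / of_int k" using k(1) by simp
  also have "\<dots> = (\<Sum>i<n. (of_int (b i) / of_int k) * \<alpha> ^ i)" unfolding k(2) by (simp add: sum_divide_distrib)
  finally show "z \<in> K" unfolding K_def rat_span_def
    by (intro CollectI exI[of _ "\<lambda>i. of_int (b i) / of_int k"]) auto
qed

lemma adj_subset_K: "adj \<alpha> \<subseteq> K"
proof
  fix z assume "z \<in> adj \<alpha>"
  thus "z \<in> K" unfolding K_iff by (intro exI[of _ 1]) simp
qed

lemma subring_adj: "subring (adj x) complex_ring"
  by (intro subring_complexI) auto

lemma subring_K: "subring K complex_ring"
proof (rule subring_complexI)
  show "1 \<in> K" using adj_subset_K by auto
  show "- x \<in> K" if x: "x \<in> K" for x
  proof -
    obtain k :: int where k: "k \<noteq> 0" "of_int k * x \<in> adj \<alpha>" using x unfolding K_iff by blast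
    hence "of_int k * (- x) \<in> adj \<alpha>" using adj_minus by fastforce
    thus ?thesis using k(1) unfolding K_iff by blast
  qed
  fix x y assume "x \<in> K" "y \<in> K"
  then obtain k l :: int where k: "k \<noteq> 0" "of_int k * x \<in> adj \<alpha>" and l: "l \<noteq> 0" "of_int l * y \<in> adj \<alpha>"
    unfolding K_iff by blast
  have "of_int l * (of_int k * x) + of_int k * (of_int l * y) \<in> adj \<alpha>"
    by (rule adj_add; rule adj_mult[OF adj_of_int]; fact)
  hence "of_int (k * l) * (x + y) \<in> adj \<alpha>" by (simp add: algebra_simps)
  thus "x + y \<in> K" using k(1) l(1) unfolding K_iff by (metis mult_eq_0_iff)
  have "of_int k * x * (of_int l * y) \<in> adj \<alpha>" by (rule adj_mult; fact)
  hence "of_int (k * l) * (x * y) \<in> adj \<alpha>" by (simp add: mult_ac)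
  thus "x * y \<in> K" using k(1) l(1) unfolding K_iff by (metis mult_eq_0_iff)
qed

text \<open>An equation of \<open>z\<close> with nonzero constant term expresses that term, divided by \<open>z\<close>, as a polynomial
  in \<open>z\<close>.\<close>

lemma inverse_multiple_in_adj:
  assumes "z \<in> adj \<alpha>" "z \<noteq> 0"
  shows "\<exists>k::int. k \<noteq> 0 \<and> of_int k * inverse z \<in> adj \<alpha>"
proof -
  obtain p where pz: "ev p z = 0" and "lead_coeff p = 1"
    using adj_alg[OF assms(1)] unfolding algebraic_int_ev_def by blast
  hence p0: "p \<noteq> 0" by auto
  from p0 pz have "\<exists>p. coeff p 0 \<noteq> 0 \<and> ev p z = 0"
  proof (induction p)
    case (pCons a p)
    show ?case
    proof (cases "a = 0")
      case True
      hence "p \<noteq> 0" "ev p z = 0" using pCons.prems assms(2) by auto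
      thus ?thesis by (rule pCons.IH)
    next
      case False
      thus ?thesis using pCons.prems by (intro exI[of _ "pCons a p"]) simp
    qed
  qed simp
  then obtain p where p: "coeff p 0 \<noteq> 0" "ev p z = 0" by blast
  obtain a q where aq: "p = pCons a q" by (cases p)
  have "of_int a + z * ev q z = 0" using p(2) by (simp add: aq)
  hence "of_int a = - (z * ev q z)" by (simp add: eq_neg_iff_add_eq_0)
  hence "of_int a * inverse z = - ev q z" using assms(2) by (simp add: field_simps)
  moreover have "ev q z \<in> adj \<alpha>"
    unfolding ev_altdef by (intro adj_sum adj_mult adj_of_int adj_power assms)
  ultimately show ?thesis using p(1) by (intro exI[of _ a]) (auto simp: aq)
qed

lemma subfield_K: "subfield K complex_ring"
proof (rule subfield_complexI[OF subring_K])
  fix x assume x: "x \<in> K" "x \<noteq> 0"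
  then obtain k :: int where k: "k \<noteq> 0" "of_int k * x \<in> adj \<alpha>" unfolding K_iff by blast
  then obtain l :: int where l: "l \<noteq> 0" "of_int l * inverse (of_int k * x) \<in> adj \<alpha>"
    using inverse_multiple_in_adj[of "of_int k * x"] x(2) by auto
  have "of_int l * inverse x = of_int k * (of_int l * inverse (of_int k * x))"
    using k(1) x(2) by (simp add: field_simps)
  moreover have "of_int k * (of_int l * inverse (of_int k * x)) \<in> adj \<alpha>"
    by (rule adj_mult[OF adj_of_int l(2)])
  ultimately show "inverse x \<in> K" using l(1) unfolding K_iff by metis
qed

lemma Rats_subset_subfield:
  assumes "subfield E complex_ring"
  shows "\<rat> \<subseteq> E"
proof -
  note s = subfieldE(1)[OF assms]
  note int = of_int_mem_subring[OF s]
  show ?thesis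
  proof
    fix q :: complex assume "q \<in> \<rat>"
    then obtain a b :: int where ab: "b > 0" "q = of_int a / of_int b" by (auto elim: Rats_cases')
    have b: "of_int b \<noteq> (0::complex)" using ab(1) by simp
    have "inv\<^bsub>complex_ring\<^esub> (of_int b) \<in> E"
      using CR.subfield_m_inv(1)[OF assms, of "of_int b"] int[of b] b by simp
    hence "inverse (of_int b) \<in> E" using complex_ring_inv[OF b] by simp
    from subringE(6)[OF s int[of a] this] have "of_int a * inverse (of_int b) \<in> E" by simp
    thus "q \<in> E" by (simp add: ab(2) divide_inverse)
  qed
qed

lemma rationals_adjoin_eq:
  fixes c :: int
  assumes "c \<noteq> 0"
  shows "rationals_adjoin (of_int c * \<alpha>) = K"
  unfolding rationals_adjoin_def
proof (rule field.generate_fieldI[OF field_complex_ring, symmetric])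
  show "subfield K complex_ring" by (rule subfield_K)
  have "of_int c * \<alpha> \<in> adj \<alpha>" by (intro adj_mult adj_of_int adj_self)
  thus "{of_int c * \<alpha>} \<subseteq> K" using adj_subset_K by auto
  fix E assume E: "subfield E complex_ring" "{of_int c * \<alpha>} \<subseteq> E"
  note s = subringE[OF subfieldE(1)[OF E(1)]]
  note Q = Rats_subset_subfield[OF E(1)]
  have "inverse (of_int c) \<in> (\<rat> :: complex set)" by simp
  hence "inverse (of_int c) \<in> E" using Q by blast
  moreover have "of_int c * \<alpha> \<in> E" using E(2) by simp
  ultimately have "inverse (of_int c) \<otimes>\<^bsub>complex_ring\<^esub> (of_int c * \<alpha>) \<in> E" by (rule s(6))
  hence \<alpha>: "\<alpha> \<in> E" using assms by (simp add: mult.assoc[symmetric])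
  have pow: "\<alpha> ^ i \<in> E" for i
  proof (induction i)
    case 0
    show ?case using s(3) by simp
  next
    case (Suc i)
    show ?case using s(6)[OF \<alpha> Suc] by simp
  qed
  show "K \<subseteq> E"
  proof
    fix z assume "z \<in> K"
    then obtain q where q: "\<And>i. q i \<in> \<rat>" "z = (\<Sum>i<n. q i * \<alpha> ^ i)" by (auto simp: K_def rat_span_def)
    have "(\<Sum>i<m. q i * \<alpha> ^ i) \<in> E" for m
    proof (induction m)
      case (Suc m)
      have "q m \<in> E" using q(1) Q by blast
      hence "q m \<otimes>\<^bsub>complex_ring\<^esub> \<alpha> ^ m \<in> E" using pow by (rule s(6))
      thus ?case using s(7)[OF Suc] by simp
    qed (use s(2) in simp)
    thus "z \<in> E" by (simp add: q(2))
  qed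
qed auto

lemma dimension_K: "CR.dimension n \<rat> K"
proof -
  have "m \<le> n \<Longrightarrow> CR.dimension m \<rat> (rat_span m \<alpha>)" for m
  proof (induction m)
    case 0
    have "rat_span 0 \<alpha> = {\<zero>\<^bsub>complex_ring\<^esub>}" by (auto simp: rat_span_def)
    thus ?case by (simp only: CR.zero_dim)
  next
    case (Suc m)
    have "rat_span (Suc m) \<alpha> = CR.line_extension \<rat> (\<alpha> ^ m) (rat_span m \<alpha>)"
    proof (intro equalityI subsetI)
      fix z assume "z \<in> rat_span (Suc m) \<alpha>"
      then obtain q where q: "\<forall>i. q i \<in> \<rat>" "z = (\<Sum>i<Suc m. q i * \<alpha> ^ i)" by (auto simp: rat_span_def)
      have "z = q m \<otimes>\<^bsub>complex_ring\<^esub> \<alpha> ^ m \<oplus>\<^bsub>complex_ring\<^esub> (\<Sum>i<m. q i * \<alpha> ^ i)" by (simp add: q(2))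
      moreover have "(\<Sum>i<m. q i * \<alpha> ^ i) \<in> rat_span m \<alpha>" using q(1) by (auto simp: rat_span_def)
      ultimately show "z \<in> CR.line_extension \<rat> (\<alpha> ^ m) (rat_span m \<alpha>)"
        using CR.line_extension_mem_iff q(1) by blast
    next
      fix z assume "z \<in> CR.line_extension \<rat> (\<alpha> ^ m) (rat_span m \<alpha>)"
      then obtain k v where kv: "k \<in> \<rat>" "v \<in> rat_span m \<alpha>" "z = k * \<alpha> ^ m + v"
        using CR.line_extension_mem_iff by auto
      then obtain q where q: "\<forall>i. q i \<in> \<rat>" "v = (\<Sum>i<m. q i * \<alpha> ^ i)" by (auto simp: rat_span_def)
      have "z = (\<Sum>i<Suc m. (q(m := k)) i * \<alpha> ^ i)" by (simp add: kv(3) q(2))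
      thus "z \<in> rat_span (Suc m) \<alpha>" unfolding rat_span_def
        using q(1) kv(1) by (intro CollectI exI[of _ "q(m := k)"]) auto
    qed
    moreover have "\<alpha> ^ m \<notin> rat_span m \<alpha>"
    proof
      assume "\<alpha> ^ m \<in> rat_span m \<alpha>"
      then obtain q where q: "\<forall>i. q i \<in> \<rat>" "\<alpha> ^ m = (\<Sum>i<m. q i * \<alpha> ^ i)" by (auto simp: rat_span_def)
      have "\<exists>k::int. k \<noteq> 0 \<and> (\<forall>i<j. \<exists>a::int. of_int k * q i = of_int a)" for j
      proof (induction j)
        case (Suc j)
        then obtain k :: int where k: "k \<noteq> 0" "\<forall>i<j. \<exists>a::int. of_int k * q i = of_int a" by blast
        obtain a b :: int where ab: "b > 0" "q j = of_int a / of_int b" using q(1) by (metis Rats_cases')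
        show ?case
        proof (rule exI[of _ "k * b"], intro conjI allI impI)
          fix i assume i: "i < Suc j"
          show "\<exists>a::int. of_int (k * b) * q i = of_int a"
          proof (cases "i = j")
            case True
            thus ?thesis using ab by (intro exI[of _ "k * a"]) simp
          next
            case False
            hence "i < j" using i by simp
            then obtain d :: int where d: "of_int k * q i = of_int d" using k(2) by blast
            have "of_int (k * b) * q i = of_int b * (of_int k * q i)"
              by (subst mult.commute[of k b]) (simp only: of_int_mult mult.assoc)
            also have "\<dots> = of_int (b * d)" unfolding d by simp
            finally have "of_int (k * b) * q i = of_int (b * d)" .
            thus ?thesis by blast
          qed
        qed (use k ab in auto)
      qed (intro exI[of _ 1], simp)
      then obtain k :: int where k: "k \<noteq> 0" "\<forall>i<m. \<exists>a::int. of_int k * q i = of_int a" by blast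
      then obtain a :: "nat \<Rightarrow> int" where a: "\<And>i. i < m \<Longrightarrow> of_int k * q i = of_int (a i)" by metis
      have "of_int k * \<alpha> ^ m = (\<Sum>i<m. of_int (a i) * \<alpha> ^ i)"
        unfolding q(2) sum_distrib_left by (intro sum.cong) (auto simp: a mult.assoc[symmetric])
      moreover have "(\<Sum>i<n. of_int (if i = m then k else 0) * \<alpha> ^ i) = of_int k * \<alpha> ^ m"
        using Suc.prems by (subst sum.remove[of _ m]) auto
      moreover have "(\<Sum>i<n. of_int (if i < m then a i else 0) * \<alpha> ^ i) = (\<Sum>i<m. of_int (a i) * \<alpha> ^ i)"
        using Suc.prems by (intro sum.mono_neutral_cong_right) auto
      ultimately have "(\<Sum>i<n. of_int (if i = m then k else 0) * \<alpha> ^ i) = (\<Sum>i<n. of_int (if i < m then a i else 0) * \<alpha> ^ i)"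
        by simp
      from basis_unique[OF this, of m] show False using Suc.prems k(1) by simp
    qed
    ultimately show ?case using Suc CR.Suc_dim[of "\<alpha> ^ m" "rat_span m \<alpha>" m \<rat>] by simp
  qed
  thus ?thesis unfolding K_def by blast
qed

lemma field_degree_K: "field_degree K = n"
  unfolding field_degree_def
  by (rule the_equality) (use dimension_K CR.dimension_is_inj[OF subfield_Rats] in auto)

lemma number_field_K: "number_field K"
  unfolding number_field_def using subfield_K dimension_K by blast

theorem integers_K: "carrier (ring_of_integers K) = adj \<alpha>"
proof -
  have "z \<in> adj \<alpha>" if "z \<in> K" "algebraic_int z" for z
    using that in_adj_if_multiple unfolding K_iff by blast
  thus ?thesis using adj_subset_K adj_alg by (auto simp: ring_of_integers_def)
qed

end

section \<open>The order generated by a multiple of the root\<close>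

lemma ring_of_integers_simps [simp]:
  "mult (ring_of_integers K) = (*)" "one (ring_of_integers K) = 1"
  "zero (ring_of_integers K) = 0" "add (ring_of_integers K) = (+)"
  "r \<odot>\<^bsub>ring_of_integers K\<^esub> x = of_int r * x"
  by (simp_all add: ring_of_integers_def)

lemma algebra_ring_of_integers:
  assumes "subring K complex_ring"
  shows "cring (ring_of_integers K)" "module \<Z> (ring_of_integers K)"
proof -
  note s = subringE[OF assms]
  have mem: "x \<in> carrier (ring_of_integers K) \<longleftrightarrow> x \<in> K \<and> algebraic_int x" for x
    by (simp add: ring_of_integers_def)
  have neg: "- x \<in> carrier (ring_of_integers K)" if "x \<in> carrier (ring_of_integers K)" for x
    using that s(5)[of x] by (simp add: mem)
  have add: "x + y \<in> carrier (ring_of_integers K)"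
    if "x \<in> carrier (ring_of_integers K)" "y \<in> carrier (ring_of_integers K)" for x y
    using that s(7)[of x y] by (simp add: mem algebraic_int_plus)
  have mult: "x * y \<in> carrier (ring_of_integers K)"
    if "x \<in> carrier (ring_of_integers K)" "y \<in> carrier (ring_of_integers K)" for x y
    using that s(6)[of x y] by (simp add: mem algebraic_int_times)
  have zero: "0 \<in> carrier (ring_of_integers K)" and one: "1 \<in> carrier (ring_of_integers K)"
    using s(2,3) by (simp_all add: mem)
  have ab: "abelian_group (ring_of_integers K)"
  proof (rule abelian_groupI)
    fix x assume "x \<in> carrier (ring_of_integers K)"
    thus "\<exists>y\<in>carrier (ring_of_integers K). y \<oplus>\<^bsub>ring_of_integers K\<^esub> x = \<zero>\<^bsub>ring_of_integers K\<^esub>"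
      using neg by (intro bexI[of _ "- x"]) auto
  qed (use add zero in auto)
  show cr: "cring (ring_of_integers K)"
    by (rule cringI[OF ab]) (auto intro!: comm_monoidI mult one simp: algebra_simps)
  have int: "of_int k \<in> carrier (ring_of_integers K)" for k
    using of_int_mem_subring[OF assms] by (simp add: mem)
  show "module \<Z> (ring_of_integers K)"
    by (rule moduleI) (auto simp: ab algebra_simps intro!: mult int int.is_cring)
qed

lemma card_bounded_digits: "card (PiE {..<n::nat} (\<lambda>i. {0..<(c::int) ^ i})) = nat c ^ (n * (n - 1) div 2)" if "c > 0"
proof -
  have "card (PiE {..<n} (\<lambda>i. {0..<c ^ i})) = (\<Prod>i<n. nat c ^ i)"
    using that by (subst card_PiE) (simp_all add: nat_power_eq)
  also have "\<dots> = nat c ^ (\<Sum>i<n. i)" by (simp add: power_sum)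
  also have "(\<Sum>i<n. i) = n * (n - 1) div 2"
    by (metis Sum_Ico_nat atLeast0LessThan diff_zero mult.commute mult_zero_left)
  finally show ?thesis .
qed

context trinomial_root
begin

lemma integers_adjoin_eq: "integers_adjoin x = adj x"
  unfolding integers_adjoin_def
proof (rule CR.generate_ringI[symmetric])
  show "subring (adj x) complex_ring" by (rule subring_adj)
  show "{x} \<subseteq> adj x" by auto
  fix E assume E: "subring E complex_ring" "{x} \<subseteq> E"
  note s = subringE[OF E(1)]
  note int = of_int_mem_subring[OF E(1)]
  have "ev p x \<in> E" for p
  proof (induction p)
    case (pCons a p)
    have "x \<otimes>\<^bsub>complex_ring\<^esub> ev p x \<in> E" using E(2) pCons by (intro s(6)) auto
    thus ?case using s(7)[OF int[of a]] by simp
  qed (use s(2) in simp)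
  thus "adj x \<subseteq> E" by (auto simp: adj_def)
qed auto

text \<open>Division with remainder by the monic polynomial \<open>c\<^sup>n f(X / c)\<close> of \<open>c \<alpha>\<close>.\<close>

lemma adj_scaled:
  fixes c :: int
  assumes "c \<noteq> 0"
  shows "z \<in> adj (of_int c * \<alpha>) \<longleftrightarrow> (\<exists>b::nat \<Rightarrow> int. z = (\<Sum>i<n. of_int (b i * c ^ i) * \<alpha> ^ i))"
proof
  assume "z \<in> adj (of_int c * \<alpha>)"
  then obtain g where g: "z = ev g (of_int c * \<alpha>)" by (auto simp: adj_def)
  \<comment> \<open>This is \<open>c\<^sup>n f(X / c)\<close>, a monic integer polynomial that vanishes at \<open>c \<alpha>\<close>.\<close>
  define h where "h = Polynomial.monom 1 n + [:c ^ n * t, c ^ (n - 1) * t:]"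
  have lin: "degree [:c ^ n * t, c ^ (n - 1) * t:] < n" using n by (simp add: le_less_trans[OF degree_pCons_le])
  have deg: "degree h = n" unfolding h_def using lin by (subst degree_add_eq_left) (simp_all add: degree_monom_eq)
  have "coeff [:c ^ n * t, c ^ (n - 1) * t:] n = 0" using lin by (rule coeff_eq_0)
  hence lc: "lead_coeff h = 1" unfolding deg by (simp add: h_def)
  have h0: "ev h (of_int c * \<alpha>) = 0"
  proof -
    have cn: "c ^ n = c ^ (n - 1) * c" using n by (cases n) auto
    have rearrange: "(d * e) * a + ((d * e) * s + e * x * (d * s)) = (d * e) * (a + s * x + s)"
      for a d e s x :: complex by (simp add: algebra_simps)
    have "ev h (of_int c * \<alpha>) = (of_int c * \<alpha>) ^ n +
        (of_int (c ^ n) * of_int t + of_int c * \<alpha> * (of_int (c ^ (n - 1)) * of_int t))"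
      by (simp add: h_def)
    also have "(of_int c * \<alpha>) ^ n = of_int (c ^ n) * \<alpha> ^ n" by (simp add: power_mult_distrib)
    also have "of_int (c ^ n) * \<alpha> ^ n + (of_int (c ^ n) * of_int t + of_int c * \<alpha> * (of_int (c ^ (n - 1)) * of_int t))
        = of_int (c ^ n) * ev f \<alpha>"
      unfolding ev_f cn of_int_mult by (rule rearrange)
    finally show ?thesis by simp
  qed
  have "h \<noteq> 0" using lc by auto
  obtain q r where "pseudo_divmod g h = (q, r)" by force
  from pseudo_divmod[OF \<open>h \<noteq> 0\<close> this] have qr: "g = h * q + r" "r = 0 \<or> degree r < n"
    using lc deg by simp_all
  hence "degree r < n" using n by auto
  moreover have "z = ev r (of_int c * \<alpha>)" using g h0 by (simp add: qr(1))
  ultimately have "z = (\<Sum>i<n. of_int (coeff r i) * (of_int c * \<alpha>) ^ i)" by (simp only: ev_altdef_less)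
  hence "z = (\<Sum>i<n. of_int (coeff r i * c ^ i) * \<alpha> ^ i)" by (simp add: power_mult_distrib mult.assoc)
  thus "\<exists>b::nat \<Rightarrow> int. z = (\<Sum>i<n. of_int (b i * c ^ i) * \<alpha> ^ i)" by (rule exI[of _ "coeff r"])
next
  assume "\<exists>b::nat \<Rightarrow> int. z = (\<Sum>i<n. of_int (b i * c ^ i) * \<alpha> ^ i)"
  then obtain b :: "nat \<Rightarrow> int" where "z = (\<Sum>i<n. of_int (b i * c ^ i) * \<alpha> ^ i)" by blast
  hence "z = (\<Sum>i<n. of_int (b i) * (of_int c * \<alpha>) ^ i)" by (simp add: power_mult_distrib mult.assoc)
  thus "z \<in> adj (of_int c * \<alpha>)" by (auto intro!: adj_sum adj_mult adj_of_int adj_power adj_self)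
qed

text \<open>In the coordinates with respect to the powers of \<open>\<alpha>\<close> the subgroup is the product of the groups
  \<open>c\<^sup>i \<int>\<close>, so the residues \<open>0 \<le> b\<^sub>i < c\<^sup>i\<close> represent the cosets.\<close>

theorem additive_index_adj:
  fixes c :: int
  assumes c: "c > 0"
  shows "int (additive_index (ring_of_integers K) (adj (of_int c * \<alpha>))) = c ^ (n * (n - 1) div 2)"
proof -
  let ?O = "ring_of_integers K" and ?S = "adj (of_int c * \<alpha>)"
  interpret O: cring ?O by (rule algebra_ring_of_integers(1)[OF subring_K])
  have c0: "c \<noteq> 0" using c by simp
  define P where "P = PiE {..<n} (\<lambda>i. {0..<c ^ i})"
  define comb where "comb b = (\<Sum>i<n. of_int (b i) * \<alpha> ^ i)" for b :: "nat \<Rightarrow> int"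
  define coset where "coset b = ?S +>\<^bsub>?O\<^esub> comb b" for b
  have coset_mem: "z \<in> ?S +>\<^bsub>?O\<^esub> a \<longleftrightarrow> z - a \<in> ?S" for z a
    by (auto simp: a_r_coset_def' intro!: bexI[of _ "z - a"])
  have comb: "comb b \<in> carrier ?O" for b unfolding integers_K comb_def using adj_basis by blast
  have eq: "?S +>\<^bsub>?O\<^esub> a = ?S +>\<^bsub>?O\<^esub> b \<longleftrightarrow> a - b \<in> ?S" for a b
  proof
    assume "?S +>\<^bsub>?O\<^esub> a = ?S +>\<^bsub>?O\<^esub> b"
    moreover have "a \<in> ?S +>\<^bsub>?O\<^esub> a" unfolding coset_mem by (simp add: adj_0)
    ultimately show "a - b \<in> ?S" using coset_mem by blast
  next
    assume ab: "a - b \<in> ?S"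
    have "z - a \<in> ?S \<longleftrightarrow> z - b \<in> ?S" for z
    proof
      assume "z - a \<in> ?S"
      from adj_add[OF this ab] show "z - b \<in> ?S" by simp
    next
      assume "z - b \<in> ?S"
      from adj_diff[OF this ab] show "z - a \<in> ?S" by simp
    qed
    thus "?S +>\<^bsub>?O\<^esub> a = ?S +>\<^bsub>?O\<^esub> b" using coset_mem by blast
  qed
  have inj: "inj_on coset P"
  proof (rule inj_onI)
    fix b b' assume b: "b \<in> P" "b' \<in> P" "coset b = coset b'"
    hence "comb b - comb b' \<in> ?S" using eq by (simp add: coset_def)
    then obtain d :: "nat \<Rightarrow> int" where "comb b - comb b' = (\<Sum>i<n. of_int (d i * c ^ i) * \<alpha> ^ i)"
      using adj_scaled[OF c0] by blast
    hence "(\<Sum>i<n. of_int (b i - b' i) * \<alpha> ^ i) = (\<Sum>i<n. of_int (d i * c ^ i) * \<alpha> ^ i)"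
      by (simp add: comb_def left_diff_distrib sum_subtractf)
    hence d: "b i - b' i = d i * c ^ i" if "i < n" for i by (rule basis_unique) (rule that)
    have "b i = b' i" if i: "i < n" for i
    proof -
      have "b i mod c ^ i = b' i mod c ^ i" using d[OF i] by (simp add: mod_eq_dvd_iff)
      moreover have "0 \<le> b i" "b i < c ^ i" "0 \<le> b' i" "b' i < c ^ i"
        using b(1,2) i by (auto simp: P_def PiE_iff)
      ultimately show ?thesis by simp
    qed
    thus "b = b'" using b(1,2) by (intro PiE_ext[of b "{..<n}" _ b']) (auto simp: P_def)
  qed
  have "a_rcosets\<^bsub>?O\<^esub> ?S = coset ` P"
  proof (intro equalityI subsetI)
    fix X assume "X \<in> a_rcosets\<^bsub>?O\<^esub> ?S"
    then obtain z where z: "z \<in> carrier ?O" "X = ?S +>\<^bsub>?O\<^esub> z" by (auto simp: A_RCOSETS_def')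
    then obtain b :: "nat \<Rightarrow> int" where b: "z = comb b" using adj_basis unfolding integers_K comb_def by blast
    define b' where "b' = restrict (\<lambda>i. b i mod c ^ i) {..<n}"
    have "z - comb b' = (\<Sum>i<n. of_int (b i - b' i) * \<alpha> ^ i)"
      by (simp add: b comb_def left_diff_distrib sum_subtractf)
    also have "\<dots> = (\<Sum>i<n. of_int ((b i div c ^ i) * c ^ i) * \<alpha> ^ i)"
    proof (rule sum.cong[OF refl])
      fix i assume "i \<in> {..<n}"
      hence "b i - b' i = (b i div c ^ i) * c ^ i" by (simp add: b'_def minus_mod_eq_div_mult)
      thus "of_int (b i - b' i) * \<alpha> ^ i = of_int ((b i div c ^ i) * c ^ i) * \<alpha> ^ i" by (simp only:)
    qed
    finally have "z - comb b' \<in> ?S"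
      unfolding adj_scaled[OF c0] by (rule exI[of _ "\<lambda>i. b i div c ^ i"])
    hence "X = coset b'" using eq z(2) by (simp add: coset_def)
    moreover have "b' \<in> P" using c by (auto simp: P_def b'_def)
    ultimately show "X \<in> coset ` P" by blast
  next
    fix X assume "X \<in> coset ` P"
    thus "X \<in> a_rcosets\<^bsub>?O\<^esub> ?S" using comb by (auto simp: A_RCOSETS_def' coset_def)
  qed
  hence "additive_index ?O ?S = card P" using inj by (simp add: additive_index_def card_image)
  thus ?thesis unfolding P_def card_bounded_digits[OF c] using c by simp
qed

lemma is_order_adj:
  fixes c :: int
  assumes c: "c \<noteq> 0"
  shows "is_order (adj (of_int c * \<alpha>)) K"
  unfolding is_order_def
proof (intro conjI ballI)
  let ?S = "adj (of_int c * \<alpha>)"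
  show "subring ?S complex_ring" by (rule subring_adj)
  have sub: "?S \<subseteq> adj \<alpha>"
  proof
    fix z assume "z \<in> ?S"
    then obtain b :: "nat \<Rightarrow> int" where "z = (\<Sum>i<n. of_int (b i * c ^ i) * \<alpha> ^ i)"
      using adj_scaled[OF c] by blast
    thus "z \<in> adj \<alpha>" unfolding adj_basis by (rule exI[of _ "\<lambda>i. b i * c ^ i"])
  qed
  thus "?S \<subseteq> K" using adj_subset_K by blast
  define w where "w i = of_int (c ^ i) * \<alpha> ^ i" for i
  have inj: "inj_on w {..<n}"
  proof (rule inj_onI)
    fix i j assume ij: "i \<in> {..<n}" "j \<in> {..<n}" "w i = w j"
    have single: "(\<Sum>k<n. of_int (if k = i then c ^ i else 0) * \<alpha> ^ k) = w i" if "i < n" for i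
      using that by (subst sum.remove[of _ i]) (auto simp: w_def)
    have "(\<Sum>k<n. of_int (if k = i then c ^ i else 0) * \<alpha> ^ k) = (\<Sum>k<n. of_int (if k = j then c ^ j else 0) * \<alpha> ^ k)"
      using single ij by simp
    from basis_unique[OF this, of i] show "i = j" using ij(1) c by (auto split: if_splits)
  qed
  show "\<exists>B. finite B \<and> ?S = {\<Sum>b\<in>B. of_int (k b) * b |k. True}"
  proof (intro exI[of _ "w ` {..<n}"] conjI equalityI subsetI)
    fix z assume "z \<in> ?S"
    then obtain b :: "nat \<Rightarrow> int" where b: "z = (\<Sum>i<n. of_int (b i * c ^ i) * \<alpha> ^ i)"
      using adj_scaled[OF c] by blast
    define k where "k x = b (inv_into {..<n} w x)" for x
    have "(\<Sum>x\<in>w ` {..<n}. of_int (k x) * x) = (\<Sum>i<n. of_int (k (w i)) * w i)"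
      by (simp add: sum.reindex[OF inj])
    also have "\<dots> = z"
      unfolding b
    proof (rule sum.cong[OF refl])
      fix i assume "i \<in> {..<n}"
      hence "k (w i) = b i" unfolding k_def by (simp only: inv_into_f_f[OF inj])
      thus "of_int (k (w i)) * w i = of_int (b i * c ^ i) * \<alpha> ^ i" by (simp add: w_def)
    qed
    finally show "z \<in> {\<Sum>b\<in>w ` {..<n}. of_int (k b) * b |k. True}" by blast
  next
    fix z assume "z \<in> {\<Sum>b\<in>w ` {..<n}. of_int (k b) * b |k. True}"
    then obtain k :: "complex \<Rightarrow> int" where k: "z = (\<Sum>b\<in>w ` {..<n}. of_int (k b) * b)" by blast
    have "z = (\<Sum>i<n. of_int (k (w i) * c ^ i) * \<alpha> ^ i)"
      unfolding k sum.reindex[OF inj] by (intro sum.cong refl) (simp add: w_def mult.assoc)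
    thus "z \<in> ?S" unfolding adj_scaled[OF c] by (rule exI[of _ "\<lambda>i. k (w i)"])
  qed simp
  fix x assume "x \<in> K"
  then obtain k :: int where k: "k \<noteq> 0" "of_int k * x \<in> adj \<alpha>" unfolding K_iff by blast
  then obtain b :: "nat \<Rightarrow> int" where b: "of_int k * x = (\<Sum>i<n. of_int (b i) * \<alpha> ^ i)" using adj_basis by blast
  have "of_int (c ^ n * k) * x = of_int (c ^ n) * (of_int k * x)" by (simp add: mult.assoc)
  also have "\<dots> = (\<Sum>i<n. of_int ((b i * c ^ (n - i)) * c ^ i) * \<alpha> ^ i)"
    unfolding b sum_distrib_left
  proof (rule sum.cong[OF refl])
    fix i assume "i \<in> {..<n}"
    hence "c ^ n = c ^ (n - i) * c ^ i" by (simp flip: power_add)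
    thus "of_int (c ^ n) * (of_int (b i) * \<alpha> ^ i) = of_int ((b i * c ^ (n - i)) * c ^ i) * \<alpha> ^ i"
      by simp
  qed
  finally have "of_int (c ^ n * k) * x \<in> ?S"
    unfolding adj_scaled[OF c] by (rule exI[of _ "\<lambda>i. b i * c ^ (n - i)"])
  thus "\<exists>m::int. m \<noteq> 0 \<and> of_int m * x \<in> ?S" using c k(1) by (intro exI[of _ "c ^ n * k"]) simp
qed

end

section \<open>Exterior powers of modules\<close>

lemma free_module_simps:
  "f \<in> carrier (free_module R S) \<longleftrightarrow>
     (\<forall>x. f x \<in> carrier R) \<and> finite {x. f x \<noteq> \<zero>\<^bsub>R\<^esub>} \<and> {x. f x \<noteq> \<zero>\<^bsub>R\<^esub>} \<subseteq> S"
  "zero (free_module R S) = (\<lambda>x. \<zero>\<^bsub>R\<^esub>)"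
  "add (free_module R S) = (\<lambda>f g x. f x \<oplus>\<^bsub>R\<^esub> g x)"
  "r \<odot>\<^bsub>free_module R S\<^esub> f = (\<lambda>x. r \<otimes>\<^bsub>R\<^esub> f x)"
  by (auto simp: free_module_def)

lemma module_free_module:
  assumes "cring R"
  shows "module R (free_module R S)"
proof -
  interpret R: cring R by fact
  let ?F = "free_module R S"
  have closed: "r \<odot>\<^bsub>?F\<^esub> f \<in> carrier ?F" if "r \<in> carrier R" "f \<in> carrier ?F" for r f
  proof -
    have "{x. r \<otimes>\<^bsub>R\<^esub> f x \<noteq> \<zero>\<^bsub>R\<^esub>} \<subseteq> {x. f x \<noteq> \<zero>\<^bsub>R\<^esub>}" using that by auto
    thus ?thesis using that unfolding free_module_simps by (auto dest: finite_subset)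
  qed
  have "abelian_group ?F"
  proof (rule abelian_groupI)
    fix f g assume f: "f \<in> carrier ?F" and g: "g \<in> carrier ?F"
    have "{x. f x \<oplus>\<^bsub>R\<^esub> g x \<noteq> \<zero>\<^bsub>R\<^esub>} \<subseteq> {x. f x \<noteq> \<zero>\<^bsub>R\<^esub>} \<union> {x. g x \<noteq> \<zero>\<^bsub>R\<^esub>}"
      using f g by (auto simp: free_module_simps)
    moreover have "finite ({x. f x \<noteq> \<zero>\<^bsub>R\<^esub>} \<union> {x. g x \<noteq> \<zero>\<^bsub>R\<^esub>})"
      using f g by (simp add: free_module_simps)
    ultimately have "finite {x. f x \<oplus>\<^bsub>R\<^esub> g x \<noteq> \<zero>\<^bsub>R\<^esub>}" "{x. f x \<oplus>\<^bsub>R\<^esub> g x \<noteq> \<zero>\<^bsub>R\<^esub>} \<subseteq> S"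
      using finite_subset f g unfolding free_module_simps by blast+
    thus "f \<oplus>\<^bsub>?F\<^esub> g \<in> carrier ?F" using f g by (simp add: free_module_simps)
    show "f \<oplus>\<^bsub>?F\<^esub> g = g \<oplus>\<^bsub>?F\<^esub> f" using f g by (auto simp: free_module_simps R.a_comm)
    show "\<zero>\<^bsub>?F\<^esub> \<oplus>\<^bsub>?F\<^esub> f = f" using f by (auto simp: free_module_simps)
    show "\<exists>g\<in>carrier ?F. g \<oplus>\<^bsub>?F\<^esub> f = \<zero>\<^bsub>?F\<^esub>"
    proof
      show "(\<ominus>\<^bsub>R\<^esub> \<one>\<^bsub>R\<^esub>) \<odot>\<^bsub>?F\<^esub> f \<in> carrier ?F" using f by (intro closed) auto
      show "(\<ominus>\<^bsub>R\<^esub> \<one>\<^bsub>R\<^esub>) \<odot>\<^bsub>?F\<^esub> f \<oplus>\<^bsub>?F\<^esub> f = \<zero>\<^bsub>?F\<^esub>"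
        using f by (auto simp: free_module_simps R.l_minus R.l_neg)
    qed
  next
    fix f g h assume "f \<in> carrier ?F" "g \<in> carrier ?F" "h \<in> carrier ?F"
    thus "f \<oplus>\<^bsub>?F\<^esub> g \<oplus>\<^bsub>?F\<^esub> h = f \<oplus>\<^bsub>?F\<^esub> (g \<oplus>\<^bsub>?F\<^esub> h)"
      by (auto simp: free_module_simps R.a_assoc)
  qed (simp add: free_module_simps)
  thus ?thesis using closed
    by (intro moduleI assms)
       (auto simp: free_module_simps R.l_distr R.r_distr R.m_assoc)
qed

lemma basis_vec_closed:
  assumes "cring R" "a \<in> S"
  shows "basis_vec R a \<in> carrier (free_module R S)"
proof -
  interpret R: cring R by fact
  have "{x. basis_vec R a x \<noteq> \<zero>\<^bsub>R\<^esub>} \<subseteq> {a}" by (auto simp: basis_vec_def)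
  thus ?thesis using assms(2) unfolding free_module_simps
    by (auto simp: basis_vec_def dest: finite_subset)
qed

text \<open>Induction on the size of the support.\<close>

lemma free_module_induct:
  assumes "cring R" and H: "submodule H R (free_module R S)"
    and basis: "\<And>a. a \<in> S \<Longrightarrow> basis_vec R a \<in> H"
    and f: "f \<in> carrier (free_module R S)"
  shows "f \<in> H"
proof -
  interpret R: cring R by fact
  interpret F: module R "free_module R S" by (rule module_free_module) fact
  note HE = F.submoduleE[OF H]
  have "finite {x. f x \<noteq> \<zero>\<^bsub>R\<^esub>}" using f by (simp add: free_module_simps)
  thus ?thesis using f
  proof (induction "{x. f x \<noteq> \<zero>\<^bsub>R\<^esub>}" arbitrary: f rule: finite_psubset_induct)
    case psubset
    show ?case
    proof (cases "{x. f x \<noteq> \<zero>\<^bsub>R\<^esub>} = {}")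
      case True
      hence "f = \<zero>\<^bsub>free_module R S\<^esub>" by (auto simp: free_module_simps)
      thus ?thesis
        using submodule.axioms(1)[OF H] subgroup.one_closed[of H "add_monoid (free_module R S)"] by simp
    next
      case False
      then obtain a where a: "f a \<noteq> \<zero>\<^bsub>R\<^esub>" by auto
      define g where "g = f(a := \<zero>\<^bsub>R\<^esub>)"
      have sub: "{x. g x \<noteq> \<zero>\<^bsub>R\<^esub>} \<subset> {x. f x \<noteq> \<zero>\<^bsub>R\<^esub>}" using a by (auto simp: g_def)
      have "g \<in> carrier (free_module R S)"
        using psubset.prems finite_subset[OF psubset_imp_subset[OF sub]] sub
        unfolding free_module_simps by (auto simp: g_def)
      hence "g \<in> H" using psubset.hyps(2)[OF sub] by blast
      moreover have aS: "a \<in> S" "f a \<in> carrier R" using psubset.prems a by (auto simp: free_module_simps)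
      hence "f a \<odot>\<^bsub>free_module R S\<^esub> basis_vec R a \<in> H" using basis HE by blast
      moreover have "f = g \<oplus>\<^bsub>free_module R S\<^esub> (f a \<odot>\<^bsub>free_module R S\<^esub> basis_vec R a)"
        using psubset.prems by (auto simp: free_module_simps g_def basis_vec_def fun_eq_iff)
      ultimately show ?thesis using HE by metis
    qed
  qed
qed

lemma generated_submodule:
  assumes "module R M" "G \<subseteq> carrier M"
  shows "submodule (generated_submodule R M G) R M" "G \<subseteq> generated_submodule R M G"
proof -
  interpret module R M by fact
  show "G \<subseteq> generated_submodule R M G" by (auto simp: generated_submodule_def)
  have car: "carrier M \<in> {N. submodule N R M \<and> G \<subseteq> N}" using carrier_is_submodule assms(2) by simp
  show "submodule (generated_submodule R M G) R M"
  proof (rule submoduleI)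
    show "generated_submodule R M G \<subseteq> carrier M" using car by (auto simp: generated_submodule_def)
    show "\<zero>\<^bsub>M\<^esub> \<in> generated_submodule R M G"
      unfolding generated_submodule_def
      using submodule.axioms(1) subgroup.one_closed[of _ "add_monoid M"] by fastforce
    show "\<ominus>\<^bsub>M\<^esub> a \<in> generated_submodule R M G" if "a \<in> generated_submodule R M G" for a
      using that submoduleE(3) unfolding generated_submodule_def by blast
    show "a \<oplus>\<^bsub>M\<^esub> b \<in> generated_submodule R M G"
      if "a \<in> generated_submodule R M G" "b \<in> generated_submodule R M G" for a b
      using that submoduleE(5) unfolding generated_submodule_def by blast
    show "a \<odot>\<^bsub>M\<^esub> x \<in> generated_submodule R M G"
      if "a \<in> carrier R" "x \<in> generated_submodule R M G" for a x
      using that submoduleE(4) unfolding generated_submodule_def by blast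
  qed
qed

lemma generated_submodule_least:
  "submodule N R M \<Longrightarrow> G \<subseteq> N \<Longrightarrow> generated_submodule R M G \<subseteq> N"
  by (auto simp: generated_submodule_def)

context module
begin

lemma submodule_abelian_subgroup: "submodule N R M \<Longrightarrow> abelian_subgroup N M"
  by (intro abelian_subgroupI3 additive_subgroup.intro submodule.axioms(1)) (simp_all add: M.abelian_group_axioms)

lemma quotient_module_simps:
  assumes "submodule N R M"
  shows "carrier (quotient_module M N) = (\<lambda>x. N +>\<^bsub>M\<^esub> x) ` carrier M"
    and "\<zero>\<^bsub>quotient_module M N\<^esub> = N +>\<^bsub>M\<^esub> \<zero>\<^bsub>M\<^esub>"
    and "x \<in> carrier M \<Longrightarrow> y \<in> carrier M \<Longrightarrow>
      (N +>\<^bsub>M\<^esub> x) \<oplus>\<^bsub>quotient_module M N\<^esub> (N +>\<^bsub>M\<^esub> y) = N +>\<^bsub>M\<^esub> (x \<oplus>\<^bsub>M\<^esub> y)"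
    and "x \<in> carrier M \<Longrightarrow> y \<in> carrier M \<Longrightarrow>
      N +>\<^bsub>M\<^esub> x = N +>\<^bsub>M\<^esub> y \<longleftrightarrow> x \<ominus>\<^bsub>M\<^esub> y \<in> N"
    and "x \<in> carrier M \<Longrightarrow> r \<in> carrier R \<Longrightarrow>
      r \<odot>\<^bsub>quotient_module M N\<^esub> (N +>\<^bsub>M\<^esub> x) = N +>\<^bsub>M\<^esub> (r \<odot>\<^bsub>M\<^esub> x)"
proof -
  interpret N: abelian_subgroup N M by (rule submodule_abelian_subgroup[OF assms])
  note NE = submoduleE[OF assms]
  show "carrier (quotient_module M N) = (\<lambda>x. N +>\<^bsub>M\<^esub> x) ` carrier M"
    by (auto simp: quotient_module_def A_RCOSETS_def')
  show "\<zero>\<^bsub>quotient_module M N\<^esub> = N +>\<^bsub>M\<^esub> \<zero>\<^bsub>M\<^esub>"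
    using NE(1) by (simp add: quotient_module_def)
  show "(N +>\<^bsub>M\<^esub> x) \<oplus>\<^bsub>quotient_module M N\<^esub> (N +>\<^bsub>M\<^esub> y) = N +>\<^bsub>M\<^esub> (x \<oplus>\<^bsub>M\<^esub> y)"
    if "x \<in> carrier M" "y \<in> carrier M"
    using that N.a_rcos_sum by (simp add: quotient_module_def)
  show eq: "N +>\<^bsub>M\<^esub> x = N +>\<^bsub>M\<^esub> y \<longleftrightarrow> x \<ominus>\<^bsub>M\<^esub> y \<in> N" if "x \<in> carrier M" "y \<in> carrier M" for x y
  proof
    assume "N +>\<^bsub>M\<^esub> x = N +>\<^bsub>M\<^esub> y"
    hence "x \<in> N +>\<^bsub>M\<^esub> y" using N.a_rcos_self[OF that(1)] by simp
    thus "x \<ominus>\<^bsub>M\<^esub> y \<in> N" using N.a_rcos_module[OF that(2,1)] by (simp add: a_minus_def)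
  next
    assume "x \<ominus>\<^bsub>M\<^esub> y \<in> N"
    hence "x \<in> N +>\<^bsub>M\<^esub> y" using N.a_rcos_module[OF that(2,1)] by (simp add: a_minus_def)
    from N.a_repr_independence'[OF this that(2)] show "N +>\<^bsub>M\<^esub> x = N +>\<^bsub>M\<^esub> y" by simp
  qed
  show "r \<odot>\<^bsub>quotient_module M N\<^esub> (N +>\<^bsub>M\<^esub> x) = N +>\<^bsub>M\<^esub> (r \<odot>\<^bsub>M\<^esub> x)"
    if x: "x \<in> carrier M" and r: "r \<in> carrier R"
  proof -
    have "N +>\<^bsub>M\<^esub> (r \<odot>\<^bsub>M\<^esub> y) = N +>\<^bsub>M\<^esub> (r \<odot>\<^bsub>M\<^esub> x)" if y: "y \<in> N +>\<^bsub>M\<^esub> x" for y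
    proof -
      have yM: "y \<in> carrier M" using y x N.a_elemrcos_carrier by blast
      have "y \<ominus>\<^bsub>M\<^esub> x \<in> N" using y x yM by (simp add: N.a_rcos_module a_minus_def)
      hence "r \<odot>\<^bsub>M\<^esub> (y \<ominus>\<^bsub>M\<^esub> x) \<in> N" using NE(4) r by blast
      also have "r \<odot>\<^bsub>M\<^esub> (y \<ominus>\<^bsub>M\<^esub> x) = r \<odot>\<^bsub>M\<^esub> y \<ominus>\<^bsub>M\<^esub> r \<odot>\<^bsub>M\<^esub> x"
        using r x yM by (simp add: a_minus_def smult_r_distr smult_r_minus)
      finally show ?thesis using eq r x yM by simp
    qed
    note const = this
    have self: "x \<in> N +>\<^bsub>M\<^esub> x" using x N.a_rcos_self by blast
    have "(\<Union>y\<in>N +>\<^bsub>M\<^esub> x. N +>\<^bsub>M\<^esub> (r \<odot>\<^bsub>M\<^esub> y)) = N +>\<^bsub>M\<^esub> (r \<odot>\<^bsub>M\<^esub> x)"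
    proof (intro equalityI subsetI)
      fix z assume "z \<in> (\<Union>y\<in>N +>\<^bsub>M\<^esub> x. N +>\<^bsub>M\<^esub> (r \<odot>\<^bsub>M\<^esub> y))"
      then obtain y where "y \<in> N +>\<^bsub>M\<^esub> x" "z \<in> N +>\<^bsub>M\<^esub> (r \<odot>\<^bsub>M\<^esub> y)" by (rule UN_E)
      thus "z \<in> N +>\<^bsub>M\<^esub> (r \<odot>\<^bsub>M\<^esub> x)" using const by simp
    next
      fix z assume "z \<in> N +>\<^bsub>M\<^esub> (r \<odot>\<^bsub>M\<^esub> x)"
      thus "z \<in> (\<Union>y\<in>N +>\<^bsub>M\<^esub> x. N +>\<^bsub>M\<^esub> (r \<odot>\<^bsub>M\<^esub> y))" by (rule UN_I[OF self])
    qed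
    thus ?thesis by (simp add: quotient_module_def)
  qed
qed

lemma module_quotient_module:
  assumes "submodule N R M"
  shows "module R (quotient_module M N)"
proof -
  note q = quotient_module_simps[OF assms]
  have "abelian_group (quotient_module M N)"
  proof (rule abelian_groupI)
    show "\<exists>y\<in>carrier (quotient_module M N). y \<oplus>\<^bsub>quotient_module M N\<^esub> x = \<zero>\<^bsub>quotient_module M N\<^esub>"
      if x: "x \<in> carrier (quotient_module M N)" for x
    proof -
      obtain a where a: "a \<in> carrier M" "x = N +>\<^bsub>M\<^esub> a" using x unfolding q(1) by blast
      have "N +>\<^bsub>M\<^esub> (\<ominus>\<^bsub>M\<^esub> a) \<in> carrier (quotient_module M N)" using a unfolding q(1) by blast
      moreover have "(N +>\<^bsub>M\<^esub> (\<ominus>\<^bsub>M\<^esub> a)) \<oplus>\<^bsub>quotient_module M N\<^esub> x = \<zero>\<^bsub>quotient_module M N\<^esub>"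
        using a by (simp add: q(2,3) M.l_neg)
      ultimately show ?thesis by blast
    qed
  qed (auto simp: q(1,2,3) M.a_ac)
  thus ?thesis
    by (intro moduleI R.is_cring)
       (auto simp: q(1,3,5) smult_l_distr smult_r_distr smult_assoc1)
qed

end

section \<open>Alternating maps and the universal property\<close>

text \<open>The scalars of \<open>M\<close> act on the values through \<open>h\<close>, so that the definition also covers the maps
  between exterior powers over different rings that base change induces.\<close>

definition multilinear_alternating ::
  "('r, 'x) ring_scheme \<Rightarrow> nat \<Rightarrow> ('r, 'm, 'y) module_scheme \<Rightarrow> ('r \<Rightarrow> 's) \<Rightarrow> ('s, 'k, 'w) module_scheme \<Rightarrow> ('m list \<Rightarrow> 'k) \<Rightarrow> bool" where
  "multilinear_alternating R n M h A w \<longleftrightarrow>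
     (\<forall>xs\<in>tuples n M. w xs \<in> carrier A) \<and>
     (\<forall>xs\<in>tuples n M. \<forall>i<n. \<forall>u\<in>carrier M. \<forall>v\<in>carrier M.
        w (xs[i := u \<oplus>\<^bsub>M\<^esub> v]) = w (xs[i := u]) \<oplus>\<^bsub>A\<^esub> w (xs[i := v])) \<and>
     (\<forall>xs\<in>tuples n M. \<forall>i<n. \<forall>r\<in>carrier R. \<forall>u\<in>carrier M.
        w (xs[i := r \<odot>\<^bsub>M\<^esub> u]) = h r \<odot>\<^bsub>A\<^esub> w (xs[i := u])) \<and>
     (\<forall>xs\<in>tuples n M. \<forall>i j. i < j \<longrightarrow> j < n \<longrightarrow> xs ! i = xs ! j \<longrightarrow> w xs = \<zero>\<^bsub>A\<^esub>)"

lemma tuples_update: "xs \<in> tuples n M \<Longrightarrow> u \<in> carrier M \<Longrightarrow> xs[i := u] \<in> tuples n M"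
  unfolding tuples_def using set_update_subset_insert[of xs i u] by auto

lemma wedge_relations_closed:
  assumes "module R M"
  shows "wedge_relations R n M \<subseteq> carrier (free_module R (tuples n M))"
proof -
  interpret M: module R M by fact
  interpret F: module R "free_module R (tuples n M)" by (rule module_free_module) (rule M.R.is_cring)
  note b = basis_vec_closed[OF M.R.is_cring]
  show ?thesis unfolding wedge_relations_def Let_def
    by (auto intro!: F.M.minus_closed F.M.a_closed F.smult_closed b tuples_update)
qed

lemma module_exterior_power:
  assumes "module R M"
  shows "module R (exterior_power R n M)"
proof -
  interpret M: module R M by fact
  interpret F: module R "free_module R (tuples n M)" by (rule module_free_module) (rule M.R.is_cring)
  show ?thesis unfolding exterior_power_def wedge_kernel_def
    by (intro F.module_quotient_module generated_submodule F.module_axioms wedge_relations_closed assms)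
qed

lemma multilinear_alternating_wedge:
  assumes "module R M"
  shows "multilinear_alternating R n M (\<lambda>r. r) (exterior_power R n M) (wedge R M)"
proof -
  interpret M: module R M by fact
  let ?F = "free_module R (tuples n M)"
  let ?N = "wedge_kernel R n M"
  interpret F: module R ?F by (rule module_free_module) (rule M.R.is_cring)
  have N: "submodule ?N R ?F" and rel: "wedge_relations R n M \<subseteq> ?N"
    unfolding wedge_kernel_def
    by (intro generated_submodule F.module_axioms wedge_relations_closed assms)+
  note q = F.quotient_module_simps[OF N, folded exterior_power_def]
  note b = basis_vec_closed[OF M.R.is_cring]
  have w: "wedge R M xs = ?N +>\<^bsub>?F\<^esub> basis_vec R xs" if "xs \<in> tuples n M" for xs
    using that by (simp add: wedge_def tuples_def)
  show ?thesis unfolding multilinear_alternating_def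
  proof (intro conjI ballI allI impI)
    fix xs assume xs: "xs \<in> tuples n M"
    show "wedge R M xs \<in> carrier (exterior_power R n M)" unfolding w[OF xs] q(1) by (intro imageI b xs)
    fix i j assume ij: "i < j" "j < n" "xs ! i = xs ! j"
    have "basis_vec R xs \<in> ?N"
      by (rule subsetD[OF rel], unfold wedge_relations_def Let_def, rule UnI2) (use xs ij in blast)
    hence "?N +>\<^bsub>?F\<^esub> basis_vec R xs = ?N +>\<^bsub>?F\<^esub> \<zero>\<^bsub>?F\<^esub>"
    proof -
      have z: "\<ominus>\<^bsub>?F\<^esub> \<zero>\<^bsub>?F\<^esub> = \<zero>\<^bsub>?F\<^esub>" by (rule F.M.minus_equality) simp_all
      show ?thesis
        unfolding q(4)[OF b[OF xs] F.M.zero_closed] a_minus_def z F.M.r_zero[OF b[OF xs]] by fact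
    qed
    thus "wedge R M xs = \<zero>\<^bsub>exterior_power R n M\<^esub>" by (simp add: w[OF xs] q(2))
  next
    fix xs i u v assume A: "xs \<in> tuples n M" "i < n" "u \<in> carrier M" "v \<in> carrier M"
    have "basis_vec R (xs[i := u \<oplus>\<^bsub>M\<^esub> v]) \<ominus>\<^bsub>?F\<^esub> (basis_vec R (xs[i := u]) \<oplus>\<^bsub>?F\<^esub> basis_vec R (xs[i := v])) \<in> ?N"

      by (rule subsetD[OF rel], unfold wedge_relations_def Let_def, intro UnI1 CollectI exI conjI, rule refl) (use A in auto)
    thus "wedge R M (xs[i := u \<oplus>\<^bsub>M\<^esub> v]) = wedge R M (xs[i := u]) \<oplus>\<^bsub>exterior_power R n M\<^esub> wedge R M (xs[i := v])"
      using A by (simp add: w q(3,4) b tuples_update)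
  next
    fix xs i r u assume A: "xs \<in> tuples n M" "i < n" "r \<in> carrier R" "u \<in> carrier M"
    have "basis_vec R (xs[i := r \<odot>\<^bsub>M\<^esub> u]) \<ominus>\<^bsub>?F\<^esub> (r \<odot>\<^bsub>?F\<^esub> basis_vec R (xs[i := u])) \<in> ?N"
      by (rule subsetD[OF rel], unfold wedge_relations_def Let_def, rule UnI1, rule UnI2, intro CollectI exI conjI, rule refl) (use A in auto)
    thus "wedge R M (xs[i := r \<odot>\<^bsub>M\<^esub> u]) = r \<odot>\<^bsub>exterior_power R n M\<^esub> wedge R M (xs[i := u])"
      using A by (simp add: w q(4,5) b tuples_update)
  qed
qed

lemma exterior_power_induct:
  assumes M: "module R M" and H: "submodule H R (exterior_power R n M)"
    and wedge: "\<And>xs. xs \<in> tuples n M \<Longrightarrow> wedge R M xs \<in> H"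
  shows "carrier (exterior_power R n M) \<subseteq> H"
proof -
  interpret M: module R M by fact
  let ?F = "free_module R (tuples n M)"
  let ?N = "wedge_kernel R n M"
  interpret F: module R ?F by (rule module_free_module) (rule M.R.is_cring)
  interpret W: module R "exterior_power R n M" by (rule module_exterior_power) fact
  have N: "submodule ?N R ?F"
    unfolding wedge_kernel_def
    by (intro generated_submodule F.module_axioms wedge_relations_closed assms)
  note q = F.quotient_module_simps[OF N, folded exterior_power_def]
  note HE = W.submoduleE[OF H]
  have H0: "\<zero>\<^bsub>exterior_power R n M\<^esub> \<in> H"
    using submodule.axioms(1)[OF H] subgroup.one_closed[of H "add_monoid (exterior_power R n M)"] by simp
  define H' where "H' = {f \<in> carrier ?F. ?N +>\<^bsub>?F\<^esub> f \<in> H}"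
  have neg: "\<ominus>\<^bsub>exterior_power R n M\<^esub> (?N +>\<^bsub>?F\<^esub> f) = ?N +>\<^bsub>?F\<^esub> (\<ominus>\<^bsub>?F\<^esub> f)" if "f \<in> carrier ?F" for f
  proof (rule W.M.minus_equality)
    show "(?N +>\<^bsub>?F\<^esub> (\<ominus>\<^bsub>?F\<^esub> f)) \<oplus>\<^bsub>exterior_power R n M\<^esub> (?N +>\<^bsub>?F\<^esub> f) = \<zero>\<^bsub>exterior_power R n M\<^esub>"
      using that by (simp add: q(2,3) F.M.l_neg)
  qed (use that q(1) in auto)
  have "submodule H' R ?F"
  proof (rule F.submoduleI)
    show "\<zero>\<^bsub>?F\<^esub> \<in> H'" using H0 by (simp add: H'_def q(2))
    show "\<ominus>\<^bsub>?F\<^esub> f \<in> H'" if "f \<in> H'" for f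
      using that HE(3)[of "?N +>\<^bsub>?F\<^esub> f"] neg[of f] by (auto simp: H'_def)
    show "f \<oplus>\<^bsub>?F\<^esub> g \<in> H'" if "f \<in> H'" "g \<in> H'" for f g
      using that HE(5)[of "?N +>\<^bsub>?F\<^esub> f" "?N +>\<^bsub>?F\<^esub> g"] q(3)[of f g] by (auto simp: H'_def)
    show "r \<odot>\<^bsub>?F\<^esub> f \<in> H'" if "r \<in> carrier R" "f \<in> H'" for r f
      using that HE(4)[of r "?N +>\<^bsub>?F\<^esub> f"] q(5)[of f r] by (auto simp: H'_def)
  qed (auto simp: H'_def)
  moreover have "basis_vec R xs \<in> H'" if "xs \<in> tuples n M" for xs
    using that wedge[OF that] basis_vec_closed[OF M.R.is_cring that]
    by (auto simp: H'_def wedge_def tuples_def)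
  ultimately have "f \<in> H'" if "f \<in> carrier ?F" for f
    using free_module_induct[OF M.R.is_cring] that by blast
  thus ?thesis by (auto simp: q(1) H'_def)
qed

text \<open>The map from the free module that \<open>w\<close> determines on the basis. The support of \<open>f\<close> is the domain of
  the sum, as in the definition of the induced map of exterior powers.\<close>

definition linear_extension ::
  "('r, 'x) ring_scheme \<Rightarrow> ('s, 'k, 'w) module_scheme \<Rightarrow> ('r \<Rightarrow> 's) \<Rightarrow> ('a \<Rightarrow> 'k) \<Rightarrow> ('a \<Rightarrow> 'r) \<Rightarrow> 'k" where
  "linear_extension R A h w f = (\<Oplus>\<^bsub>A\<^esub> x\<in>{x. f x \<noteq> \<zero>\<^bsub>R\<^esub>}. h (f x) \<odot>\<^bsub>A\<^esub> w x)"

text \<open>Sums over two different supports are compared over their union.\<close>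

lemma linear_extension_props:
  assumes R: "cring R" and A: "module R' A" and h: "h \<in> Ring.ring_hom R R'" and R': "cring R'"
    and w: "\<And>x. x \<in> S \<Longrightarrow> w x \<in> carrier A"
  shows "f \<in> carrier (free_module R S) \<Longrightarrow> linear_extension R A h w f \<in> carrier A"
    and "f \<in> carrier (free_module R S) \<Longrightarrow> g \<in> carrier (free_module R S) \<Longrightarrow>
       linear_extension R A h w (f \<oplus>\<^bsub>free_module R S\<^esub> g) =
       linear_extension R A h w f \<oplus>\<^bsub>A\<^esub> linear_extension R A h w g"
    and "f \<in> carrier (free_module R S) \<Longrightarrow> r \<in> carrier R \<Longrightarrow>
       linear_extension R A h w (r \<odot>\<^bsub>free_module R S\<^esub> f) = h r \<odot>\<^bsub>A\<^esub> linear_extension R A h w f"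
    and "a \<in> S \<Longrightarrow> linear_extension R A h w (basis_vec R a) = w a"
proof -
  interpret R: cring R by fact
  interpret R': cring R' by fact
  interpret A: module R' A by fact
  interpret hom: ring_hom_cring R R' h by (intro ring_hom_cring.intro ring_hom_cring_axioms.intro) fact+
  have terms: "(\<lambda>x. h (f x) \<odot>\<^bsub>A\<^esub> w x) \<in> T \<rightarrow> carrier A" if "f \<in> carrier (free_module R S)" "T \<subseteq> S" for f T
    using that w by (auto simp: free_module_simps intro!: A.smult_closed hom.hom_closed)
  have ext: "linear_extension R A h w f = (\<Oplus>\<^bsub>A\<^esub> x\<in>T. h (f x) \<odot>\<^bsub>A\<^esub> w x)"
    if "f \<in> carrier (free_module R S)" "finite T" "{x. f x \<noteq> \<zero>\<^bsub>R\<^esub>} \<subseteq> T" "T \<subseteq> S" for f T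
    unfolding linear_extension_def
  proof (rule A.M.add.finprod_mono_neutral_cong_left[OF that(2,3)])
    show "h (f x) \<odot>\<^bsub>A\<^esub> w x = \<zero>\<^bsub>A\<^esub>" if "x \<in> T - {x. f x \<noteq> \<zero>\<^bsub>R\<^esub>}" for x
      using that \<open>T \<subseteq> S\<close> w by auto
  qed (use terms[OF that(1,4)] in auto)
  show closed: "linear_extension R A h w f \<in> carrier A" if f: "f \<in> carrier (free_module R S)" for f
    unfolding linear_extension_def
    by (intro A.M.finsum_closed terms f) (use f in \<open>simp add: free_module_simps\<close>)
  interpret F: module R "free_module R S" by (rule module_free_module) fact
  show "linear_extension R A h w (f \<oplus>\<^bsub>free_module R S\<^esub> g) =
       linear_extension R A h w f \<oplus>\<^bsub>A\<^esub> linear_extension R A h w g"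
    if f: "f \<in> carrier (free_module R S)" and g: "g \<in> carrier (free_module R S)"
  proof -
    define T where "T = {x. f x \<noteq> \<zero>\<^bsub>R\<^esub>} \<union> {x. g x \<noteq> \<zero>\<^bsub>R\<^esub>}"
    have T: "finite T" "T \<subseteq> S" "{x. f x \<noteq> \<zero>\<^bsub>R\<^esub>} \<subseteq> T" "{x. g x \<noteq> \<zero>\<^bsub>R\<^esub>} \<subseteq> T"
      using f g by (auto simp: T_def free_module_simps)
    have fg: "f \<oplus>\<^bsub>free_module R S\<^esub> g \<in> carrier (free_module R S)" using f g by simp
    have "{x. (f \<oplus>\<^bsub>free_module R S\<^esub> g) x \<noteq> \<zero>\<^bsub>R\<^esub>} \<subseteq> T"
      using f g by (auto simp: T_def free_module_simps)
    hence "linear_extension R A h w (f \<oplus>\<^bsub>free_module R S\<^esub> g) =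
        (\<Oplus>\<^bsub>A\<^esub> x\<in>T. h ((f \<oplus>\<^bsub>free_module R S\<^esub> g) x) \<odot>\<^bsub>A\<^esub> w x)"
      by (intro ext[OF fg] T)
    also have "\<dots> = (\<Oplus>\<^bsub>A\<^esub> x\<in>T. h (f x) \<odot>\<^bsub>A\<^esub> w x \<oplus>\<^bsub>A\<^esub> h (g x) \<odot>\<^bsub>A\<^esub> w x)"
    proof (rule A.M.finsum_cong')
      fix x assume x: "x \<in> T"
      have "f x \<in> carrier R" "g x \<in> carrier R" using f g by (auto simp: free_module_simps)
      thus "h ((f \<oplus>\<^bsub>free_module R S\<^esub> g) x) \<odot>\<^bsub>A\<^esub> w x = h (f x) \<odot>\<^bsub>A\<^esub> w x \<oplus>\<^bsub>A\<^esub> h (g x) \<odot>\<^bsub>A\<^esub> w x"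
        using w[of x] x T(2) by (simp add: free_module_simps A.smult_l_distr subset_iff)
    qed (use terms[OF f T(2)] terms[OF g T(2)] in \<open>auto simp: Pi_iff\<close>)
    also have "\<dots> = (\<Oplus>\<^bsub>A\<^esub> x\<in>T. h (f x) \<odot>\<^bsub>A\<^esub> w x) \<oplus>\<^bsub>A\<^esub> (\<Oplus>\<^bsub>A\<^esub> x\<in>T. h (g x) \<odot>\<^bsub>A\<^esub> w x)"
      by (intro A.M.finsum_addf terms f g T)
    finally show ?thesis using ext[OF f T(1,3,2)] ext[OF g T(1,4,2)] by simp
  qed
  show "linear_extension R A h w (r \<odot>\<^bsub>free_module R S\<^esub> f) = h r \<odot>\<^bsub>A\<^esub> linear_extension R A h w f"
    if f: "f \<in> carrier (free_module R S)" and r: "r \<in> carrier R"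
  proof -
    define T where "T = {x. f x \<noteq> \<zero>\<^bsub>R\<^esub>}"
    have T: "finite T" "T \<subseteq> S" using f by (auto simp: T_def free_module_simps)
    have rf: "r \<odot>\<^bsub>free_module R S\<^esub> f \<in> carrier (free_module R S)" using f r by simp
    have "{x. (r \<odot>\<^bsub>free_module R S\<^esub> f) x \<noteq> \<zero>\<^bsub>R\<^esub>} \<subseteq> T" using r by (auto simp: T_def free_module_simps)
    hence "linear_extension R A h w (r \<odot>\<^bsub>free_module R S\<^esub> f) =
        (\<Oplus>\<^bsub>A\<^esub> x\<in>T. h ((r \<odot>\<^bsub>free_module R S\<^esub> f) x) \<odot>\<^bsub>A\<^esub> w x)"
      by (intro ext[OF rf] T)
    also have "\<dots> = (\<Oplus>\<^bsub>A\<^esub> x\<in>T. h r \<odot>\<^bsub>A\<^esub> (h (f x) \<odot>\<^bsub>A\<^esub> w x))"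
    proof (rule A.M.finsum_cong')
      fix x assume x: "x \<in> T"
      have "f x \<in> carrier R" using f by (auto simp: free_module_simps)
      thus "h ((r \<odot>\<^bsub>free_module R S\<^esub> f) x) \<odot>\<^bsub>A\<^esub> w x = h r \<odot>\<^bsub>A\<^esub> (h (f x) \<odot>\<^bsub>A\<^esub> w x)"
        using w[of x] x r T(2) by (simp add: free_module_simps A.smult_assoc1 subset_iff)
    qed (use terms[OF f T(2)] r in \<open>auto simp: Pi_iff\<close>)
    also have "\<dots> = h r \<odot>\<^bsub>A\<^esub> (\<Oplus>\<^bsub>A\<^esub> x\<in>T. h (f x) \<odot>\<^bsub>A\<^esub> w x)"
      using T(1) terms[OF f T(2)]
    proof (induction T)
      case (insert x T)
      have "(\<Oplus>\<^bsub>A\<^esub> y\<in>T. h (f y) \<odot>\<^bsub>A\<^esub> w y) \<in> carrier A" using insert.prems by (intro A.M.finsum_closed) auto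
      moreover have "(\<Oplus>\<^bsub>A\<^esub> y\<in>insert x T. h r \<odot>\<^bsub>A\<^esub> (h (f y) \<odot>\<^bsub>A\<^esub> w y)) =
          h r \<odot>\<^bsub>A\<^esub> (h (f x) \<odot>\<^bsub>A\<^esub> w x) \<oplus>\<^bsub>A\<^esub> (\<Oplus>\<^bsub>A\<^esub> y\<in>T. h r \<odot>\<^bsub>A\<^esub> (h (f y) \<odot>\<^bsub>A\<^esub> w y))"
        using insert.hyps insert.prems r by (intro A.M.finsum_insert) auto
      moreover have "(\<Oplus>\<^bsub>A\<^esub> y\<in>insert x T. h (f y) \<odot>\<^bsub>A\<^esub> w y) =
          h (f x) \<odot>\<^bsub>A\<^esub> w x \<oplus>\<^bsub>A\<^esub> (\<Oplus>\<^bsub>A\<^esub> y\<in>T. h (f y) \<odot>\<^bsub>A\<^esub> w y)"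
        using insert.hyps insert.prems by (intro A.M.finsum_insert) auto
      moreover have "(\<Oplus>\<^bsub>A\<^esub> y\<in>T. h r \<odot>\<^bsub>A\<^esub> (h (f y) \<odot>\<^bsub>A\<^esub> w y)) = h r \<odot>\<^bsub>A\<^esub> (\<Oplus>\<^bsub>A\<^esub> y\<in>T. h (f y) \<odot>\<^bsub>A\<^esub> w y)"
        using insert by auto
      ultimately show ?case using r insert.prems by (simp add: A.smult_r_distr)
    qed (use r in simp)
    finally show ?thesis by (simp add: linear_extension_def T_def)
  qed
  show "linear_extension R A h w (basis_vec R a) = w a" if a: "a \<in> S"
  proof -
    have "linear_extension R A h w (basis_vec R a) = (\<Oplus>\<^bsub>A\<^esub> x\<in>{a}. h (basis_vec R a x) \<odot>\<^bsub>A\<^esub> w x)"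
      by (rule ext[OF basis_vec_closed[OF R a]]) (use a in \<open>auto simp: basis_vec_def\<close>)
    also have "\<dots> = h (basis_vec R a a) \<odot>\<^bsub>A\<^esub> w a"
      using w[OF a] by (subst A.M.finsum_insert) (auto simp: basis_vec_def)
    finally show ?thesis using w[OF a] by (simp add: basis_vec_def)
  qed
qed

text \<open>The universal property of the exterior power: the elements that the extension annihilates form a
  submodule, and it contains the defining relations.\<close>

theorem linear_extension_wedge_kernel:
  assumes M: "module R M" and A: "module R' A" and h: "h \<in> Ring.ring_hom R R'"
    and w: "multilinear_alternating R n M h A w" and f: "f \<in> wedge_kernel R n M"
  shows "linear_extension R A h w f = \<zero>\<^bsub>A\<^esub>"
proof -
  interpret M: module R M by fact
  interpret A: module R' A by fact
  let ?F = "free_module R (tuples n M)"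
  interpret F: module R ?F by (rule module_free_module) (rule M.R.is_cring)
  have wc: "w xs \<in> carrier A" if "xs \<in> tuples n M" for xs
    using w that by (simp add: multilinear_alternating_def)
  note L = linear_extension_props[OF M.R.is_cring A h A.R.is_cring, where S = "tuples n M" and w = w, OF wc]
  note b = basis_vec_closed[OF M.R.is_cring]
  define G where "G = linear_extension R A h w"
  note L = L[folded G_def]
  define H where "H = {f \<in> carrier ?F. G f = \<zero>\<^bsub>A\<^esub>}"
  have hc: "h r \<in> carrier R'" if "r \<in> carrier R" for r using h that by (rule ring_hom_closed)
  have G0: "G \<zero>\<^bsub>?F\<^esub> = \<zero>\<^bsub>A\<^esub>"
  proof -
    have "G \<zero>\<^bsub>?F\<^esub> \<oplus>\<^bsub>A\<^esub> G \<zero>\<^bsub>?F\<^esub> = G \<zero>\<^bsub>?F\<^esub>"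
      using L(2)[where f = "\<zero>\<^bsub>?F\<^esub>" and g = "\<zero>\<^bsub>?F\<^esub>"] by simp
    thus ?thesis using L(1)[where f = "\<zero>\<^bsub>?F\<^esub>"] A.M.add.l_cancel_one by simp
  qed
  have neg: "G (\<ominus>\<^bsub>?F\<^esub> f) = \<ominus>\<^bsub>A\<^esub> G f" if "f \<in> carrier ?F" for f
  proof (rule A.M.minus_equality[symmetric])
    show "G (\<ominus>\<^bsub>?F\<^esub> f) \<oplus>\<^bsub>A\<^esub> G f = \<zero>\<^bsub>A\<^esub>"
      using L(2)[where f = "\<ominus>\<^bsub>?F\<^esub> f" and g = f] that G0 by (simp add: F.M.l_neg)
  qed (use that L(1) in auto)
  have "submodule H R ?F"
    by (rule F.submoduleI) (auto simp: H_def G0 neg L(2,3) hc)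
  moreover have "wedge_relations R n M \<subseteq> H"
  proof -
    have diff: "f \<ominus>\<^bsub>?F\<^esub> g \<in> H" if "f \<in> carrier ?F" "g \<in> carrier ?F" "G f = G g" for f g
      using that by (simp add: H_def a_minus_def L(2) neg L(1) A.M.r_neg)
    have r1: "basis_vec R (xs[i := u \<oplus>\<^bsub>M\<^esub> v]) \<ominus>\<^bsub>?F\<^esub> (basis_vec R (xs[i := u]) \<oplus>\<^bsub>?F\<^esub> basis_vec R (xs[i := v])) \<in> H"
      if "xs \<in> tuples n M" "i < n" "u \<in> carrier M" "v \<in> carrier M" for xs i u v
    proof (rule diff)
      show "G (basis_vec R (xs[i := u \<oplus>\<^bsub>M\<^esub> v])) = G (basis_vec R (xs[i := u]) \<oplus>\<^bsub>?F\<^esub> basis_vec R (xs[i := v]))"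
        using w that unfolding multilinear_alternating_def
        by (simp add: L(2,4) b tuples_update)
    qed (use that in \<open>auto intro!: b tuples_update F.M.a_closed M.M.a_closed\<close>)
    have r2: "basis_vec R (xs[i := r \<odot>\<^bsub>M\<^esub> u]) \<ominus>\<^bsub>?F\<^esub> (r \<odot>\<^bsub>?F\<^esub> basis_vec R (xs[i := u])) \<in> H"
      if "xs \<in> tuples n M" "i < n" "r \<in> carrier R" "u \<in> carrier M" for xs i r u
    proof (rule diff)
      show "G (basis_vec R (xs[i := r \<odot>\<^bsub>M\<^esub> u])) = G (r \<odot>\<^bsub>?F\<^esub> basis_vec R (xs[i := u]))"
        using w that unfolding multilinear_alternating_def
        by (simp add: L(3,4) b tuples_update)
    qed (use that in \<open>auto intro!: b tuples_update F.smult_closed\<close>)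
    have r3: "basis_vec R xs \<in> H" if "xs \<in> tuples n M" "i < j" "j < n" "xs ! i = xs ! j" for xs i j
      using w that b[of xs "tuples n M"] unfolding multilinear_alternating_def H_def
      by (auto simp: L(4))
    show ?thesis unfolding wedge_relations_def Let_def using r1 r2 r3 by auto
  qed
  ultimately have "wedge_kernel R n M \<subseteq> H"
    unfolding wedge_kernel_def by (rule generated_submodule_least)
  thus ?thesis using f by (auto simp: H_def G_def)
qed

lemma multilinear_alternating_swap:
  assumes M: "module R M" and A: "module R' A" and w: "multilinear_alternating R n M h A w"
    and xs: "xs \<in> tuples n M" and ij: "i < n" "j < n" "i \<noteq> j"
  shows "w (xs[i := xs ! j, j := xs ! i]) = \<ominus>\<^bsub>A\<^esub> w xs"
proof -
  interpret M: module R M by fact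
  interpret A: module R' A by fact
  have len: "length xs = n" using xs by (simp add: tuples_def)
  define B where "B a b = w (xs[i := a, j := b])" for a b
  have car: "B a b \<in> carrier A" if "a \<in> carrier M" "b \<in> carrier M" for a b
    using w that xs unfolding B_def multilinear_alternating_def by (blast intro: tuples_update)
  have same: "B a a = \<zero>\<^bsub>A\<^esub>" if a: "a \<in> carrier M" for a
  proof -
    have t: "xs[i := a, j := a] \<in> tuples n M" by (intro tuples_update xs a)
    have e: "xs[i := a, j := a] ! i = a" "xs[i := a, j := a] ! j = a" using ij len by auto
    show ?thesis
    proof (cases "i < j")
      case True
      thus ?thesis using w t e ij unfolding B_def multilinear_alternating_def by auto
    next
      case False
      hence "j < i" using ij by simp
      thus ?thesis using w t e ij unfolding B_def multilinear_alternating_def by auto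
    qed
  qed
  have add2: "B a (b \<oplus>\<^bsub>M\<^esub> c) = B a b \<oplus>\<^bsub>A\<^esub> B a c"
    if "a \<in> carrier M" "b \<in> carrier M" "c \<in> carrier M" for a b c
    using w tuples_update[OF xs that(1), of i] that ij unfolding B_def multilinear_alternating_def by blast
  have add1: "B (a \<oplus>\<^bsub>M\<^esub> b) c = B a c \<oplus>\<^bsub>A\<^esub> B b c"
    if "a \<in> carrier M" "b \<in> carrier M" "c \<in> carrier M" for a b c
  proof -
    have "w (xs[j := c, i := a \<oplus>\<^bsub>M\<^esub> b]) = w (xs[j := c, i := a]) \<oplus>\<^bsub>A\<^esub> w (xs[j := c, i := b])"
      using w tuples_update[OF xs that(3), of j] that ij unfolding multilinear_alternating_def by blast
    thus ?thesis using ij by (simp add: B_def list_update_swap)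
  qed
  define u v where "u = xs ! i" and "v = xs ! j"
  have uv: "u \<in> carrier M" "v \<in> carrier M"
    using xs ij by (auto simp: u_def v_def tuples_def dest: nth_mem)
  \<comment> \<open>Expand the vanishing value at two equal entries \<open>u + v\<close>.\<close>
  have "\<zero>\<^bsub>A\<^esub> = B (u \<oplus>\<^bsub>M\<^esub> v) (u \<oplus>\<^bsub>M\<^esub> v)" using same[of "u \<oplus>\<^bsub>M\<^esub> v"] uv by simp
  also have "\<dots> = B u (u \<oplus>\<^bsub>M\<^esub> v) \<oplus>\<^bsub>A\<^esub> B v (u \<oplus>\<^bsub>M\<^esub> v)" using uv by (intro add1) auto
  also have "\<dots> = B u v \<oplus>\<^bsub>A\<^esub> B v u" using uv by (simp add: add2 same car)
  finally have "B v u \<oplus>\<^bsub>A\<^esub> B u v = \<zero>\<^bsub>A\<^esub>" using uv car by (simp add: A.M.a_comm)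
  hence "B v u = \<ominus>\<^bsub>A\<^esub> B u v" using uv car by (intro A.M.minus_equality[symmetric]) auto
  moreover have "B u v = w xs" by (simp add: B_def u_def v_def)
  ultimately show ?thesis by (simp add: B_def u_def v_def)
qed

text \<open>Generation is expressed through submodules, which is the form in which multilinearity uses it: the
  entries that a fixed slot may take without leaving the cyclic submodule form a submodule.\<close>

theorem exterior_power_top_cyclic:
  assumes M: "module R M" and b: "\<And>j. j < n \<Longrightarrow> b j \<in> carrier M"
    and gen: "\<And>H. submodule H R M \<Longrightarrow> (\<And>j. j < n \<Longrightarrow> b j \<in> H) \<Longrightarrow> carrier M \<subseteq> H"
  shows "carrier (exterior_power R n M) =
    {r \<odot>\<^bsub>exterior_power R n M\<^esub> wedge R M (map b [0..<n]) |r. r \<in> carrier R}"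
proof -
  interpret M: module R M by fact
  let ?W = "exterior_power R n M"
  interpret W: module R ?W by (rule module_exterior_power) fact
  note w = multilinear_alternating_wedge[OF M, of n]
  define \<omega> where "\<omega> = wedge R M (map b [0..<n])"
  define S where "S = {r \<odot>\<^bsub>?W\<^esub> \<omega> |r. r \<in> carrier R}"
  have wc: "wedge R M xs \<in> carrier ?W" if "xs \<in> tuples n M" for xs
    using w that by (simp add: multilinear_alternating_def)
  have bt: "map b ys \<in> tuples n M" if "length ys = n" "set ys \<subseteq> {..<n}" for ys
    using that b by (auto simp: tuples_def)
  have \<omega>: "\<omega> \<in> carrier ?W" unfolding \<omega>_def by (intro wc bt) auto
  have subS: "submodule S R ?W"
  proof (rule W.submoduleI)
    show "\<zero>\<^bsub>?W\<^esub> \<in> S" unfolding S_def using W.smult_l_null[OF \<omega>, symmetric] M.R.zero_closed by blast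
    show "\<ominus>\<^bsub>?W\<^esub> a \<in> S" if "a \<in> S" for a
    proof -
      obtain r where r: "r \<in> carrier R" "a = r \<odot>\<^bsub>?W\<^esub> \<omega>" using \<open>a \<in> S\<close> by (auto simp: S_def)
      hence "\<ominus>\<^bsub>?W\<^esub> a = (\<ominus>\<^bsub>R\<^esub> r) \<odot>\<^bsub>?W\<^esub> \<omega>" using \<omega> by (simp add: W.smult_l_minus)
      thus ?thesis using r unfolding S_def by blast
    qed
    show "a \<oplus>\<^bsub>?W\<^esub> c \<in> S" if "a \<in> S" "c \<in> S" for a c
    proof -
      obtain r s where r: "r \<in> carrier R" "a = r \<odot>\<^bsub>?W\<^esub> \<omega>" and s: "s \<in> carrier R" "c = s \<odot>\<^bsub>?W\<^esub> \<omega>"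
        using \<open>a \<in> S\<close> \<open>c \<in> S\<close> by (auto simp: S_def)
      hence "a \<oplus>\<^bsub>?W\<^esub> c = (r \<oplus>\<^bsub>R\<^esub> s) \<odot>\<^bsub>?W\<^esub> \<omega>" using \<omega> by (simp add: W.smult_l_distr)
      thus ?thesis using r s unfolding S_def by blast
    qed
    show "a \<odot>\<^bsub>?W\<^esub> x \<in> S" if "a \<in> carrier R" "x \<in> S" for a x
    proof -
      obtain r where r: "r \<in> carrier R" "x = r \<odot>\<^bsub>?W\<^esub> \<omega>" using \<open>x \<in> S\<close> by (auto simp: S_def)
      hence "a \<odot>\<^bsub>?W\<^esub> x = (a \<otimes>\<^bsub>R\<^esub> r) \<odot>\<^bsub>?W\<^esub> \<omega>" using \<omega> that by (simp add: W.smult_assoc1)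
      thus ?thesis using r that unfolding S_def by blast
    qed
  qed (use \<omega> in \<open>auto simp: S_def\<close>)
  note SE = W.submoduleE[OF subS]
  have S0: "\<zero>\<^bsub>?W\<^esub> \<in> S"
    using submodule.axioms(1)[OF subS] subgroup.one_closed[of S "add_monoid ?W"] by simp
  \<comment> \<open>Descending induction on the number \<open>n - k\<close> of initial entries that are already in place: either
     a swap puts the next one in place, or its index is missing and some entry is repeated.\<close>
  have perm: "wedge R M (map b ys) \<in> S"
    if "length ys = n" "set ys \<subseteq> {..<n}" "\<And>i. i < n - k \<Longrightarrow> ys ! i = i" for ys k
    using that
  proof (induction k arbitrary: ys)
    case 0
    have "ys = [0..<n]" using 0 by (intro nth_equalityI) auto
    hence "wedge R M (map b ys) = \<one>\<^bsub>R\<^esub> \<odot>\<^bsub>?W\<^esub> \<omega>" using \<omega> by (simp add: \<omega>_def)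
    thus ?case unfolding S_def using M.R.one_closed by blast
  next
    case (Suc k)
    show ?case
    proof (cases "k < n")
      case False
      thus ?thesis using Suc by auto
    next
      case True
      define m where "m = n - Suc k"
      have m: "m < n" "n - k = Suc m" using True by (auto simp: m_def)
      consider "ys ! m = m" | j where "m < j" "j < n" "ys ! j = m" | "ys ! m \<noteq> m" "\<And>j. m < j \<Longrightarrow> j < n \<Longrightarrow> ys ! j \<noteq> m"
        by blast
      thus ?thesis
      proof cases
        case 1
        show ?thesis by (rule Suc.IH) (use Suc.prems 1 m in \<open>auto simp: less_Suc_eq m_def\<close>)
      next
        case (2 j)
        define zs where "zs = ys[m := ys ! j, j := ys ! m]"
        have len: "length zs = n" using Suc.prems by (simp add: zs_def)
        have "ys ! j \<in> set ys" "ys ! m \<in> set ys" using 2 m Suc.prems by auto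
        hence set: "set zs \<subseteq> {..<n}"
          using Suc.prems(2) set_update_subset_insert[of ys m "ys ! j"]
            set_update_subset_insert[of "ys[m := ys ! j]" j "ys ! m"] unfolding zs_def by blast
        have "wedge R M (map b zs) \<in> S"
        proof (rule Suc.IH[OF len set])
          fix i assume "i < n - k"
          hence "i < m \<or> i = m" using m by auto
          thus "zs ! i = i" using 2 m Suc.prems by (auto simp: zs_def m_def)
        qed
        hence "\<ominus>\<^bsub>?W\<^esub> wedge R M (map b zs) \<in> S" by (rule SE(3))
        moreover have "map b zs = (map b ys)[m := map b ys ! j, j := map b ys ! m]"
          using 2 m Suc.prems by (simp add: zs_def map_update)
        hence "wedge R M (map b zs) = \<ominus>\<^bsub>?W\<^esub> wedge R M (map b ys)"
          using multilinear_alternating_swap[OF M W.module_axioms w bt[OF Suc.prems(1,2)] m(1) 2(2)] 2(1) by simp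
        ultimately show ?thesis using wc[OF bt[OF Suc.prems(1,2)]] by simp
      next
        case 3
        have "m \<notin> set ys"
        proof
          assume "m \<in> set ys"
          then obtain i where i: "i < n" "ys ! i = m" using Suc.prems(1) by (auto simp: in_set_conv_nth)
          show False
            using i 3 Suc.prems(3)[of i] by (cases i m rule: linorder_cases) (auto simp: m_def)
        qed
        hence "set ys \<subseteq> {..<n} - {m}" using Suc.prems(2) by blast
        hence "card (set ys) \<le> card ({..<n} - {m})" by (intro card_mono) auto
        also have "\<dots> < n" using m by simp
        finally have "\<not> distinct ys" using Suc.prems(1) distinct_card by fastforce
        then obtain i j where "i < n" "j < n" "i \<noteq> j" "ys ! i = ys ! j"
          using Suc.prems(1) by (auto simp: distinct_conv_nth)
        then obtain i j where ij: "i < j" "j < n" "ys ! i = ys ! j" by (metis linorder_neqE_nat)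
        hence "map b ys ! i = map b ys ! j" using Suc.prems(1) by simp
        hence "wedge R M (map b ys) = \<zero>\<^bsub>?W\<^esub>"
          using w bt[OF Suc.prems(1,2)] ij unfolding multilinear_alternating_def by blast
        thus ?thesis using S0 by simp
      qed
    qed
  qed
  \<comment> \<open>Multilinearity replaces the arbitrary entries, those of index below \<open>k\<close>, one after the other.\<close>
  have gen_wedge: "wedge R M xs \<in> S"
    if "xs \<in> tuples n M" "k \<le> n" "\<And>i. k \<le> i \<Longrightarrow> i < n \<Longrightarrow> \<exists>j<n. xs ! i = b j" for xs k
    using that
  proof (induction k arbitrary: xs)
    case 0
    then obtain y where y: "\<And>i. i < n \<Longrightarrow> y i < n \<and> xs ! i = b (y i)" by (metis le0)
    have "xs = map b (map y [0..<n])"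
      using 0 y by (intro nth_equalityI) (auto simp: tuples_def)
    moreover have "wedge R M (map b (map y [0..<n])) \<in> S"
      by (rule perm[where k = n]) (use y in auto)
    ultimately show ?case by simp
  next
    case (Suc k)
    have k: "k < n" using Suc.prems by simp
    have len: "length xs = n" using Suc.prems by (simp add: tuples_def)
    define H where "H = {u \<in> carrier M. wedge R M (xs[k := u]) \<in> S}"
    have sm: "r \<odot>\<^bsub>M\<^esub> u \<in> H" if "r \<in> carrier R" "u \<in> H" for r u
    proof -
      have "wedge R M (xs[k := r \<odot>\<^bsub>M\<^esub> u]) = r \<odot>\<^bsub>?W\<^esub> wedge R M (xs[k := u])"
        using w Suc.prems(1) k that unfolding multilinear_alternating_def H_def by blast
      thus ?thesis using that SE(4) by (auto simp: H_def)
    qed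
    have bH: "b j \<in> H" if "j < n" for j
    proof -
      have "wedge R M (xs[k := b j]) \<in> S"
      proof (rule Suc.IH)
        show "xs[k := b j] \<in> tuples n M" by (intro tuples_update Suc.prems b that)
        fix i assume "k \<le> i" "i < n"
        thus "\<exists>j'<n. xs[k := b j] ! i = b j'" using Suc.prems(3)[of i] that len by (cases "i = k") auto
      qed (use k in simp)
      thus ?thesis using b that by (simp add: H_def)
    qed
    have neg: "\<ominus>\<^bsub>M\<^esub> u = (\<ominus>\<^bsub>R\<^esub> \<one>\<^bsub>R\<^esub>) \<odot>\<^bsub>M\<^esub> u" if "u \<in> carrier M" for u
      using that by (simp add: M.smult_l_minus)
    have "submodule H R M"
    proof (rule M.submoduleI)
      show "\<zero>\<^bsub>M\<^esub> \<in> H" using sm[OF M.R.zero_closed bH[OF k]] b[OF k] by simp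
      show "\<ominus>\<^bsub>M\<^esub> u \<in> H" if "u \<in> H" for u using that sm[of "\<ominus>\<^bsub>R\<^esub> \<one>\<^bsub>R\<^esub>" u] neg[of u] by (auto simp: H_def)
      show "u \<oplus>\<^bsub>M\<^esub> v \<in> H" if "u \<in> H" "v \<in> H" for u v
      proof -
        have "wedge R M (xs[k := u \<oplus>\<^bsub>M\<^esub> v]) = wedge R M (xs[k := u]) \<oplus>\<^bsub>?W\<^esub> wedge R M (xs[k := v])"
          using w Suc.prems(1) k that unfolding multilinear_alternating_def H_def by blast
        thus ?thesis using that SE(5) by (auto simp: H_def)
      qed
      show "H \<subseteq> carrier M" by (auto simp: H_def)
    qed (use sm in auto)
    hence "carrier M \<subseteq> H" using bH by (rule gen)
    moreover have "xs ! k \<in> carrier M" using Suc.prems(1) k by (auto simp: tuples_def dest: nth_mem)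
    ultimately show ?case by (auto simp: H_def)
  qed
  have "carrier ?W \<subseteq> S"
    by (rule exterior_power_induct[OF M subS]) (rule gen_wedge[where k = n], auto)
  thus ?thesis using SE(1) unfolding S_def \<omega>_def by blast
qed

text \<open>The representatives of a wedge differ by elements of the kernel, on which the extension of the
  composite alternating map vanishes; so the image set in the definition is a singleton.\<close>

theorem exterior_map_wedge:
  assumes M: "module R M" and M': "module R' M'" and h: "h \<in> Ring.ring_hom R R'"
    and g: "\<And>u. u \<in> carrier M \<Longrightarrow> g u \<in> carrier M'"
    and g_add: "\<And>u v. u \<in> carrier M \<Longrightarrow> v \<in> carrier M \<Longrightarrow> g (u \<oplus>\<^bsub>M\<^esub> v) = g u \<oplus>\<^bsub>M'\<^esub> g v"
    and g_smult: "\<And>r u. r \<in> carrier R \<Longrightarrow> u \<in> carrier M \<Longrightarrow> g (r \<odot>\<^bsub>M\<^esub> u) = h r \<odot>\<^bsub>M'\<^esub> g u"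
    and xs: "xs \<in> tuples n M"
  shows "exterior_map R R' n M' h g (wedge R M xs) = wedge R' M' (map g xs)"
proof -
  interpret M: module R M by fact
  interpret M': module R' M' by fact
  let ?W' = "exterior_power R' n M'"
  interpret W': module R' ?W' by (rule module_exterior_power) fact
  let ?F = "free_module R (tuples n M)"
  interpret F: module R ?F by (rule module_free_module) (rule M.R.is_cring)
  define w where "w ys = wedge R' M' (map g ys)" for ys
  have hc: "h r \<in> carrier R'" if "r \<in> carrier R" for r using h that by (rule ring_hom_closed)
  have gt: "map g ys \<in> tuples n M'" if "ys \<in> tuples n M" for ys
    using that g by (auto simp: tuples_def)
  note ma = multilinear_alternating_wedge[OF M', of n]
  have w: "multilinear_alternating R n M h ?W' w"
    unfolding multilinear_alternating_def
  proof (intro conjI ballI allI impI)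
    fix ys assume ys: "ys \<in> tuples n M"
    show "w ys \<in> carrier ?W'" using ma gt[OF ys] by (simp add: w_def multilinear_alternating_def)
    fix i j assume ij: "i < j" "j < n" "ys ! i = ys ! j"
    have "map g ys ! i = map g ys ! j" using ij ys by (simp add: tuples_def)
    thus "w ys = \<zero>\<^bsub>?W'\<^esub>"
      using ma[unfolded multilinear_alternating_def, THEN conjunct2, THEN conjunct2, THEN conjunct2,
        rule_format, OF gt[OF ys] ij(1,2)] by (simp add: w_def)
  next
    fix ys i u v assume "ys \<in> tuples n M" "i < n" "u \<in> carrier M" "v \<in> carrier M"
    thus "w (ys[i := u \<oplus>\<^bsub>M\<^esub> v]) = w (ys[i := u]) \<oplus>\<^bsub>?W'\<^esub> w (ys[i := v])"
      using ma gt[of ys] g by (simp add: w_def map_update g_add multilinear_alternating_def)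
  next
    fix ys i r u assume "ys \<in> tuples n M" "i < n" "r \<in> carrier R" "u \<in> carrier M"
    thus "w (ys[i := r \<odot>\<^bsub>M\<^esub> u]) = h r \<odot>\<^bsub>?W'\<^esub> w (ys[i := u])"
      using ma gt[of ys] g hc by (simp add: w_def map_update g_smult multilinear_alternating_def)
  qed
  have wc: "w ys \<in> carrier ?W'" if "ys \<in> tuples n M" for ys
    using w that by (simp add: multilinear_alternating_def)
  note L = linear_extension_props[OF M.R.is_cring W'.module_axioms h M'.R.is_cring, where S = "tuples n M" and w = w, OF wc]
  define e where "e = basis_vec R xs"
  have e: "e \<in> carrier ?F" unfolding e_def by (intro basis_vec_closed M.R.is_cring xs)
  have N: "submodule (wedge_kernel R n M) R ?F"
    unfolding wedge_kernel_def by (intro generated_submodule F.module_axioms wedge_relations_closed M)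
  note NE = F.submoduleE[OF N]
  have N0: "\<zero>\<^bsub>?F\<^esub> \<in> wedge_kernel R n M"
    using submodule.axioms(1)[OF N] subgroup.one_closed[of _ "add_monoid ?F"] by fastforce
  have rep: "wedge R M xs = (\<lambda>k. k \<oplus>\<^bsub>?F\<^esub> e) ` wedge_kernel R n M"
    using xs by (auto simp: wedge_def tuples_def e_def a_r_coset_def')
  have const: "linear_extension R ?W' h w (k \<oplus>\<^bsub>?F\<^esub> e) = w xs" if k: "k \<in> wedge_kernel R n M" for k
  proof -
    have "k \<in> carrier ?F" using k NE(1) by blast
    hence "linear_extension R ?W' h w (k \<oplus>\<^bsub>?F\<^esub> e) = \<zero>\<^bsub>?W'\<^esub> \<oplus>\<^bsub>?W'\<^esub> w xs"
      using L(2)[OF _ _ e] L(4)[OF _ xs] linear_extension_wedge_kernel[OF M W'.module_axioms h w k]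
      by (simp add: e_def)
    thus ?thesis using wc[OF xs] by simp
  qed
  have "linear_extension R ?W' h w ` wedge R M xs = {w xs}"
    using const N0 unfolding rep image_image by force
  thus ?thesis unfolding exterior_map_def linear_extension_def w_def by simp
qed

text \<open>An alternating form transports a proportionality of wedges to its values. When the value on the
  reference wedge is a unit, the factor is determined.\<close>

theorem wedge_multiple_unique:
  assumes M: "module R M" and A: "module R A" and D: "multilinear_alternating R n M (\<lambda>r. r) A D"
    and xs: "xs \<in> tuples n M" and ys: "ys \<in> tuples n M" and r: "r \<in> carrier R"
    and eq: "wedge R M xs = r \<odot>\<^bsub>exterior_power R n M\<^esub> wedge R M ys"
  shows "D xs = r \<odot>\<^bsub>A\<^esub> D ys"
proof -
  interpret M: module R M by fact
  interpret A: module R A by fact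
  let ?F = "free_module R (tuples n M)"
  let ?N = "wedge_kernel R n M"
  interpret F: module R ?F by (rule module_free_module) (rule M.R.is_cring)
  have N: "submodule ?N R ?F"
    unfolding wedge_kernel_def by (intro generated_submodule F.module_axioms wedge_relations_closed M)
  note q = F.quotient_module_simps[OF N, folded exterior_power_def]
  note b = basis_vec_closed[OF M.R.is_cring]
  have Dc: "D zs \<in> carrier A" if "zs \<in> tuples n M" for zs
    using D that by (simp add: multilinear_alternating_def)
  have id: "(\<lambda>r. r) \<in> Ring.ring_hom R R" by (auto simp: Ring.ring_hom_def)
  note L = linear_extension_props[OF M.R.is_cring A id M.R.is_cring, where S = "tuples n M" and w = D, OF Dc]
  have w: "wedge R M zs = ?N +>\<^bsub>?F\<^esub> basis_vec R zs" if "zs \<in> tuples n M" for zs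
    using that by (simp add: wedge_def tuples_def)
  define k where "k = basis_vec R xs \<ominus>\<^bsub>?F\<^esub> r \<odot>\<^bsub>?F\<^esub> basis_vec R ys"
  have "k \<in> ?N"
    using eq xs ys r unfolding k_def by (simp add: w q(4,5) b)
  hence 0: "linear_extension R A (\<lambda>r. r) D k = \<zero>\<^bsub>A\<^esub>" by (rule linear_extension_wedge_kernel[OF M A id D])
  have kc: "k \<in> carrier ?F" unfolding k_def by (intro F.M.minus_closed F.smult_closed b xs ys r)
  have rc: "r \<odot>\<^bsub>?F\<^esub> basis_vec R ys \<in> carrier ?F" by (intro F.smult_closed b ys r)
  have "basis_vec R xs = k \<oplus>\<^bsub>?F\<^esub> r \<odot>\<^bsub>?F\<^esub> basis_vec R ys"
    unfolding k_def using b[OF xs] rc by (simp add: a_minus_def F.M.a_assoc F.M.l_neg)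
  hence "linear_extension R A (\<lambda>r. r) D (basis_vec R xs) = r \<odot>\<^bsub>A\<^esub> D ys"
    using L(2)[OF _ kc rc] L(3)[OF _ b[OF ys] r] L(4)[OF _ ys] 0 Dc[OF ys] r by simp
  thus ?thesis using L(4)[OF _ xs] by simp
qed

section \<open>The l-adic integers and base change\<close>

lemma padic_simps [simp]:
  "mult (padic_int_ring l) = (\<lambda>x y k. (x k * y k) mod int l ^ k)"
  "one (padic_int_ring l) = (\<lambda>k. 1 mod int l ^ k)"
  "zero (padic_int_ring l) = (\<lambda>k. 0)"
  "add (padic_int_ring l) = (\<lambda>x y k. (x k + y k) mod int l ^ k)"
  by (simp_all add: padic_int_ring_def)

lemma padic_carrier:
  "x \<in> carrier (padic_int_ring l) \<longleftrightarrow> (\<forall>k. 0 \<le> x k \<and> x k < int l ^ k \<and> x (Suc k) mod int l ^ k = x k)"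
  by (simp add: padic_int_ring_def)

lemma padic_mod:
  assumes "x \<in> carrier (padic_int_ring l)"
  shows "x k mod int l ^ k = x k"
  using assms by (simp add: padic_carrier)

text \<open>Every sequence of integers that is compatible up to congruence defines an \<open>l\<close>-adic integer.\<close>

lemma padic_carrier_modI:
  assumes "l > 0" "\<And>k. [f (Suc k) = f k] (mod int l ^ k)"
  shows "(\<lambda>k. f k mod int l ^ k) \<in> carrier (padic_int_ring l)"
proof -
  have "f (Suc k) mod int l ^ Suc k mod int l ^ k = f k mod int l ^ k" for k
  proof -
    have "f (Suc k) mod int l ^ Suc k mod int l ^ k = f (Suc k) mod int l ^ k"
      by (rule mod_mod_cancel) simp
    thus ?thesis using assms(2)[of k] by (simp add: cong_def)
  qed
  thus ?thesis using assms(1) by (simp add: padic_carrier)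
qed

lemma padic_cong_Suc:
  assumes "x \<in> carrier (padic_int_ring l)"
  shows "[x (Suc k) = x k] (mod int l ^ k)"
  using assms padic_mod[OF assms, of k] by (simp add: padic_carrier cong_def)

lemma cring_padic:
  assumes l: "l > 0"
  shows "cring (padic_int_ring l)"
proof -
  let ?Z = "padic_int_ring l"
  have add: "x \<oplus>\<^bsub>?Z\<^esub> y \<in> carrier ?Z" if "x \<in> carrier ?Z" "y \<in> carrier ?Z" for x y
    using that by (simp, intro padic_carrier_modI l cong_add padic_cong_Suc)
  have mult: "x \<otimes>\<^bsub>?Z\<^esub> y \<in> carrier ?Z" if "x \<in> carrier ?Z" "y \<in> carrier ?Z" for x y
    using that by (simp, intro padic_carrier_modI l cong_mult padic_cong_Suc)
  have one: "\<one>\<^bsub>?Z\<^esub> \<in> carrier ?Z" by (simp, intro padic_carrier_modI l cong_refl)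
  have zero: "\<zero>\<^bsub>?Z\<^esub> \<in> carrier ?Z" using l by (simp add: padic_carrier)
  show ?thesis
  proof (rule cringI)
    show "abelian_group ?Z"
    proof (rule abelian_groupI)
      fix x assume x: "x \<in> carrier ?Z"
      have "(\<lambda>k. (- x k) mod int l ^ k) \<in> carrier ?Z"
        by (intro padic_carrier_modI l) (use padic_cong_Suc[OF x] in \<open>simp add: cong_minus_minus_iff\<close>)
      moreover have "(\<lambda>k. (- x k) mod int l ^ k) \<oplus>\<^bsub>?Z\<^esub> x = \<zero>\<^bsub>?Z\<^esub>" by (simp add: mod_add_left_eq)
      ultimately show "\<exists>y\<in>carrier ?Z. y \<oplus>\<^bsub>?Z\<^esub> x = \<zero>\<^bsub>?Z\<^esub>" by blast
      show "\<zero>\<^bsub>?Z\<^esub> \<oplus>\<^bsub>?Z\<^esub> x = x" using padic_mod[OF x] by simp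
    next
      fix x y z
      show "x \<oplus>\<^bsub>?Z\<^esub> y \<oplus>\<^bsub>?Z\<^esub> z = x \<oplus>\<^bsub>?Z\<^esub> (y \<oplus>\<^bsub>?Z\<^esub> z)"
        by (simp add: mod_add_left_eq mod_add_right_eq add.assoc)
      show "x \<oplus>\<^bsub>?Z\<^esub> y = y \<oplus>\<^bsub>?Z\<^esub> x" by (simp add: add.commute)
    qed (use add zero in auto)
    show "comm_monoid ?Z"
    proof (rule comm_monoidI)
      fix x y z
      show "x \<otimes>\<^bsub>?Z\<^esub> y \<otimes>\<^bsub>?Z\<^esub> z = x \<otimes>\<^bsub>?Z\<^esub> (y \<otimes>\<^bsub>?Z\<^esub> z)"
        by (simp add: mod_mult_left_eq mod_mult_right_eq mult.assoc)
      show "x \<otimes>\<^bsub>?Z\<^esub> y = y \<otimes>\<^bsub>?Z\<^esub> x" by (simp add: mult.commute)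
    next
      fix x assume x: "x \<in> carrier ?Z"
      show "\<one>\<^bsub>?Z\<^esub> \<otimes>\<^bsub>?Z\<^esub> x = x" using padic_mod[OF x] by (simp add: mod_mult_left_eq)
    qed (use mult one in auto)
    fix x y z
    show "(x \<oplus>\<^bsub>?Z\<^esub> y) \<otimes>\<^bsub>?Z\<^esub> z = x \<otimes>\<^bsub>?Z\<^esub> z \<oplus>\<^bsub>?Z\<^esub> y \<otimes>\<^bsub>?Z\<^esub> z"
      by (simp add: mod_mult_left_eq mod_add_eq distrib_right)
  qed
qed

lemma padic_of_int_hom:
  assumes "l > 0"
  shows "padic_of_int l \<in> Ring.ring_hom \<Z> (padic_int_ring l)"
  by (rule ring_hom_memI)
     (auto simp: padic_of_int_def mod_mult_eq mod_add_eq intro!: padic_carrier_modI assms)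

text \<open>Extension of an integer weight to formal sums. Formal sums of copies of a single point serve as a
  model of the integers, so that additivity comes from that of the extension of maps.\<close>

definition frag_sum :: "('a \<Rightarrow> int) \<Rightarrow> ('a \<Rightarrow>\<^sub>0 int) \<Rightarrow> int" where
  "frag_sum w F = Poly_Mapping.lookup (frag_extend (\<lambda>x. frag_cmul (w x) (frag_of ())) F) ()"

lemma frag_sum_simps [simp]:
  "frag_sum w 0 = 0" "frag_sum w (frag_of x) = w x"
  "frag_sum w (F + G) = frag_sum w F + frag_sum w G"
  "frag_sum w (F - G) = frag_sum w F - frag_sum w G"
  "frag_sum w (- F) = - frag_sum w F"
  by (simp_all add: frag_sum_def frag_extend_add frag_extend_diff frag_extend_minus lookup_add lookup_minus)

lemma pair_monoid_ring_simps:
  "F \<in> carrier (pair_monoid_ring A B) \<longleftrightarrow> Poly_Mapping.keys F \<subseteq> carrier A \<times> carrier B"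
  "one (pair_monoid_ring A B) = frag_of (\<one>\<^bsub>A\<^esub>, \<one>\<^bsub>B\<^esub>)" "zero (pair_monoid_ring A B) = 0"
  "add (pair_monoid_ring A B) = (+)"
  by (simp_all add: pair_monoid_ring_def)

text \<open>Together with induction over formal sums, biadditivity and the value on generators determine the
  multiplication.\<close>

lemma pair_mult:
  fixes A :: "('a, 'x) ring_scheme" and B :: "('b, 'y) ring_scheme"
  defines "P \<equiv> pair_monoid_ring A B"
  shows "frag_of (a, b) \<otimes>\<^bsub>P\<^esub> frag_of (a', b') = frag_of (a \<otimes>\<^bsub>A\<^esub> a', b \<otimes>\<^bsub>B\<^esub> b')"
    and "(F - F') \<otimes>\<^bsub>P\<^esub> G = F \<otimes>\<^bsub>P\<^esub> G - F' \<otimes>\<^bsub>P\<^esub> G"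
    and "(F + F') \<otimes>\<^bsub>P\<^esub> G = F \<otimes>\<^bsub>P\<^esub> G + F' \<otimes>\<^bsub>P\<^esub> G"
    and "G \<otimes>\<^bsub>P\<^esub> (F - F') = G \<otimes>\<^bsub>P\<^esub> F - G \<otimes>\<^bsub>P\<^esub> F'"
    and "G \<otimes>\<^bsub>P\<^esub> (F + F') = G \<otimes>\<^bsub>P\<^esub> F + G \<otimes>\<^bsub>P\<^esub> F'"
    and "0 \<otimes>\<^bsub>P\<^esub> G = 0" and "G \<otimes>\<^bsub>P\<^esub> 0 = 0"
proof -
  have m: "F \<otimes>\<^bsub>P\<^esub> G = frag_extend (\<lambda>(a, b). frag_extend
                (\<lambda>(a', b'). frag_of (a \<otimes>\<^bsub>A\<^esub> a', b \<otimes>\<^bsub>B\<^esub> b')) G) F" for F G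
    by (simp add: P_def pair_monoid_ring_def)
  show "frag_of (a, b) \<otimes>\<^bsub>P\<^esub> frag_of (a', b') = frag_of (a \<otimes>\<^bsub>A\<^esub> a', b \<otimes>\<^bsub>B\<^esub> b')" by (simp add: m)
  show diff1: "(F - F') \<otimes>\<^bsub>P\<^esub> G = F \<otimes>\<^bsub>P\<^esub> G - F' \<otimes>\<^bsub>P\<^esub> G" for F F' G by (simp add: m frag_extend_diff)
  show "(F + F') \<otimes>\<^bsub>P\<^esub> G = F \<otimes>\<^bsub>P\<^esub> G + F' \<otimes>\<^bsub>P\<^esub> G" by (simp add: m frag_extend_add)
  show z1: "0 \<otimes>\<^bsub>P\<^esub> G = 0" for G by (simp add: m)
  show diff2: "G \<otimes>\<^bsub>P\<^esub> (F - F') = G \<otimes>\<^bsub>P\<^esub> F - G \<otimes>\<^bsub>P\<^esub> F'" for F F'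
  proof -
    have "Poly_Mapping.keys G \<subseteq> UNIV" by simp
    thus ?thesis
    proof (induction G rule: frag_induction)
      case (one x)
      show ?case by (cases x) (simp add: m frag_extend_diff)
    qed (simp_all add: z1 diff1)
  qed
  show z2: "G \<otimes>\<^bsub>P\<^esub> 0 = 0" using diff2[of 0 0] by simp
  show "G \<otimes>\<^bsub>P\<^esub> (F + F') = G \<otimes>\<^bsub>P\<^esub> F + G \<otimes>\<^bsub>P\<^esub> F'"
    using diff2[of F "0 - F'"] diff2[of 0 F'] z2 by simp
qed

lemma pair_carrier_induct [consumes 1, case_names zero one diff]:
  assumes "F \<in> carrier (pair_monoid_ring A B)" "P 0"
    "\<And>a b. a \<in> carrier A \<Longrightarrow> b \<in> carrier B \<Longrightarrow> P (frag_of (a, b))"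
    "\<And>F G. P F \<Longrightarrow> P G \<Longrightarrow> P (F - G)"
  shows "P F"
proof -
  have "Poly_Mapping.keys F \<subseteq> carrier A \<times> carrier B" using assms(1) by (simp add: pair_monoid_ring_simps)
  thus ?thesis by (induction F rule: frag_induction) (use assms in auto)
qed

lemma pair_carrier_intros:
  "0 \<in> carrier (pair_monoid_ring A B)"
  "a \<in> carrier A \<Longrightarrow> b \<in> carrier B \<Longrightarrow> frag_of (a, b) \<in> carrier (pair_monoid_ring A B)"
  "F \<in> carrier (pair_monoid_ring A B) \<Longrightarrow> G \<in> carrier (pair_monoid_ring A B) \<Longrightarrow> F + G \<in> carrier (pair_monoid_ring A B)"
  "F \<in> carrier (pair_monoid_ring A B) \<Longrightarrow> G \<in> carrier (pair_monoid_ring A B) \<Longrightarrow> F - G \<in> carrier (pair_monoid_ring A B)"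
  using keys_add[of F G] keys_diff[of F G] by (auto simp: pair_monoid_ring_simps keys_frag_of)

lemma cring_pair_monoid_ring:
  assumes "cring A" "cring B"
  shows "cring (pair_monoid_ring A B)"
proof -
  interpret A: cring A by fact
  interpret B: cring B by fact
  let ?P = "pair_monoid_ring A B"
  note pm = pair_mult[where A = A and B = B]
  note pc = pair_carrier_intros[where A = A and B = B]
  have closed: "F \<otimes>\<^bsub>?P\<^esub> G \<in> carrier ?P" if F: "F \<in> carrier ?P" and G: "G \<in> carrier ?P" for F G
    using F
  proof (induction F rule: pair_carrier_induct)
    case (one a b)
    show ?case using G
      by (induction G rule: pair_carrier_induct) (use one in \<open>auto simp: pm intro!: pc\<close>)
  qed (auto simp: pm intro!: pc)
  have comm: "F \<otimes>\<^bsub>?P\<^esub> G = G \<otimes>\<^bsub>?P\<^esub> F" if F: "F \<in> carrier ?P" and G: "G \<in> carrier ?P" for F G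
    using F
  proof (induction F rule: pair_carrier_induct)
    case (one a b)
    show ?case using G
      by (induction G rule: pair_carrier_induct) (use one in \<open>auto simp: pm A.m_comm B.m_comm\<close>)
  qed (auto simp: pm)
  have assoc: "F \<otimes>\<^bsub>?P\<^esub> G \<otimes>\<^bsub>?P\<^esub> H = F \<otimes>\<^bsub>?P\<^esub> (G \<otimes>\<^bsub>?P\<^esub> H)"
    if F: "F \<in> carrier ?P" and G: "G \<in> carrier ?P" and H: "H \<in> carrier ?P" for F G H
    using F
  proof (induction F rule: pair_carrier_induct)
    case (one a b)
    note ab = one
    show ?case using G
    proof (induction G rule: pair_carrier_induct)
      case (one a' b')
      show ?case using H
        by (induction H rule: pair_carrier_induct) (use one ab in \<open>auto simp: pm A.m_assoc B.m_assoc\<close>)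
    qed (auto simp: pm)
  qed (auto simp: pm)
  have one: "\<one>\<^bsub>?P\<^esub> \<otimes>\<^bsub>?P\<^esub> F = F" if F: "F \<in> carrier ?P" for F
    using F by (induction F rule: pair_carrier_induct) (auto simp: pm pair_monoid_ring_simps(2))
  show ?thesis
  proof (rule cringI)
    show "abelian_group ?P"
    proof (rule abelian_groupI)
      fix F assume F: "F \<in> carrier ?P"
      have "0 - F \<in> carrier ?P" by (intro pc F)
      thus "\<exists>G\<in>carrier ?P. G \<oplus>\<^bsub>?P\<^esub> F = \<zero>\<^bsub>?P\<^esub>"
        by (intro bexI[of _ "0 - F"]) (auto simp: pair_monoid_ring_simps)
    qed (auto simp: pair_monoid_ring_simps(2-4) intro: pc)
    show "comm_monoid ?P"
      by (rule comm_monoidI) (use closed comm assoc one in \<open>auto simp: pair_monoid_ring_simps(2) intro!: pc\<close>)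
  qed (auto simp: pair_monoid_ring_simps(4) pm)
qed

lemma tensor_relations_closed:
  assumes "cring A" "cring B"
  shows "tensor_relations A B \<subseteq> carrier (pair_monoid_ring A B)"
proof -
  interpret A: cring A by fact
  interpret B: cring B by fact
  show ?thesis unfolding tensor_relations_def by (auto intro!: pair_carrier_intros)
qed

lemma ideal_tensor_ideal:
  assumes "cring A" "cring B"
  shows "ideal (tensor_ideal A B) (pair_monoid_ring A B)"
proof -
  interpret P: cring "pair_monoid_ring A B" by (intro cring_pair_monoid_ring assms)
  show ?thesis unfolding tensor_ideal_def by (intro P.genideal_ideal tensor_relations_closed assms)
qed

lemma pair_minus:
  assumes "cring A" "cring B" "F \<in> carrier (pair_monoid_ring A B)" "G \<in> carrier (pair_monoid_ring A B)"
  shows "F \<ominus>\<^bsub>pair_monoid_ring A B\<^esub> G = F - G"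
proof -
  interpret P: cring "pair_monoid_ring A B" by (intro cring_pair_monoid_ring assms)
  have "0 - G \<in> carrier (pair_monoid_ring A B)" by (intro pair_carrier_intros(1,4) assms)
  from P.minus_equality[OF _ assms(4) this]
  have "\<ominus>\<^bsub>pair_monoid_ring A B\<^esub> G = 0 - G"
    by (simp add: pair_monoid_ring_simps(3,4))
  thus ?thesis by (simp add: a_minus_def pair_monoid_ring_simps(4))
qed

text \<open>All operations are computed on representatives in the monoid ring.\<close>

lemma base_change_simps:
  fixes A :: "('a, 'x) ring_scheme" and B :: "('b, 'y) ring_scheme"
  defines "P \<equiv> pair_monoid_ring A B" and "I \<equiv> tensor_ideal A B"
  assumes "cring A" "cring B"
  shows "carrier (base_change A B) = (\<lambda>F. I +>\<^bsub>P\<^esub> F) ` carrier P"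
    and "F \<in> carrier P \<Longrightarrow> G \<in> carrier P \<Longrightarrow>
      (I +>\<^bsub>P\<^esub> F) \<otimes>\<^bsub>base_change A B\<^esub> (I +>\<^bsub>P\<^esub> G) = I +>\<^bsub>P\<^esub> (F \<otimes>\<^bsub>P\<^esub> G)"
    and "F \<in> carrier P \<Longrightarrow> G \<in> carrier P \<Longrightarrow>
      (I +>\<^bsub>P\<^esub> F) \<oplus>\<^bsub>base_change A B\<^esub> (I +>\<^bsub>P\<^esub> G) = I +>\<^bsub>P\<^esub> (F + G)"
    and "\<one>\<^bsub>base_change A B\<^esub> = I +>\<^bsub>P\<^esub> frag_of (\<one>\<^bsub>A\<^esub>, \<one>\<^bsub>B\<^esub>)"
    and "\<zero>\<^bsub>base_change A B\<^esub> = I +>\<^bsub>P\<^esub> 0"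
    and "b \<in> carrier B \<Longrightarrow> F \<in> carrier P \<Longrightarrow>
      b \<odot>\<^bsub>base_change A B\<^esub> (I +>\<^bsub>P\<^esub> F) = I +>\<^bsub>P\<^esub> (frag_of (\<one>\<^bsub>A\<^esub>, b) \<otimes>\<^bsub>P\<^esub> F)"
    and "F \<in> carrier P \<Longrightarrow> G \<in> carrier P \<Longrightarrow> I +>\<^bsub>P\<^esub> F = I +>\<^bsub>P\<^esub> G \<longleftrightarrow> F - G \<in> I"
proof -
  interpret A: cring A by fact
  interpret B: cring B by fact
  interpret P: cring P unfolding P_def by (intro cring_pair_monoid_ring assms)
  interpret I: ideal I P unfolding P_def I_def by (intro ideal_tensor_ideal assms)
  have pt: "pure_tensor A B a b = I +>\<^bsub>P\<^esub> frag_of (a, b)" for a b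
    by (simp add: pure_tensor_def P_def I_def)
  have bc: "carrier (base_change A B) = carrier (P Quot I)" "mult (base_change A B) = mult (P Quot I)"
    "add (base_change A B) = add (P Quot I)" "one (base_change A B) = one (P Quot I)" "zero (base_change A B) = zero (P Quot I)"
    "b \<odot>\<^bsub>base_change A B\<^esub> x = (I +>\<^bsub>P\<^esub> frag_of (\<one>\<^bsub>A\<^esub>, b)) \<otimes>\<^bsub>P Quot I\<^esub> x" for b x
    by (simp_all add: base_change_def Let_def P_def I_def pure_tensor_def)
  show "carrier (base_change A B) = (\<lambda>F. I +>\<^bsub>P\<^esub> F) ` carrier P"
    unfolding bc by (auto simp: FactRing_def A_RCOSETS_def')
  show mult: "(I +>\<^bsub>P\<^esub> F) \<otimes>\<^bsub>base_change A B\<^esub> (I +>\<^bsub>P\<^esub> G) = I +>\<^bsub>P\<^esub> (F \<otimes>\<^bsub>P\<^esub> G)"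
    if "F \<in> carrier P" "G \<in> carrier P" for F G
    unfolding bc using that I.rcoset_mult_add by (simp add: FactRing_def)
  show "(I +>\<^bsub>P\<^esub> F) \<oplus>\<^bsub>base_change A B\<^esub> (I +>\<^bsub>P\<^esub> G) = I +>\<^bsub>P\<^esub> (F + G)"
    if "F \<in> carrier P" "G \<in> carrier P"
    unfolding bc using that I.a_rcos_sum by (simp add: FactRing_def P_def pair_monoid_ring_simps(4))
  show "\<one>\<^bsub>base_change A B\<^esub> = I +>\<^bsub>P\<^esub> frag_of (\<one>\<^bsub>A\<^esub>, \<one>\<^bsub>B\<^esub>)"
    unfolding bc by (simp add: FactRing_def P_def pair_monoid_ring_simps(2))
  have "I +>\<^bsub>P\<^esub> \<zero>\<^bsub>P\<^esub> = I" using I.a_subset by (rule P.a_coset_add_zero)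
  thus "\<zero>\<^bsub>base_change A B\<^esub> = I +>\<^bsub>P\<^esub> 0" unfolding bc by (simp add: FactRing_def P_def pair_monoid_ring_simps(3))
  show "b \<odot>\<^bsub>base_change A B\<^esub> (I +>\<^bsub>P\<^esub> F) = I +>\<^bsub>P\<^esub> (frag_of (\<one>\<^bsub>A\<^esub>, b) \<otimes>\<^bsub>P\<^esub> F)"
    if "b \<in> carrier B" "F \<in> carrier P"
    using mult[of "frag_of (\<one>\<^bsub>A\<^esub>, b)" F] that unfolding bc
    by (simp add: P_def pair_carrier_intros)
  show "I +>\<^bsub>P\<^esub> F = I +>\<^bsub>P\<^esub> G \<longleftrightarrow> F - G \<in> I" if F: "F \<in> carrier P" and G: "G \<in> carrier P"
  proof -
    have m: "F \<ominus>\<^bsub>P\<^esub> G = F - G" unfolding P_def by (rule pair_minus) (use assms F G in \<open>auto simp: P_def\<close>)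
    show ?thesis
    proof
      assume "I +>\<^bsub>P\<^esub> F = I +>\<^bsub>P\<^esub> G"
      hence "F \<in> I +>\<^bsub>P\<^esub> G" using I.a_rcos_self[OF F] by simp
      thus "F - G \<in> I" using I.a_rcos_module[OF G F] m by (simp add: a_minus_def)
    next
      assume "F - G \<in> I"
      hence "F \<in> I +>\<^bsub>P\<^esub> G" using I.a_rcos_module[OF G F] m by (simp add: a_minus_def)
      from I.a_repr_independence'[OF this G] show "I +>\<^bsub>P\<^esub> F = I +>\<^bsub>P\<^esub> G" by simp
    qed
  qed
qed

lemma pure_tensor_add:
  assumes "cring A" "cring B"
  shows "a \<in> carrier A \<Longrightarrow> a' \<in> carrier A \<Longrightarrow> b \<in> carrier B \<Longrightarrow>
      pure_tensor A B (a \<oplus>\<^bsub>A\<^esub> a') b = pure_tensor A B a b \<oplus>\<^bsub>base_change A B\<^esub> pure_tensor A B a' b"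
    and "a \<in> carrier A \<Longrightarrow> b \<in> carrier B \<Longrightarrow> b' \<in> carrier B \<Longrightarrow>
      pure_tensor A B a (b \<oplus>\<^bsub>B\<^esub> b') = pure_tensor A B a b \<oplus>\<^bsub>base_change A B\<^esub> pure_tensor A B a b'"
proof -
  interpret A: cring A by fact
  interpret B: cring B by fact
  interpret P: cring "pair_monoid_ring A B" by (intro cring_pair_monoid_ring assms)
  note b = base_change_simps[OF assms]
  note pc = pair_carrier_intros[where A = A and B = B]
  have rel: "tensor_relations A B \<subseteq> tensor_ideal A B"
    unfolding tensor_ideal_def by (intro P.genideal_self tensor_relations_closed assms)
  show "pure_tensor A B (a \<oplus>\<^bsub>A\<^esub> a') b = pure_tensor A B a b \<oplus>\<^bsub>base_change A B\<^esub> pure_tensor A B a' b"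
    if "a \<in> carrier A" "a' \<in> carrier A" "b \<in> carrier B"
  proof -
    have "frag_of (a \<oplus>\<^bsub>A\<^esub> a', b) - frag_of (a, b) - frag_of (a', b) \<in> tensor_ideal A B"
      using that by (intro subsetD[OF rel]) (auto simp: tensor_relations_def)
    thus ?thesis using that unfolding pure_tensor_def by (simp add: b(3,7) pc diff_diff_eq)
  qed
  show "pure_tensor A B a (b \<oplus>\<^bsub>B\<^esub> b') = pure_tensor A B a b \<oplus>\<^bsub>base_change A B\<^esub> pure_tensor A B a b'"
    if "a \<in> carrier A" "b \<in> carrier B" "b' \<in> carrier B"
  proof -
    have "frag_of (a, b \<oplus>\<^bsub>B\<^esub> b') - frag_of (a, b) - frag_of (a, b') \<in> tensor_ideal A B"
      using that by (intro subsetD[OF rel]) (auto simp: tensor_relations_def)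
    thus ?thesis using that unfolding pure_tensor_def by (simp add: b(3,7) pc diff_diff_eq)
  qed
qed

lemma module_base_change:
  assumes "cring A" "cring B"
  shows "module B (base_change A B)"
proof -
  interpret A: cring A by fact
  interpret B: cring B by fact
  let ?P = "pair_monoid_ring A B"
  interpret P: cring ?P by (intro cring_pair_monoid_ring assms)
  note b = base_change_simps[OF assms]
  note pc = pair_carrier_intros[where A = A and B = B]
  note pa = pair_monoid_ring_simps(4)[of A B]
  have mult: "F \<otimes>\<^bsub>?P\<^esub> G \<in> carrier ?P" if "F \<in> carrier ?P" "G \<in> carrier ?P" for F G using that by (rule P.m_closed)
  have ab: "abelian_group (base_change A B)"
  proof (rule abelian_groupI)
    show "\<exists>y\<in>carrier (base_change A B). y \<oplus>\<^bsub>base_change A B\<^esub> x = \<zero>\<^bsub>base_change A B\<^esub>"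
      if x: "x \<in> carrier (base_change A B)" for x
    proof -
      obtain F where F: "F \<in> carrier ?P" "x = tensor_ideal A B +>\<^bsub>?P\<^esub> F" using x unfolding b(1) by blast
      have F': "0 - F \<in> carrier ?P" by (intro pc F)
      have "tensor_ideal A B +>\<^bsub>?P\<^esub> (0 - F) \<in> carrier (base_change A B)" using F' unfolding b(1) by blast
      moreover have "(tensor_ideal A B +>\<^bsub>?P\<^esub> (0 - F)) \<oplus>\<^bsub>base_change A B\<^esub> x = \<zero>\<^bsub>base_change A B\<^esub>"
        unfolding F(2) b(3)[OF F' F(1)] b(5) by simp
      ultimately show ?thesis by blast
    qed
  qed (auto simp: b(1,3,5) pc add_ac)
  show ?thesis
  proof (rule moduleI[OF assms(2) ab])
    fix r s x assume A: "r \<in> carrier B" "s \<in> carrier B" "x \<in> carrier (base_change A B)"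
    obtain F where F: "F \<in> carrier ?P" "x = tensor_ideal A B +>\<^bsub>?P\<^esub> F" using A(3) unfolding b(1) by blast
    have pt: "pure_tensor A B \<one>\<^bsub>A\<^esub> r = tensor_ideal A B +>\<^bsub>?P\<^esub> frag_of (\<one>\<^bsub>A\<^esub>, r)" for r by (simp add: pure_tensor_def)
    have sm: "r \<odot>\<^bsub>base_change A B\<^esub> x = pure_tensor A B \<one>\<^bsub>A\<^esub> r \<otimes>\<^bsub>base_change A B\<^esub> x" if "r \<in> carrier B" for r
      using that F by (simp add: b(2,6) pt pc)
    show "r \<odot>\<^bsub>base_change A B\<^esub> x \<in> carrier (base_change A B)"
      using A F by (auto simp: b(1,6) pc intro!: imageI mult)
    show "(r \<oplus>\<^bsub>B\<^esub> s) \<odot>\<^bsub>base_change A B\<^esub> x = r \<odot>\<^bsub>base_change A B\<^esub> x \<oplus>\<^bsub>base_change A B\<^esub> s \<odot>\<^bsub>base_change A B\<^esub> x"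
    proof -
      let ?I = "tensor_ideal A B"
      let ?r = "frag_of (\<one>\<^bsub>A\<^esub>, r)" and ?s = "frag_of (\<one>\<^bsub>A\<^esub>, s)" and ?rs = "frag_of (\<one>\<^bsub>A\<^esub>, r \<oplus>\<^bsub>B\<^esub> s)"
      have c: "?r \<in> carrier ?P" "?s \<in> carrier ?P" "?rs \<in> carrier ?P" using A by (auto intro!: pc)
      have "?I +>\<^bsub>?P\<^esub> ?rs = ?I +>\<^bsub>?P\<^esub> (?r + ?s)"
        using pure_tensor_add(2)[OF assms A.one_closed A(1,2)] unfolding pt b(3)[OF c(1,2)] .
      hence "(r \<oplus>\<^bsub>B\<^esub> s) \<odot>\<^bsub>base_change A B\<^esub> x = (?I +>\<^bsub>?P\<^esub> (?r + ?s)) \<otimes>\<^bsub>base_change A B\<^esub> x"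
        using A sm[of "r \<oplus>\<^bsub>B\<^esub> s"] by (simp add: pt)
      also have "\<dots> = ?I +>\<^bsub>?P\<^esub> (?r \<otimes>\<^bsub>?P\<^esub> F + ?s \<otimes>\<^bsub>?P\<^esub> F)"
        unfolding F(2) b(2)[OF pc(3)[OF c(1,2)] F(1)] pair_mult ..
      also have "\<dots> = r \<odot>\<^bsub>base_change A B\<^esub> x \<oplus>\<^bsub>base_change A B\<^esub> s \<odot>\<^bsub>base_change A B\<^esub> x"
        unfolding F(2) b(6)[OF A(1) F(1)] b(6)[OF A(2) F(1)]
        by (rule b(3)[symmetric]) (intro mult c F)+
      finally show ?thesis .
    qed
    show "(r \<otimes>\<^bsub>B\<^esub> s) \<odot>\<^bsub>base_change A B\<^esub> x = r \<odot>\<^bsub>base_change A B\<^esub> (s \<odot>\<^bsub>base_change A B\<^esub> x)"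
    proof -
      have "frag_of (\<one>\<^bsub>A\<^esub>, r) \<otimes>\<^bsub>?P\<^esub> (frag_of (\<one>\<^bsub>A\<^esub>, s) \<otimes>\<^bsub>?P\<^esub> F) = frag_of (\<one>\<^bsub>A\<^esub>, r \<otimes>\<^bsub>B\<^esub> s) \<otimes>\<^bsub>?P\<^esub> F"
        using A F(1) pc(2)[of "\<one>\<^bsub>A\<^esub>"] by (simp add: P.m_assoc[symmetric] pair_mult)
      thus ?thesis using A F by (simp add: b(6) pc mult)
    qed
  next
    fix r x y assume A: "r \<in> carrier B" "x \<in> carrier (base_change A B)" "y \<in> carrier (base_change A B)"
    then obtain F G where F: "F \<in> carrier ?P" "x = tensor_ideal A B +>\<^bsub>?P\<^esub> F"
      and G: "G \<in> carrier ?P" "y = tensor_ideal A B +>\<^bsub>?P\<^esub> G" unfolding b(1) by blast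
    show "r \<odot>\<^bsub>base_change A B\<^esub> (x \<oplus>\<^bsub>base_change A B\<^esub> y) = r \<odot>\<^bsub>base_change A B\<^esub> x \<oplus>\<^bsub>base_change A B\<^esub> r \<odot>\<^bsub>base_change A B\<^esub> y"
      using A F G by (simp add: b(3,6) pc mult pair_mult)
  next
    fix x assume "x \<in> carrier (base_change A B)"
    then obtain F where F: "F \<in> carrier ?P" "x = tensor_ideal A B +>\<^bsub>?P\<^esub> F" unfolding b(1) by blast
    have "frag_of (\<one>\<^bsub>A\<^esub>, \<one>\<^bsub>B\<^esub>) \<otimes>\<^bsub>?P\<^esub> F = F" using P.l_one[OF F(1)] by (simp add: pair_monoid_ring_simps(2))
    thus "\<one>\<^bsub>B\<^esub> \<odot>\<^bsub>base_change A B\<^esub> x = x" using F by (simp add: b(6))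
  qed
qed

section \<open>The index form over the l-adic integers\<close>

text \<open>Determinants of \<open>l\<close>-adic matrices are replaced by determinants of integer representatives modulo
  \<open>l\<^sup>k\<close>; the indexing by functions suits rows that are given by coordinate functions.\<close>

definition int_det :: "nat \<Rightarrow> (nat \<Rightarrow> nat \<Rightarrow> int) \<Rightarrow> int" where
  "int_det n c = det (mat n n (\<lambda>(i, j). c i j))"

lemma int_det_leibniz:
  "int_det n c = (\<Sum>p | p permutes {0..<n}. of_int (sign p) * (\<Prod>i = 0..<n. c i (p i)))"
proof -
  have "int_det n c = (\<Sum>p | p permutes {0..<n}. of_int (sign p) * (\<Prod>i = 0..<n. mat n n (\<lambda>(i, j). c i j) $$ (i, p i)))"
    unfolding int_det_def by (rule det_def') simp
  also have "\<dots> = (\<Sum>p | p permutes {0..<n}. of_int (sign p) * (\<Prod>i = 0..<n. c i (p i)))"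
    by (intro sum.cong refl arg_cong2[of _ _ _ _ "(*)"] prod.cong) (auto dest: permutes_in_image)
  finally show ?thesis .
qed

lemma int_det_cong_mod:
  assumes "\<And>i j. i < n \<Longrightarrow> j < n \<Longrightarrow> [c i j = d i j] (mod q)"
  shows "[int_det n c = int_det n d] (mod q)"
  unfolding int_det_leibniz
  by (intro cong_sum cong_mult cong_refl cong_prod assms) (auto dest: permutes_in_image)

text \<open>Additivity and homogeneity in a row in one statement, with the row known only modulo \<open>q\<close>.\<close>

lemma int_det_row_linear_mod:
  assumes i: "i < n" and row: "\<And>j. j < n \<Longrightarrow> [c i j = s * d i j + u * e i j] (mod q)"
    and rest: "\<And>r j. r < n \<Longrightarrow> r \<noteq> i \<Longrightarrow> j < n \<Longrightarrow> c r j = d r j \<and> c r j = e r j"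
  shows "[int_det n c = s * int_det n d + u * int_det n e] (mod q)"
proof -
  have "[of_int (sign p) * (\<Prod>r = 0..<n. c r (p r)) =
      s * (of_int (sign p) * (\<Prod>r = 0..<n. d r (p r))) + u * (of_int (sign p) * (\<Prod>r = 0..<n. e r (p r)))] (mod q)"
    if p: "p permutes {0..<n}" for p
  proof -
    have pn: "p r < n" if "r < n" for r using permutes_in_image[OF p, of r] that by simp
    define R where "R = (\<Prod>r\<in>{0..<n}-{i}. c r (p r))"
    have split: "(\<Prod>r = 0..<n. g r (p r)) = g i (p i) * (\<Prod>r\<in>{0..<n}-{i}. g r (p r))" for g :: "nat \<Rightarrow> nat \<Rightarrow> int"
      using i by (simp add: prod.remove)
    have same: "d r (p r) = c r (p r) \<and> e r (p r) = c r (p r)" if "r \<in> {0..<n} - {i}" for r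
      using rest[of r "p r"] pn[of r] that by simp
    have Rd: "(\<Prod>r\<in>{0..<n}-{i}. d r (p r)) = R" and Re: "(\<Prod>r\<in>{0..<n}-{i}. e r (p r)) = R"
      unfolding R_def using same by (auto intro: prod.cong)
    have "[of_int (sign p) * (c i (p i) * R) = of_int (sign p) * ((s * d i (p i) + u * e i (p i)) * R)] (mod q)"
      by (intro cong_mult cong_refl row pn i)
    thus ?thesis unfolding split[of c] split[of d] split[of e] Rd Re R_def[symmetric]
      by (simp add: algebra_simps)
  qed
  hence "[int_det n c = (\<Sum>p | p permutes {0..<n}. s * (of_int (sign p) * (\<Prod>r = 0..<n. d r (p r)))
       + u * (of_int (sign p) * (\<Prod>r = 0..<n. e r (p r))))] (mod q)"
    unfolding int_det_leibniz[of n c] by (intro cong_sum) auto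
  thus ?thesis unfolding int_det_leibniz[of n d] int_det_leibniz[of n e] sum_distrib_left sum.distrib .
qed

lemma int_det_equal_rows:
  assumes "i < n" "j < n" "i \<noteq> j" "\<And>k. k < n \<Longrightarrow> c i k = c j k"
  shows "int_det n c = 0"
  unfolding int_det_def
  by (rule det_identical_rows[OF _ assms(3,1,2)]) (use assms in \<open>auto intro!: eq_vecI\<close>)

lemma int_det_identity: "int_det n (\<lambda>i j. if i = j then 1 else 0) = 1"
proof -
  have "mat n n (\<lambda>(i, j). if i = j then 1 else 0) = (1\<^sub>m n :: int mat)" by (intro eq_matI) auto
  thus ?thesis by (simp add: int_det_def)
qed

text \<open>Used to compare the two actions of an integer on a tensor, on the left and on the right factor.\<close>

lemma additive_int_maps_eqI:
  fixes f g :: "int \<Rightarrow> 'm" and M (structure)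
  assumes M: "abelian_group M" and closed: "\<And>r. f r \<in> carrier M" "\<And>r. g r \<in> carrier M"
    and add: "\<And>r s. f (r + s) = f r \<oplus> f s" "\<And>r s. g (r + s) = g r \<oplus> g s"
    and one: "f 1 = g 1"
  shows "f r = g r"
proof -
  interpret M: abelian_group M by fact
  have zero: "h 0 = \<zero>" if "\<And>r. h r \<in> carrier M" "\<And>r s. h (r + s) = h r \<oplus> h s" for h :: "int \<Rightarrow> 'm"
    using that(2)[of 0 0] that(1)[of 0] M.add.l_cancel_one by simp
  show ?thesis
  proof (induction r rule: int_induct[where k = 0])
    case base
    show ?case using zero[of f] zero[of g] closed add by simp
  next
    case (step1 i)
    thus ?case using add one by simp
  next
    case (step2 i)
    have "f (i - 1) \<oplus> f 1 = g (i - 1) \<oplus> f 1"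
      using add(1)[of "i - 1" 1] add(2)[of "i - 1" 1] step2 one by simp
    thus ?case using M.add.right_cancel[of "f 1" "f (i - 1)" "g (i - 1)"] closed by simp
  qed
qed

text \<open>The ring as a module over itself, the target of alternating forms.\<close>

definition self_module :: "('a, 'x) ring_scheme \<Rightarrow> ('a, 'a) module" where
  "self_module R = \<lparr>carrier = carrier R, mult = mult R, one = one R, zero = zero R, add = add R, smult = mult R\<rparr>"

lemma self_module_simps [simp]:
  "carrier (self_module R) = carrier R" "zero (self_module R) = zero R" "add (self_module R) = add R"
  "r \<odot>\<^bsub>self_module R\<^esub> x = r \<otimes>\<^bsub>R\<^esub> x"
  by (simp_all add: self_module_def)

lemma module_self_module:
  assumes "cring R"
  shows "module R (self_module R)"
proof -
  interpret R: cring R by fact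
  have "abelian_group (self_module R)"
    by (rule abelian_groupI) (auto simp: R.a_ac intro: R.l_neg)
  thus ?thesis by (intro moduleI assms) (auto simp: R.l_distr R.r_distr R.m_assoc)
qed

context trinomial_root
begin

section \<open>Coordinates of local integers\<close>

definition coord :: "complex \<Rightarrow> nat \<Rightarrow> int" where
  "coord a = (SOME b. a = (\<Sum>i<n. of_int (b i) * \<alpha> ^ i))"

lemma coord_expand: "a \<in> adj \<alpha> \<Longrightarrow> a = (\<Sum>i<n. of_int (coord a i) * \<alpha> ^ i)"
proof -
  assume "a \<in> adj \<alpha>"
  hence "\<exists>b::nat \<Rightarrow> int. a = (\<Sum>i<n. of_int (b i) * \<alpha> ^ i)" by (simp only: adj_basis)
  from someI_ex[OF this] show ?thesis unfolding coord_def .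
qed

lemma coord_eqI: "a = (\<Sum>i<n. of_int (b i) * \<alpha> ^ i) \<Longrightarrow> i < n \<Longrightarrow> coord a i = b i"
proof -
  assume a: "a = (\<Sum>i<n. of_int (b i) * \<alpha> ^ i)" and i: "i < n"
  hence "a \<in> adj \<alpha>" unfolding adj_basis by blast
  from coord_expand[OF this] a have "(\<Sum>i<n. of_int (coord a i) * \<alpha> ^ i) = (\<Sum>i<n. of_int (b i) * \<alpha> ^ i)" by simp
  from basis_unique[OF this i] show "coord a i = b i" .
qed

lemma coord_add: "a \<in> adj \<alpha> \<Longrightarrow> b \<in> adj \<alpha> \<Longrightarrow> i < n \<Longrightarrow> coord (a + b) i = coord a i + coord b i"
proof (rule coord_eqI)
  assume "a \<in> adj \<alpha>" "b \<in> adj \<alpha>"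
  from coord_expand[OF this(1)] coord_expand[OF this(2)]
  have "a + b = (\<Sum>i<n. of_int (coord a i) * \<alpha> ^ i) + (\<Sum>i<n. of_int (coord b i) * \<alpha> ^ i)" by simp
  also have "\<dots> = (\<Sum>i<n. of_int (coord a i + coord b i) * \<alpha> ^ i)"
    by (simp add: distrib_right sum.distrib)
  finally show "a + b = (\<Sum>i<n. of_int (coord a i + coord b i) * \<alpha> ^ i)" .
qed

lemma coord_power: "i < n \<Longrightarrow> j < n \<Longrightarrow> coord (\<alpha> ^ i) j = (if i = j then 1 else 0)"
proof (rule coord_eqI)
  assume i: "i < n"
  have "(\<Sum>j<n. of_int (if i = j then 1 else 0) * \<alpha> ^ j) = (\<Sum>j<n. if i = j then \<alpha> ^ j else 0)"
    by (intro sum.cong) auto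
  thus "\<alpha> ^ i = (\<Sum>j<n. of_int (if i = j then 1 else 0) * \<alpha> ^ j)" using i by simp
qed

text \<open>Multiplication by a fixed element is given by an integer matrix in the coordinates.\<close>

lemma coord_mult:
  assumes "a0 \<in> adj \<alpha>" "a \<in> adj \<alpha>" "j < n"
  shows "coord (a0 * a) j = (\<Sum>i<n. coord a i * coord (a0 * \<alpha> ^ i) j)"
proof (rule coord_eqI[OF _ assms(3)])
  have "a0 * a = a0 * (\<Sum>i<n. of_int (coord a i) * \<alpha> ^ i)" using coord_expand[OF assms(2)] by simp
  also have "\<dots> = (\<Sum>i<n. of_int (coord a i) * (a0 * \<alpha> ^ i))" by (simp add: sum_distrib_left mult.left_commute)
  also have "\<dots> = (\<Sum>i<n. of_int (coord a i) * (\<Sum>j<n. of_int (coord (a0 * \<alpha> ^ i) j) * \<alpha> ^ j))"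
  proof (intro sum.cong refl arg_cong2[of _ _ _ _ "(*)"])
    fix i show "a0 * \<alpha> ^ i = (\<Sum>j<n. of_int (coord (a0 * \<alpha> ^ i) j) * \<alpha> ^ j)"
      by (rule coord_expand) (intro adj_mult assms adj_power adj_self)
  qed
  also have "\<dots> = (\<Sum>i<n. \<Sum>j<n. of_int (coord a i * coord (a0 * \<alpha> ^ i) j) * \<alpha> ^ j)"
    by (simp only: sum_distrib_left of_int_mult mult.assoc)
  also have "\<dots> = (\<Sum>j<n. \<Sum>i<n. of_int (coord a i * coord (a0 * \<alpha> ^ i) j) * \<alpha> ^ j)" by (rule sum.swap)
  also have "\<dots> = (\<Sum>j<n. of_int (\<Sum>i<n. coord a i * coord (a0 * \<alpha> ^ i) j) * \<alpha> ^ j)"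
    by (simp only: of_int_sum sum_distrib_right)
  finally show "a0 * a = (\<Sum>j<n. of_int (\<Sum>i<n. coord a i * coord (a0 * \<alpha> ^ i) j) * \<alpha> ^ j)" .
qed

abbreviation OK :: "(int, complex) module" where "OK \<equiv> ring_of_integers K"

lemma cring_OK: "cring OK" and module_OK: "module \<Z> OK"
  using algebra_ring_of_integers[OF subring_K] by blast+

context
  fixes l :: nat
  assumes l: "l > 0"
begin

abbreviation Zl :: "(nat \<Rightarrow> int) ring" where "Zl \<equiv> padic_int_ring l"
abbreviation P :: "(complex \<times> (nat \<Rightarrow> int) \<Rightarrow>\<^sub>0 int) ring" where "P \<equiv> pair_monoid_ring OK Zl"
abbreviation I :: "(complex \<times> (nat \<Rightarrow> int) \<Rightarrow>\<^sub>0 int) set" where "I \<equiv> tensor_ideal OK Zl"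
abbreviation OL :: "(nat \<Rightarrow> int, (complex \<times> (nat \<Rightarrow> int) \<Rightarrow>\<^sub>0 int) set) module" where "OL \<equiv> base_change OK Zl"

lemmas cring_Zl = cring_padic[OF l]
lemmas OL_simps = base_change_simps[OF cring_OK cring_Zl]

text \<open>The coordinate of index \<open>j\<close>, to the precision \<open>l\<^sup>k\<close>, of the tensor that a formal sum represents.\<close>

definition formal_coord :: "nat \<Rightarrow> nat \<Rightarrow> (complex \<times> (nat \<Rightarrow> int) \<Rightarrow>\<^sub>0 int) \<Rightarrow> int" where
  "formal_coord k j = frag_sum (\<lambda>(a, b). coord a j * b k)"

lemma formal_coord_simps [simp]:
  "formal_coord k j 0 = 0" "formal_coord k j (frag_of (a, b)) = coord a j * b k"
  "formal_coord k j (F + G) = formal_coord k j F + formal_coord k j G"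
  "formal_coord k j (F - G) = formal_coord k j F - formal_coord k j G"
  "formal_coord k j (- F) = - formal_coord k j F"
  by (simp_all add: formal_coord_def)

text \<open>Multiplication by a pure tensor acts on the vector of coordinates by an \<open>l\<close>-adic matrix; the
  congruence absorbs the reduction of the products of second components.\<close>

lemma formal_coord_mult:
  assumes a: "a \<in> adj \<alpha>" and G: "G \<in> carrier P" and j: "j < n"
  shows "[formal_coord k j (frag_of (a, b) \<otimes>\<^bsub>P\<^esub> G) =
     b k * (\<Sum>i<n. coord (a * \<alpha> ^ i) j * formal_coord k i G)] (mod int l ^ k)"
  using G
proof (induction G rule: pair_carrier_induct)
  case (one a' b')
  hence a': "a' \<in> adj \<alpha>" by (simp add: integers_K)
  have "formal_coord k j (frag_of (a, b) \<otimes>\<^bsub>P\<^esub> frag_of (a', b')) = coord (a * a') j * ((b k * b' k) mod int l ^ k)"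
    by (simp add: pair_mult)
  also have "[\<dots> = coord (a * a') j * (b k * b' k)] (mod int l ^ k)"
    by (intro cong_mult cong_refl) (simp add: cong_def)
  also have "coord (a * a') j * (b k * b' k) = b k * (\<Sum>i<n. coord (a * \<alpha> ^ i) j * formal_coord k i (frag_of (a', b')))"
    unfolding coord_mult[OF a a' j] by (simp add: sum_distrib_left sum_distrib_right mult_ac)
  finally show ?case .
next
  case (diff F G)
  have "formal_coord k j (frag_of (a, b) \<otimes>\<^bsub>P\<^esub> (F - G)) =
    formal_coord k j (frag_of (a, b) \<otimes>\<^bsub>P\<^esub> F) - formal_coord k j (frag_of (a, b) \<otimes>\<^bsub>P\<^esub> G)"
    by (simp add: pair_mult)
  also have "[\<dots> = b k * (\<Sum>i<n. coord (a * \<alpha> ^ i) j * formal_coord k i F)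
      - b k * (\<Sum>i<n. coord (a * \<alpha> ^ i) j * formal_coord k i G)] (mod int l ^ k)"
    by (intro cong_diff diff)
  also have "b k * (\<Sum>i<n. coord (a * \<alpha> ^ i) j * formal_coord k i F)
      - b k * (\<Sum>i<n. coord (a * \<alpha> ^ i) j * formal_coord k i G)
    = b k * (\<Sum>i<n. coord (a * \<alpha> ^ i) j * formal_coord k i (F - G))"
    by (simp add: right_diff_distrib sum_subtractf)
  finally show ?case .
qed (simp add: pair_mult)

text \<open>The formal sums whose coordinates all vanish modulo \<open>l\<^sup>k\<close> form an ideal, by the previous lemma, and
  the relations of biadditivity lie in it.\<close>

lemma formal_coord_ideal:
  assumes "F \<in> I" "j < n"
  shows "int l ^ k dvd formal_coord k j F"
proof -
  interpret P: cring P by (intro cring_pair_monoid_ring cring_OK cring_Zl)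
  define J where "J = {F \<in> carrier P. \<forall>j<n. int l ^ k dvd formal_coord k j F}"
  have absorb: "G \<otimes>\<^bsub>P\<^esub> F \<in> J" if G: "G \<in> carrier P" and F: "F \<in> J" for F G
  proof -
    have Fc: "F \<in> carrier P" using F by (simp add: J_def)
    have "int l ^ k dvd formal_coord k j (G \<otimes>\<^bsub>P\<^esub> F)" if j: "j < n" for j
      using G
    proof (induction G rule: pair_carrier_induct)
      case (one a b)
      hence a: "a \<in> adj \<alpha>" by (simp add: integers_K)
      have "int l ^ k dvd b k * (\<Sum>i<n. coord (a * \<alpha> ^ i) j * formal_coord k i F)"
      proof (intro dvd_mult dvd_sum)
        fix i assume "i \<in> {..<n}"
        thus "int l ^ k dvd formal_coord k i F" using F by (simp add: J_def)
      qed
      thus ?case using formal_coord_mult[OF a Fc j, of k b] cong_dvd_iff by blast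
    qed (auto simp: pair_mult intro: dvd_diff)
    thus ?thesis using G Fc by (simp add: J_def)
  qed
  have "ideal J P"
  proof (rule idealI)
    show "ring P" by (rule P.ring_axioms)
    show "subgroup J (add_monoid P)"
    proof (rule P.add.subgroupI)
      show "J \<subseteq> carrier P" by (auto simp: J_def)
      show "J \<noteq> {}" by (auto simp: J_def intro!: exI[of _ 0] pair_carrier_intros)
      fix F assume F: "F \<in> J"
      have "\<ominus>\<^bsub>P\<^esub> F = 0 - F"
        using pair_minus[OF cring_OK cring_Zl pair_carrier_intros(1), of F] F P.minus_eq[of 0 F] P.l_zero[of "\<ominus>\<^bsub>P\<^esub> F"]
        by (simp add: J_def a_minus_def pair_monoid_ring_simps(3))
      thus "\<ominus>\<^bsub>P\<^esub> F \<in> J"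
        using F pair_carrier_intros(4)[OF pair_carrier_intros(1), of F OK Zl] by (simp add: J_def)
    next
      fix F G assume "F \<in> J" "G \<in> J"
      thus "F \<oplus>\<^bsub>P\<^esub> G \<in> J"
        using pair_carrier_intros(3)[of F OK Zl G] by (auto simp: J_def pair_monoid_ring_simps(4))
    qed
    show "G \<otimes>\<^bsub>P\<^esub> F \<in> J" if "F \<in> J" "G \<in> carrier P" for F G using absorb that by blast
    show "F \<otimes>\<^bsub>P\<^esub> G \<in> J" if "F \<in> J" "G \<in> carrier P" for F G
      using absorb[OF that(2,1)] P.m_comm[of F G] that by (simp add: J_def)
  qed
  moreover have "tensor_relations OK Zl \<subseteq> J"
  proof
    fix F assume F: "F \<in> tensor_relations OK Zl"
    have Fc: "F \<in> carrier P" using F tensor_relations_closed[OF cring_OK cring_Zl] by blast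
    have "int l ^ k dvd formal_coord k j F" if j: "j < n" for j
    proof -
      consider a a' b where "F = frag_of (a \<oplus>\<^bsub>OK\<^esub> a', b) - frag_of (a, b) - frag_of (a', b)"
          "a \<in> carrier OK" "a' \<in> carrier OK"
        | a b b' where "F = frag_of (a, b \<oplus>\<^bsub>Zl\<^esub> b') - frag_of (a, b) - frag_of (a, b')"
        using F unfolding tensor_relations_def by blast
      thus ?thesis
      proof cases
        case 1
        thus ?thesis using coord_add[of a a' j] j by (simp add: integers_K distrib_right)
      next
        case 2
        have "[(b k + b' k) mod int l ^ k = b k + b' k] (mod int l ^ k)" by (simp add: cong_def)
        hence "int l ^ k dvd ((b k + b' k) mod int l ^ k) - (b k + b' k)" by (simp add: cong_iff_dvd_diff)
        hence "int l ^ k dvd coord a j * (((b k + b' k) mod int l ^ k) - (b k + b' k))" by (rule dvd_mult)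
        also have "\<dots> = formal_coord k j F" by (simp add: 2 right_diff_distrib distrib_left)
        finally show ?thesis .
      qed
    qed
    thus "F \<in> J" using Fc by (simp add: J_def)
  qed
  ultimately have "I \<subseteq> J" unfolding tensor_ideal_def by (rule P.genideal_minimal)
  thus ?thesis using assms by (auto simp: J_def)
qed

lemma formal_coord_Suc:
  assumes "F \<in> carrier P"
  shows "[formal_coord (Suc k) j F = formal_coord k j F] (mod int l ^ k)"
  using assms
proof (induction F rule: pair_carrier_induct)
  case (one a b)
  show ?case by (simp, intro cong_mult cong_refl padic_cong_Suc one)
next
  case (diff F G)
  show ?case by (simp, intro cong_diff diff)
qed simp

text \<open>Defined through an arbitrary representative: only the residue modulo \<open>l\<^sup>k\<close> is meaningful.\<close>

definition local_coord :: "(complex \<times> (nat \<Rightarrow> int) \<Rightarrow>\<^sub>0 int) set \<Rightarrow> nat \<Rightarrow> nat \<Rightarrow> int" where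
  "local_coord x j k = formal_coord k j (SOME F. F \<in> carrier P \<and> x = I +>\<^bsub>P\<^esub> F)"

lemma local_coord_rep:
  assumes "x \<in> carrier OL"
  obtains F where "F \<in> carrier P" "x = I +>\<^bsub>P\<^esub> F" "\<And>j k. local_coord x j k = formal_coord k j F"
proof -
  let ?F = "SOME F. F \<in> carrier P \<and> x = I +>\<^bsub>P\<^esub> F"
  have "\<exists>F. F \<in> carrier P \<and> x = I +>\<^bsub>P\<^esub> F" using assms unfolding OL_simps(1) by blast
  hence "?F \<in> carrier P \<and> x = I +>\<^bsub>P\<^esub> ?F" by (rule someI_ex)
  thus ?thesis by (intro that[of ?F]) (auto simp: local_coord_def)
qed

lemma local_coord_coset:
  assumes F: "F \<in> carrier P" and j: "j < n"
  shows "[local_coord (I +>\<^bsub>P\<^esub> F) j k = formal_coord k j F] (mod int l ^ k)"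
proof -
  have "I +>\<^bsub>P\<^esub> F \<in> carrier OL" using F unfolding OL_simps(1) by blast
  then obtain G where G: "G \<in> carrier P" "I +>\<^bsub>P\<^esub> F = I +>\<^bsub>P\<^esub> G"
    "\<And>j k. local_coord (I +>\<^bsub>P\<^esub> F) j k = formal_coord k j G" by (rule local_coord_rep) blast
  have "G - F \<in> I" using OL_simps(7)[OF G(1) F] G(2) by simp
  from formal_coord_ideal[OF this j, of k] show ?thesis by (simp add: G(3) cong_iff_dvd_diff)
qed

lemma local_coord_add:
  assumes x: "x \<in> carrier OL" and y: "y \<in> carrier OL" and j: "j < n"
  shows "[local_coord (x \<oplus>\<^bsub>OL\<^esub> y) j k = local_coord x j k + local_coord y j k] (mod int l ^ k)"
proof -
  obtain F where F: "F \<in> carrier P" "x = I +>\<^bsub>P\<^esub> F" "\<And>j k. local_coord x j k = formal_coord k j F"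
    using local_coord_rep[OF x] by blast
  obtain G where G: "G \<in> carrier P" "y = I +>\<^bsub>P\<^esub> G" "\<And>j k. local_coord y j k = formal_coord k j G"
    using local_coord_rep[OF y] by blast
  have "[local_coord (I +>\<^bsub>P\<^esub> (F + G)) j k = formal_coord k j (F + G)] (mod int l ^ k)"
    by (rule local_coord_coset[OF _ j]) (intro pair_carrier_intros F G)
  moreover have "x \<oplus>\<^bsub>OL\<^esub> y = I +>\<^bsub>P\<^esub> (F + G)" unfolding F(2) G(2) by (rule OL_simps(3)[OF F(1) G(1)])
  ultimately show ?thesis by (simp add: F(3) G(3))
qed

lemma local_coord_smult:
  assumes x: "x \<in> carrier OL" and r: "r \<in> carrier Zl" and j: "j < n"
  shows "[local_coord (r \<odot>\<^bsub>OL\<^esub> x) j k = r k * local_coord x j k] (mod int l ^ k)"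
proof -
  interpret P: cring P by (intro cring_pair_monoid_ring cring_OK cring_Zl)
  obtain F where F: "F \<in> carrier P" "x = I +>\<^bsub>P\<^esub> F" "\<And>j k. local_coord x j k = formal_coord k j F"
    using local_coord_rep[OF x] by blast
  have c: "frag_of (\<one>\<^bsub>OK\<^esub>, r) \<in> carrier P"
    by (rule pair_carrier_intros(2)) (use r in \<open>auto simp: integers_K\<close>)
  have "[local_coord (I +>\<^bsub>P\<^esub> (frag_of (\<one>\<^bsub>OK\<^esub>, r) \<otimes>\<^bsub>P\<^esub> F)) j k = formal_coord k j (frag_of (\<one>\<^bsub>OK\<^esub>, r) \<otimes>\<^bsub>P\<^esub> F)] (mod int l ^ k)"
    by (rule local_coord_coset[OF P.m_closed[OF c F(1)] j])
  also have "[formal_coord k j (frag_of (\<one>\<^bsub>OK\<^esub>, r) \<otimes>\<^bsub>P\<^esub> F) =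
      r k * (\<Sum>i<n. coord (\<one>\<^bsub>OK\<^esub> * \<alpha> ^ i) j * formal_coord k i F)] (mod int l ^ k)"
    by (rule formal_coord_mult[OF _ F(1) j]) auto
  also have "(\<Sum>i<n. coord (\<one>\<^bsub>OK\<^esub> * \<alpha> ^ i) j * formal_coord k i F) = (\<Sum>i<n. if i = j then formal_coord k i F else 0)"
    by (intro sum.cong) (auto simp: coord_power j)
  also have "\<dots> = formal_coord k j F" using j by simp
  finally show ?thesis unfolding F(2) OL_simps(6)[OF r F(1)] using F(2,3) by simp
qed

text \<open>The determinant of the coordinates, as the sequence of its residues.\<close>

definition local_det :: "(complex \<times> (nat \<Rightarrow> int) \<Rightarrow>\<^sub>0 int) set list \<Rightarrow> nat \<Rightarrow> int" where
  "local_det xs k = int_det n (\<lambda>i j. local_coord (xs ! i) j k) mod int l ^ k"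

lemma local_det_cong: "[local_det xs k = int_det n (\<lambda>i j. local_coord (xs ! i) j k)] (mod int l ^ k)"
  by (simp add: local_det_def cong_def)

lemma local_det_eqI: "[a = int_det n (\<lambda>i j. local_coord (xs ! i) j k)] (mod int l ^ k) \<Longrightarrow> local_det xs k = a mod int l ^ k"
  by (simp add: local_det_def cong_def)

lemma multilinear_alternating_local_det:
  "multilinear_alternating Zl n OL (\<lambda>r. r) (self_module Zl) local_det"
  unfolding multilinear_alternating_def
proof (intro conjI ballI allI impI)
  fix xs assume xs: "xs \<in> tuples n OL"
  hence mem: "xs ! i \<in> carrier OL" if "i < n" for i using that by (auto simp: tuples_def dest: nth_mem)
  have "(\<lambda>k. int_det n (\<lambda>i j. local_coord (xs ! i) j k) mod int l ^ k) \<in> carrier Zl"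
  proof (intro padic_carrier_modI l int_det_cong_mod)
    fix k i j assume "i < n" "j < n"
    obtain F where "F \<in> carrier P" "xs ! i = I +>\<^bsub>P\<^esub> F" "\<And>j k. local_coord (xs ! i) j k = formal_coord k j F"
      using local_coord_rep[OF mem[OF \<open>i < n\<close>]] by blast
    thus "[local_coord (xs ! i) j (Suc k) = local_coord (xs ! i) j k] (mod int l ^ k)"
      using formal_coord_Suc by simp
  qed
  moreover have "local_det xs = (\<lambda>k. int_det n (\<lambda>i j. local_coord (xs ! i) j k) mod int l ^ k)"
    by (rule ext) (simp add: local_det_def)
  ultimately show "local_det xs \<in> carrier (self_module Zl)" by simp
  fix i j assume ij: "i < j" "j < n" "xs ! i = xs ! j"
  hence "int_det n (\<lambda>i j. local_coord (xs ! i) j k) = 0" for k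
    by (intro int_det_equal_rows[of i n j]) auto
  thus "local_det xs = \<zero>\<^bsub>self_module Zl\<^esub>" by (simp add: local_det_def fun_eq_iff)
next
  fix xs i u v assume A: "xs \<in> tuples n OL" "i < n" "u \<in> carrier OL" "v \<in> carrier OL"
  have len: "length xs = n" using A by (simp add: tuples_def)
  show "local_det (xs[i := u \<oplus>\<^bsub>OL\<^esub> v]) = local_det (xs[i := u]) \<oplus>\<^bsub>self_module Zl\<^esub> local_det (xs[i := v])"
  proof (rule ext)
    fix k
    have 1: "[int_det n (\<lambda>r j. local_coord (xs[i := u \<oplus>\<^bsub>OL\<^esub> v] ! r) j k) =
       1 * int_det n (\<lambda>r j. local_coord (xs[i := u] ! r) j k) + 1 * int_det n (\<lambda>r j. local_coord (xs[i := v] ! r) j k)] (mod int l ^ k)"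
      by (rule int_det_row_linear_mod[OF A(2)]) (use A len local_coord_add in auto)
    have 2: "[local_det (xs[i := u]) k + local_det (xs[i := v]) k =
       int_det n (\<lambda>r j. local_coord (xs[i := u] ! r) j k) + int_det n (\<lambda>r j. local_coord (xs[i := v] ! r) j k)] (mod int l ^ k)"
      by (intro cong_add local_det_cong)
    have "[local_det (xs[i := u]) k + local_det (xs[i := v]) k =
        int_det n (\<lambda>r j. local_coord (xs[i := u \<oplus>\<^bsub>OL\<^esub> v] ! r) j k)] (mod int l ^ k)"
      by (rule cong_trans[OF 2 cong_sym[OF 1[unfolded mult_1]]])
    from local_det_eqI[OF this]
    show "local_det (xs[i := u \<oplus>\<^bsub>OL\<^esub> v]) k = (local_det (xs[i := u]) \<oplus>\<^bsub>self_module Zl\<^esub> local_det (xs[i := v])) k"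
      by simp
  qed
next
  fix xs i r u assume A: "xs \<in> tuples n OL" "i < n" "r \<in> carrier Zl" "u \<in> carrier OL"
  have len: "length xs = n" using A by (simp add: tuples_def)
  show "local_det (xs[i := r \<odot>\<^bsub>OL\<^esub> u]) = r \<odot>\<^bsub>self_module Zl\<^esub> local_det (xs[i := u])"
  proof (rule ext)
    fix k
    have 1: "[int_det n (\<lambda>s j. local_coord (xs[i := r \<odot>\<^bsub>OL\<^esub> u] ! s) j k) =
       r k * int_det n (\<lambda>s j. local_coord (xs[i := u] ! s) j k) + 0 * int_det n (\<lambda>s j. local_coord (xs[i := u] ! s) j k)] (mod int l ^ k)"
      by (rule int_det_row_linear_mod[OF A(2)]) (use A len local_coord_smult in auto)
    have 2: "[r k * local_det (xs[i := u]) k =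
       r k * int_det n (\<lambda>s j. local_coord (xs[i := u] ! s) j k)] (mod int l ^ k)"
      by (intro cong_mult cong_refl local_det_cong)
    have "[r k * local_det (xs[i := u]) k =
        int_det n (\<lambda>s j. local_coord (xs[i := r \<odot>\<^bsub>OL\<^esub> u] ! s) j k)] (mod int l ^ k)"
      by (rule cong_trans[OF 2 cong_sym[OF 1[unfolded mult_zero_left add_0_right]]])
    from local_det_eqI[OF this]
    show "local_det (xs[i := r \<odot>\<^bsub>OL\<^esub> u]) k = (r \<odot>\<^bsub>self_module Zl\<^esub> local_det (xs[i := u])) k" by simp
  qed
qed

definition power_tensors :: "(complex \<times> (nat \<Rightarrow> int) \<Rightarrow>\<^sub>0 int) set list" where
  "power_tensors = map (\<lambda>i. pure_tensor OK Zl (\<alpha> ^ i) \<one>\<^bsub>Zl\<^esub>) [0..<n]"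

lemma pure_power_closed: "a \<in> adj \<alpha> \<Longrightarrow> frag_of (a, \<one>\<^bsub>Zl\<^esub>) \<in> carrier P"
proof -
  interpret B: cring Zl by (rule cring_Zl)
  show "a \<in> adj \<alpha> \<Longrightarrow> frag_of (a, \<one>\<^bsub>Zl\<^esub>) \<in> carrier P"
    using B.one_closed by (intro pair_carrier_intros(2)) (simp_all only: integers_K)
qed

lemma pure_tensor_closed: "a \<in> adj \<alpha> \<Longrightarrow> pure_tensor OK Zl a \<one>\<^bsub>Zl\<^esub> \<in> carrier OL"
  unfolding pure_tensor_def OL_simps(1) by (intro imageI pure_power_closed)

lemma power_tensors_tuple: "power_tensors \<in> tuples n OL"
  by (auto simp: power_tensors_def tuples_def simp del: padic_simps intro!: pure_tensor_closed)

lemma local_det_power_tensors: "local_det power_tensors = \<one>\<^bsub>Zl\<^esub>"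
proof (rule ext)
  fix k
  have "[int_det n (\<lambda>i j. local_coord (power_tensors ! i) j k) = int_det n (\<lambda>i j. if i = j then 1 else 0)] (mod int l ^ k)"
  proof (rule int_det_cong_mod)
    fix i j assume ij: "i < n" "j < n"
    have "power_tensors ! i = I +>\<^bsub>P\<^esub> frag_of (\<alpha> ^ i, \<one>\<^bsub>Zl\<^esub>)" using ij by (simp add: power_tensors_def pure_tensor_def)
    hence "[local_coord (power_tensors ! i) j k = formal_coord k j (frag_of (\<alpha> ^ i, \<one>\<^bsub>Zl\<^esub>))] (mod int l ^ k)"
      using local_coord_coset[OF pure_power_closed ij(2), of "\<alpha> ^ i" k] by (simp add: adj_power adj_self)
    also have "formal_coord k j (frag_of (\<alpha> ^ i, \<one>\<^bsub>Zl\<^esub>)) = (if i = j then 1 else 0) * (1 mod int l ^ k)"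
      using ij by (simp add: coord_power)
    also have "[\<dots> = (if i = j then 1 else 0) * 1] (mod int l ^ k)"
      by (intro cong_mult cong_refl) (simp add: cong_def)
    finally show "[local_coord (power_tensors ! i) j k = (if i = j then 1 else 0)] (mod int l ^ k)" by simp
  qed
  from local_det_eqI[OF cong_sym[OF this]] show "local_det power_tensors k = \<one>\<^bsub>Zl\<^esub> k"
    by (simp add: int_det_identity)
qed

text \<open>The tensor product is balanced over the integers: both sides are additive in \<open>r\<close> and agree at
  \<open>r = 1\<close>.\<close>

lemma pure_tensor_of_int_mult:
  assumes u: "u \<in> adj \<alpha>"
  shows "pure_tensor OK Zl (of_int r * u) \<one>\<^bsub>Zl\<^esub> = padic_of_int l r \<odot>\<^bsub>OL\<^esub> pure_tensor OK Zl u \<one>\<^bsub>Zl\<^esub>"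
proof -
  interpret B: cring Zl by (rule cring_Zl)
  interpret M: module Zl OL by (rule module_base_change[OF cring_OK cring_Zl])
  note hom = padic_of_int_hom[OF l]
  have hc: "padic_of_int l r \<in> carrier Zl" for r using ring_hom_closed[OF hom, of r] by simp
  have uc: "pure_tensor OK Zl u \<one>\<^bsub>Zl\<^esub> \<in> carrier OL" by (rule pure_tensor_closed[OF u])
  have ru: "of_int r * u \<in> adj \<alpha>" for r by (intro adj_mult adj_of_int u)
  have h1: "padic_of_int l 1 = \<one>\<^bsub>Zl\<^esub>" using ring_hom_one[OF hom] by simp
  show ?thesis
  proof (rule additive_int_maps_eqI[where M = OL, where f = "\<lambda>r. pure_tensor OK Zl (of_int r * u) \<one>\<^bsub>Zl\<^esub>"])
    show "abelian_group OL" by (rule M.M.abelian_group_axioms)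
    show "pure_tensor OK Zl (of_int r * u) \<one>\<^bsub>Zl\<^esub> \<in> carrier OL" for r by (rule pure_tensor_closed[OF ru])
    show "padic_of_int l r \<odot>\<^bsub>OL\<^esub> pure_tensor OK Zl u \<one>\<^bsub>Zl\<^esub> \<in> carrier OL" for r
      by (rule M.smult_closed[OF hc uc])
    show "pure_tensor OK Zl (of_int (r + s) * u) \<one>\<^bsub>Zl\<^esub> =
       pure_tensor OK Zl (of_int r * u) \<one>\<^bsub>Zl\<^esub> \<oplus>\<^bsub>OL\<^esub> pure_tensor OK Zl (of_int s * u) \<one>\<^bsub>Zl\<^esub>" for r s
      using pure_tensor_add(1)[OF cring_OK cring_Zl, of "of_int r * u" "of_int s * u" "\<one>\<^bsub>Zl\<^esub>"] ru B.one_closed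
      by (simp add: integers_K distrib_right del: padic_simps)
    show "padic_of_int l (r + s) \<odot>\<^bsub>OL\<^esub> pure_tensor OK Zl u \<one>\<^bsub>Zl\<^esub> =
       padic_of_int l r \<odot>\<^bsub>OL\<^esub> pure_tensor OK Zl u \<one>\<^bsub>Zl\<^esub> \<oplus>\<^bsub>OL\<^esub> padic_of_int l s \<odot>\<^bsub>OL\<^esub> pure_tensor OK Zl u \<one>\<^bsub>Zl\<^esub>" for r s
      using M.smult_l_distr[OF hc hc uc, of r s] ring_hom_add[OF hom, of r s] by (simp del: padic_simps)
    show "pure_tensor OK Zl (of_int 1 * u) \<one>\<^bsub>Zl\<^esub> = padic_of_int l 1 \<odot>\<^bsub>OL\<^esub> pure_tensor OK Zl u \<one>\<^bsub>Zl\<^esub>"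
      unfolding h1 M.smult_one[OF uc] by simp
  qed
qed

lemma pure_tensor_nat_pow:
  "pure_tensor OK Zl \<alpha> \<one>\<^bsub>Zl\<^esub> [^]\<^bsub>OL\<^esub> (i::nat) = pure_tensor OK Zl (\<alpha> ^ i) \<one>\<^bsub>Zl\<^esub>"
proof (induction i)
  case 0
  show ?case by (simp add: nat_pow_def OL_simps(4) pure_tensor_def)
next
  case (Suc i)
  interpret B: cring Zl by (rule cring_Zl)
  have "pure_tensor OK Zl \<alpha> \<one>\<^bsub>Zl\<^esub> [^]\<^bsub>OL\<^esub> Suc i =
      pure_tensor OK Zl (\<alpha> ^ i) \<one>\<^bsub>Zl\<^esub> \<otimes>\<^bsub>OL\<^esub> pure_tensor OK Zl \<alpha> \<one>\<^bsub>Zl\<^esub>"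
    using Suc by (simp add: nat_pow_def)
  also have "\<dots> = I +>\<^bsub>P\<^esub> (frag_of (\<alpha> ^ i, \<one>\<^bsub>Zl\<^esub>) \<otimes>\<^bsub>P\<^esub> frag_of (\<alpha>, \<one>\<^bsub>Zl\<^esub>))"
    unfolding pure_tensor_def by (intro OL_simps(2) pure_power_closed adj_power adj_self)
  also have "frag_of (\<alpha> ^ i, \<one>\<^bsub>Zl\<^esub>) \<otimes>\<^bsub>P\<^esub> frag_of (\<alpha>, \<one>\<^bsub>Zl\<^esub>) = frag_of (\<alpha> ^ Suc i, \<one>\<^bsub>Zl\<^esub>)"
    unfolding pair_mult using B.l_one[OF B.one_closed] by (simp del: padic_simps add: mult.commute)
  finally show ?case by (simp add: pure_tensor_def)
qed

end

end

section \<open>Absence of a local obstruction\<close>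

context trinomial_root
begin

lemma power_basis_tuple: "map (\<lambda>i. \<alpha> ^ i) [0..<n] \<in> tuples n OK"
  by (auto simp: tuples_def integers_K intro!: adj_power adj_self)

lemma power_basis_generates:
  assumes H: "submodule H \<Z> OK" and b: "\<And>j. j < n \<Longrightarrow> \<alpha> ^ j \<in> H"
  shows "carrier OK \<subseteq> H"
proof
  fix z assume "z \<in> carrier OK"
  hence "z \<in> adj \<alpha>" by (simp add: integers_K)
  then obtain c :: "nat \<Rightarrow> int" where c: "z = (\<Sum>i<n. of_int (c i) * \<alpha> ^ i)" using adj_basis by blast
  interpret M: module \<Z> OK by (rule module_OK)
  note HE = M.submoduleE[OF H]
  have "(\<Sum>i<m. of_int (c i) * \<alpha> ^ i) \<in> H" if "m \<le> n" for m
    using that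
  proof (induction m)
    case 0
    show ?case using submodule.axioms(1)[OF H] subgroup.one_closed[of H "add_monoid OK"] by simp
  next
    case (Suc m)
    have "c m \<odot>\<^bsub>OK\<^esub> \<alpha> ^ m \<in> H" using b Suc.prems by (intro HE(4)) auto
    thus ?case using HE(5)[of "\<Sum>i<m. of_int (c i) * \<alpha> ^ i" "c m \<odot>\<^bsub>OK\<^esub> \<alpha> ^ m"] Suc by simp
  qed
  thus "z \<in> H" using c by simp
qed

lemma orientation_power_basis: "orientation K (wedge \<Z> OK (map (\<lambda>i. \<alpha> ^ i) [0..<n]))"
proof -
  have top: "carrier (exterior_power \<Z> n OK) =
    {r \<odot>\<^bsub>exterior_power \<Z> n OK\<^esub> wedge \<Z> OK (map (\<lambda>i. \<alpha> ^ i) [0..<n]) |r. r \<in> carrier \<Z>}"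
    by (rule exterior_power_top_cyclic[OF module_OK _ power_basis_generates])
       (auto simp: integers_K intro!: adj_power adj_self)
  have "wedge \<Z> OK (map (\<lambda>i. \<alpha> ^ i) [0..<n]) \<in> carrier (exterior_power \<Z> n OK)"
    by (rule multilinear_alternating_wedge[OF module_OK, of n, unfolded multilinear_alternating_def,
        THEN conjunct1, rule_format, OF power_basis_tuple])
  thus ?thesis unfolding orientation_def field_degree_K Let_def using top by (rule conjI)
qed

text \<open>The wedge of the powers of \<open>\<alpha> \<otimes> 1\<close> is the image of the orientation, so 1 is a coefficient; by
  the determinant it is the only one.\<close>

lemma local_index_form_eq_one:
  assumes l: "l > 0"
  shows "local_index_form K (wedge \<Z> OK (map (\<lambda>i. \<alpha> ^ i) [0..<n])) l
    (pure_tensor OK (padic_int_ring l) \<alpha> \<one>\<^bsub>padic_int_ring l\<^esub>) = padic_of_int l 1"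
proof -
  let ?Zl = "padic_int_ring l" and ?M = "base_change OK (padic_int_ring l)"
  let ?g = "\<lambda>a. pure_tensor OK ?Zl a \<one>\<^bsub>?Zl\<^esub>"
  let ?pt = "power_tensors l"
  note M = module_base_change[OF cring_OK cring_padic[OF l]]
  interpret M: module ?Zl ?M by (rule M)
  interpret O: cring OK by (rule cring_OK)
  interpret W: module ?Zl "exterior_power ?Zl n ?M" by (rule module_exterior_power[OF M])
  have pt: "?pt = map ?g (map (\<lambda>i. \<alpha> ^ i) [0..<n])" by (simp add: power_tensors_def[OF l])
  have smult: "?g (r \<odot>\<^bsub>OK\<^esub> u) = padic_of_int l r \<odot>\<^bsub>?M\<^esub> ?g u" if u: "u \<in> carrier OK" for r u
    using pure_tensor_of_int_mult[OF l, of u r] u by (simp add: integers_K del: padic_simps)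
  have emap: "exterior_map \<Z> ?Zl n ?M (padic_of_int l) ?g (wedge \<Z> OK (map (\<lambda>i. \<alpha> ^ i) [0..<n])) = wedge ?Zl ?M ?pt"
    unfolding pt
  proof (rule exterior_map_wedge[OF module_OK M padic_of_int_hom[OF l] _ _ _ power_basis_tuple])
    show "?g u \<in> carrier ?M" if "u \<in> carrier OK" for u
      using pure_tensor_closed[OF l] that by (simp only: integers_K)
    show "?g (u \<oplus>\<^bsub>OK\<^esub> v) = ?g u \<oplus>\<^bsub>?M\<^esub> ?g v" if "u \<in> carrier OK" "v \<in> carrier OK" for u v
      by (rule pure_tensor_add(1)[OF cring_OK cring_padic[OF l] that M.R.one_closed])
    show "?g (r \<odot>\<^bsub>OK\<^esub> u) = padic_of_int l r \<odot>\<^bsub>?M\<^esub> ?g u" if "r \<in> carrier \<Z>" "u \<in> carrier OK" for r u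
      using smult that by blast
  qed
  have pow: "map (\<lambda>i. ?g \<alpha> [^]\<^bsub>?M\<^esub> i) [0..<n] = ?pt"
    unfolding power_tensors_def[OF l] by (intro map_cong refl pure_tensor_nat_pow[OF l])
  note w = multilinear_alternating_wedge[OF M, of n]
  have wc: "wedge ?Zl ?M ?pt \<in> carrier (exterior_power ?Zl n ?M)"
    by (rule w[unfolded multilinear_alternating_def, THEN conjunct1, rule_format, OF power_tensors_tuple[OF l]])
  have "local_index_form K (wedge \<Z> OK (map (\<lambda>i. \<alpha> ^ i) [0..<n])) l (?g \<alpha>) =
    (THE r. r \<in> carrier ?Zl \<and> wedge ?Zl ?M ?pt = r \<odot>\<^bsub>exterior_power ?Zl n ?M\<^esub> wedge ?Zl ?M ?pt)"
    unfolding local_index_form_def local_integers_def field_degree_K emap index_coeff_def pow ..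
  also have "\<dots> = \<one>\<^bsub>?Zl\<^esub>"
  proof (rule the_equality)
    show "\<one>\<^bsub>?Zl\<^esub> \<in> carrier ?Zl \<and> wedge ?Zl ?M ?pt = \<one>\<^bsub>?Zl\<^esub> \<odot>\<^bsub>exterior_power ?Zl n ?M\<^esub> wedge ?Zl ?M ?pt"
      using W.smult_one[OF wc] M.R.one_closed by simp
    fix r assume r: "r \<in> carrier ?Zl \<and> wedge ?Zl ?M ?pt = r \<odot>\<^bsub>exterior_power ?Zl n ?M\<^esub> wedge ?Zl ?M ?pt"
    have "local_det l ?pt = r \<odot>\<^bsub>self_module ?Zl\<^esub> local_det l ?pt"
      using r by (intro wedge_multiple_unique[OF M module_self_module[OF cring_padic[OF l]]
        multilinear_alternating_local_det[OF l] power_tensors_tuple[OF l] power_tensors_tuple[OF l]]) auto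
    hence "\<one>\<^bsub>?Zl\<^esub> = r \<otimes>\<^bsub>?Zl\<^esub> \<one>\<^bsub>?Zl\<^esub>" unfolding local_det_power_tensors[OF l] self_module_simps .
    thus "r = \<one>\<^bsub>?Zl\<^esub>" using M.R.r_one[of r] r by (simp del: padic_simps)
  qed
  also have "\<dots> = padic_of_int l 1" by (simp add: padic_of_int_def)
  finally show ?thesis .
qed

theorem ABS_unobstructed_K: "ABS_unobstructed K"
  unfolding ABS_unobstructed_def
proof (intro conjI exI[of _ "wedge \<Z> OK (map (\<lambda>i. \<alpha> ^ i) [0..<n])"] bexI[of _ 1] allI impI)
  fix l :: nat assume "prime l"
  hence l: "l > 0" by (rule prime_gt_0_nat)
  show "\<exists>x\<in>carrier (local_integers K l). local_index_form K (wedge \<Z> OK (map (\<lambda>i. \<alpha> ^ i) [0..<n])) l x = padic_of_int l 1"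
  proof (rule bexI)
    show "pure_tensor OK (padic_int_ring l) \<alpha> \<one>\<^bsub>padic_int_ring l\<^esub> \<in> carrier (local_integers K l)"
      unfolding local_integers_def by (rule pure_tensor_closed[OF l adj_self])
  qed (rule local_index_form_eq_one[OF l])
next
  show "number_field K" by (rule number_field_K)
  show "orientation K (wedge \<Z> OK (map (\<lambda>i. \<alpha> ^ i) [0..<n]))" by (rule orientation_power_basis)
qed simp

end

text \<open>The given polynomial is \<open>c\<^sup>n f(X / c)\<close>.\<close>

lemma trinomial_root_if_is_root_F:
  assumes n: "n \<ge> 4" and c: "c \<ge> 2" and t: "t \<in> T_set_coprime n c" and root: "is_root_F n c t \<theta>"
  shows "trinomial_root n t (\<theta> / of_int c)"
proof
  have c0: "of_int c \<noteq> (0::complex)" using c by simp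
  show "n \<ge> 4" by fact
  show "\<bar>t\<bar> > 1" "Rings.coprime t (int (n * (n - 1)))" "squarefree (t * L_form n t)"
    using t unfolding T_set_coprime_def T_set_def coprime_iff_gcd_eq_1 by blast+
  have "poly (map_poly of_int (F_poly n c t)) \<theta> = ev ([:0, 1:] ^ n + [:c ^ n * t, c ^ (n - 1) * t:]) \<theta>"
    by (simp add: F_poly_def ev_def)
  also have "\<dots> = \<theta> ^ n + (of_int (c ^ n * t) + \<theta> * of_int (c ^ (n - 1) * t))" by simp
  finally have eq: "\<theta> ^ n + (of_int (c ^ n * t) + \<theta> * of_int (c ^ (n - 1) * t)) = 0"
    using root by (simp add: is_root_F_def)
  define \<alpha> where "\<alpha> = \<theta> / of_int c"
  have \<theta>: "\<theta> = of_int c * \<alpha>" using c0 by (simp add: \<alpha>_def)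
  have cn: "(of_int c :: complex) ^ n = of_int c * of_int c ^ (n - 1)" using n by (cases n) auto
  have rearrange: "d * e * a + (d * e * s + d * x * (e * s)) = (d * e) * (a + s * x + s)"
    for a d e s x :: complex by (simp add: algebra_simps)
  have "\<theta> ^ n + (of_int (c ^ n * t) + \<theta> * of_int (c ^ (n - 1) * t)) =
      of_int c ^ n * (\<alpha> ^ n + of_int t * \<alpha> + of_int t)"
    unfolding \<theta> power_mult_distrib of_int_mult of_int_power cn by (rule rearrange)
  hence "of_int c ^ n * (\<alpha> ^ n + of_int t * \<alpha> + of_int t) = 0" using eq by simp
  thus "(\<theta> / of_int c) ^ n + of_int t * (\<theta> / of_int c) + of_int t = 0"
    using c0 unfolding \<alpha>_def by simp
qed

theorem theorem7p10:
  fixes n :: nat and c :: int and N :: nat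
  assumes "n \<ge> 4" and "c \<ge> 2" and "N = n * (n - 1) div 2"
  shows
    "has_positive_density (T_set_coprime n c) \<and>
     (\<forall>t \<in> T_set_coprime n c. \<forall>\<theta>. is_root_F n c t \<theta> \<longrightarrow>
        ABS_unobstructed (rationals_adjoin \<theta>) \<and>
        integers_adjoin \<theta> \<subseteq> carrier (ring_of_integers (rationals_adjoin \<theta>)) \<and>
        int (additive_index (ring_of_integers (rationals_adjoin \<theta>)) (integers_adjoin \<theta>)) = c ^ N \<and>
        c ^ N > 1) \<and>
     (\<exists>S :: int set. has_positive_density S \<and>
        (\<forall>t \<in> S. \<forall>\<theta>. is_root_F n c t \<theta> \<longrightarrow>
           ABS_unobstructed (rationals_adjoin \<theta>) \<and>
           is_order (integers_adjoin \<theta>) (rationals_adjoin \<theta>) \<and>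
           integers_adjoin \<theta> \<subset> carrier (ring_of_integers (rationals_adjoin \<theta>)) \<and>
           int (additive_index (ring_of_integers (rationals_adjoin \<theta>)) (integers_adjoin \<theta>)) = c ^ N))"
proof -
  have "N \<ge> 1"
  proof -
    have "4 * 3 \<le> n * (n - 1)" using assms(1) by (intro mult_le_mono) auto
    thus ?thesis by (simp add: assms(3))
  qed
  hence cN: "c ^ N > 1" using assms(2) by (intro one_less_power) auto
  have main: "ABS_unobstructed (rationals_adjoin \<theta>) \<and>
      is_order (integers_adjoin \<theta>) (rationals_adjoin \<theta>) \<and>
      integers_adjoin \<theta> \<subset> carrier (ring_of_integers (rationals_adjoin \<theta>)) \<and>
      int (additive_index (ring_of_integers (rationals_adjoin \<theta>)) (integers_adjoin \<theta>)) = c ^ N"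
    if t: "t \<in> T_set_coprime n c" and root: "is_root_F n c t \<theta>" for t \<theta>
  proof -
    interpret trinomial_root n t "\<theta> / of_int c"
      by (rule trinomial_root_if_is_root_F[OF assms(1,2) t root])
    have \<theta>: "of_int c * (\<theta> / of_int c) = \<theta>" using assms(2) by simp
    have Q: "rationals_adjoin \<theta> = K" using rationals_adjoin_eq[of c] assms(2) by (simp add: \<theta>)
    have index: "int (additive_index (ring_of_integers K) (adj \<theta>)) = c ^ N"
      using additive_index_adj[of c] assms(2,3) by (simp add: \<theta>)
    have order: "is_order (adj \<theta>) K" using is_order_adj[of c] assms(2) by (simp add: \<theta>)
    have "\<theta> \<in> adj (\<theta> / of_int c)"
      using adj_mult[OF adj_of_int[of c] adj_self, of "\<theta> / of_int c"] by (simp only: \<theta>)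
    hence "adj \<theta> \<subseteq> adj (\<theta> / of_int c)"
      unfolding adj_def[of \<theta>] by (auto simp: ev_altdef intro!: adj_sum adj_mult adj_of_int adj_power)
    hence sub: "adj \<theta> \<subseteq> carrier (ring_of_integers K)" by (simp add: integers_K)
    have "adj \<theta> \<noteq> carrier (ring_of_integers K)"
    proof
      assume eq: "adj \<theta> = carrier (ring_of_integers K)"
      have "a_rcosets\<^bsub>ring_of_integers K\<^esub> (adj \<theta>) \<subseteq> {adj \<theta>}"
      proof
        fix X assume "X \<in> a_rcosets\<^bsub>ring_of_integers K\<^esub> (adj \<theta>)"
        then obtain z where z: "z \<in> adj \<theta>" "X = adj \<theta> +>\<^bsub>ring_of_integers K\<^esub> z"
          unfolding eq by (auto simp: A_RCOSETS_def')
        have "X = (\<lambda>h. h + z) ` adj \<theta>" using z(2) by (auto simp: a_r_coset_def')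
        also have "\<dots> = adj \<theta>"
        proof (intro equalityI subsetI)
          fix x assume "x \<in> (\<lambda>h. h + z) ` adj \<theta>"
          thus "x \<in> adj \<theta>" using z(1) by (auto intro: adj_add)
        next
          fix x assume "x \<in> adj \<theta>"
          hence "x - z \<in> adj \<theta>" using z(1) by (intro adj_diff)
          thus "x \<in> (\<lambda>h. h + z) ` adj \<theta>" by (rule image_eqI[rotated]) simp
        qed
        finally show "X \<in> {adj \<theta>}" by simp
      qed
      hence "additive_index (ring_of_integers K) (adj \<theta>) \<le> card {adj \<theta>}"
        unfolding additive_index_def by (intro card_mono) auto
      thus False using index cN by simp
    qed
    thus ?thesis unfolding Q integers_adjoin_eq using ABS_unobstructed_K index order sub by blast
  qed
  have dens: "has_positive_density (T_set_coprime n c)"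
    by (rule T_set_coprime_has_positive_density[OF assms(1,2)])
  show ?thesis
  proof (intro conjI ballI allI impI)
    show "\<exists>S :: int set. has_positive_density S \<and>
        (\<forall>t \<in> S. \<forall>\<theta>. is_root_F n c t \<theta> \<longrightarrow>
           ABS_unobstructed (rationals_adjoin \<theta>) \<and>
           is_order (integers_adjoin \<theta>) (rationals_adjoin \<theta>) \<and>
           integers_adjoin \<theta> \<subset> carrier (ring_of_integers (rationals_adjoin \<theta>)) \<and>
           int (additive_index (ring_of_integers (rationals_adjoin \<theta>)) (integers_adjoin \<theta>)) = c ^ N)"
      using dens main by blast
  qed (use dens main cN in blast)+
qed

end
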